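(* Let $p(z)=a_0z^n+a_1z^{n-1}+\dots+a_n$ be a real polynomial of degree $n\geqslant 1$ with $a_0>0$. Then $p$ is generalized Hurwitz (of type I) if and only if $$\Delta_{n-1}(p)>0,\ \Delta_{n-3}(p)>0,\ \Delta_{n-5}(p)>0,\ \ldots$$ (all indices $\geqslant 1$ of this parity). In this case the order $k$ of $p$ equals $$k=v(a_n,a_{n-2},\ldots,1)=v(a_n,a_{n-1},a_{n-3},\ldots,1)\quad\text{if } a_n\neq0,$$ $$k=v(a_{n-2},a_{n-4},\ldots,1)+1=v(a_{n-1},a_{n-3},\ldots,1)+1\quad\text{if } a_n=0,$$ where $v$ is the number of strong sign changes.
   Context: The number of strong sign changes $v(x_1,\dots,x_m)$ of a sequence of real numbers is the number of sign changes in the sequence of its nonzero entries. In each sequence above the indices decrease in steps of $2$ (after the first entry $a_n$ in $v(a_n,a_{n-1},a_{n-3},\dots,1)$) down to $0$ or $1$, and the final entry is the number $1$; a sequence with no such indices is just $(1)$. Put $a_i=0$ for $i<0$ and $i>n$. The Hurwitz determinant $\Delta_j(p)$ ($1\leqslant j\leqslant n$) is the determinant of the $j\times j$ matrix whose $(r,s)$ entry is $a_{2s-r}$, i.e. with first rows $(a_1,a_3,a_5,\dots)$, $(a_0,a_2,a_4,\dots)$, $(0,a_1,a_3,\dots)$, $(0,a_0,a_2,\dots)$, etc. Generalized Hurwitz polynomials. A real polynomial $p$ of degree $n$ with positive leading coefficient is generalized Hurwitz of type I of order $k$, $0\leqslant k\leqslant[(n+1)/2]$, if: (i) it has exactly $k$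 zeroes in the closed right half-plane, all of which are nonnegative real and simple, $0\leqslant\mu_1<\mu_2<\dots<\mu_k$; (ii) $p(-\mu_i)\neq0$ for every positive $\mu_i$; (iii) $p$ has an odd number of zeroes, counting multiplicities, on each interval $(-\mu_k,-\mu_{k-1}),\dots,(-\mu_2,-\mu_1)$; (iv) the number of zeroes of $p$ on $(-\mu_1,0)$ (if any) is even, counting multiplicities; (v) the remaining real zeroes lie on $(-\infty,-\mu_k)$: an odd number of them when $n$ is even and an even number when $n$ is odd, counting multiplicities; (vi) all nonreal zeroes lie in the open left half-plane. For $k=0$ this means that $p$ is Hurwitz stable (all zeroes in the open left half-plane), conditions (ii)-(v) being void. "Generalized Hurwitz" means generalized Hurwitz of type I of some order. *)

theory Defs
  imports Complex_Main "Jordan_Normal_Form.Determinant"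
begin

text \<open>
  The coefficients of \<open>p(z) = a\<^sub>0 z\<^sup>n + a\<^sub>1 z\<^sup>n\<^sup>-\<^sup>1 + \<dots> + a\<^sub>n\<close> with \<open>n = degree p\<close>, numbered from the
  leading one downwards and padded by \<open>a\<^sub>i = 0\<close> for \<open>i < 0\<close> and \<open>i > n\<close>. The index is an
  integer, so that subtraction of indices does not truncate.
\<close>

definition hcoeff :: "real poly \<Rightarrow> int \<Rightarrow> real" where
  "hcoeff p i = (if 0 \<le> i \<and> i \<le> int (degree p) then coeff p (degree p - nat i) else 0)"

text \<open>
  The \<open>(r, s)\<close> entry is \<open>a\<^bsub>2s - r\<^esub>\<close> for \<open>1 \<le> r, s \<le> j\<close>; library matrices are indexed from 0.
\<close>

definition hurwitz_matrix :: "real poly \<Rightarrow> nat \<Rightarrow> real mat" where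
  "hurwitz_matrix p j = mat j j (\<lambda>(r, s). hcoeff p (2 * (int s + 1) - (int r + 1)))"

definition hurwitz_det :: "real poly \<Rightarrow> nat \<Rightarrow> real" where
  "hurwitz_det p j = det (hurwitz_matrix p j)"

definition strong_sign_changes :: "real list \<Rightarrow> nat" where
  "strong_sign_changes xs =
     (let ys = filter (\<lambda>x. x \<noteq> 0) xs
      in card {i. Suc i < length ys \<and> ys ! i * ys ! Suc i < 0})"

text \<open>
  The list \<open>a\<^sub>m, a\<^bsub>m-2\<^esub>, a\<^bsub>m-4\<^esub>, \<dots>\<close> down to index 0 or 1, followed by the number 1;
  it is \<open>[1]\<close> if \<open>m < 0\<close>.
\<close>

definition step2_seq :: "real poly \<Rightarrow> int \<Rightarrow> real list" where
  "step2_seq p m = map (hcoeff p) (filter (\<lambda>i. even (m - i)) (rev [0..m])) @ [1]"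

definition num_real_zeros :: "real poly \<Rightarrow> real set \<Rightarrow> nat" where
  "num_real_zeros p S = (\<Sum>x | x \<in> S \<and> poly p x = 0. Polynomial.order x p)"

definition complex_zeros :: "real poly \<Rightarrow> complex set" where
  "complex_zeros p = {z. poly (map_poly complex_of_real p) z = 0}"

text \<open>
  Generalized Hurwitz polynomials of type I of order \<open>k\<close>; the zeros in the closed right
  half-plane are \<open>\<mu> 1 < \<dots> < \<mu> k\<close>. For \<open>k = 0\<close> the choice of \<open>\<mu>\<close> is
  irrelevant, (ii)-(v) are void and (i) says that all zeros lie in the open left half-plane.
\<close>

definition gen_hurwitz_order :: "real poly \<Rightarrow> nat \<Rightarrow> bool" where
  "gen_hurwitz_order p k \<longleftrightarrow>
     lead_coeff p > 0 \<and> k \<le> (degree p + 1) div 2 \<and>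
     (\<exists>\<mu> :: nat \<Rightarrow> real.
        \<comment> \<open>(i)\<close>
        strict_mono_on {1..k} \<mu> \<and>
        {z \<in> complex_zeros p. Re z \<ge> 0} = (\<lambda>i. complex_of_real (\<mu> i)) ` {1..k} \<and>
        (\<forall>i\<in>{1..k}. \<mu> i \<ge> 0 \<and> Polynomial.order (\<mu> i) p = 1) \<and>
        \<comment> \<open>(ii)\<close>
        (\<forall>i\<in>{1..k}. \<mu> i > 0 \<longrightarrow> poly p (- \<mu> i) \<noteq> 0) \<and>
        \<comment> \<open>(iii)\<close>
        (\<forall>i\<in>{1..<k}. odd (num_real_zeros p {- \<mu> (Suc i)<..<- \<mu> i})) \<and>
        \<comment> \<open>(iv)\<close>
        (k \<ge> 1 \<longrightarrow> even (num_real_zeros p {- \<mu> 1<..<0})) \<and>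
        \<comment> \<open>(v)\<close>
        (k \<ge> 1 \<longrightarrow>
           (\<forall>x. poly p x = 0 \<longrightarrow>
              x \<in> \<mu> ` {1..k} \<union> (\<Union>i\<in>{1..<k}. {- \<mu> (Suc i)<..<- \<mu> i}) \<union>
                {- \<mu> 1<..<0} \<union> {..<- \<mu> k}) \<and>
           (odd (num_real_zeros p {..<- \<mu> k}) \<longleftrightarrow> even (degree p))) \<and>
        \<comment> \<open>(vi)\<close>
        (\<forall>z\<in>complex_zeros p. z \<notin> \<real> \<longrightarrow> Re z < 0))"

definition gen_hurwitz :: "real poly \<Rightarrow> bool" where
  "gen_hurwitz p \<longleftrightarrow> (\<exists>k. gen_hurwitz_order p k)"

end

theory Submission
  imports
    Defs
    "HOL-Analysis.Complex_Transcendental"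
    "HOL-Computational_Algebra.Fundamental_Theorem_Algebra"
begin

text \<open>
  Write \<open>p(z) = P\<^sub>0(z\<^sup>2) + z P\<^sub>1(z\<^sup>2)\<close>. The property that ties both sides of the theorem
  together is that \<open>P\<^sub>0\<close> and \<open>P\<^sub>1\<close> have only real simple zeros and that these interlace with a
  prescribed sign pattern (\<open>interlaced\<close>): for even degree, \<open>P\<^sub>1 / P\<^sub>0\<close> is a sum of simple
  fractions with positive residues; for odd degree the same holds for \<open>- P\<^sub>0 / P\<^sub>1\<close> up to an
  additive constant.

  \<^emph>\<open>Determinants.\<close> Interlacing of \<open>A\<close> and \<open>B\<close> is inherited, in both directions, by \<open>B\<close> and the
  negative remainder of \<open>A\<close> modulo \<open>B\<close> (\<open>interlaced_step\<close>). Row operations perform the same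
  division inside the Hurwitz matrix and lower its order by two, so that every second Hurwitz
  determinant being positive says exactly that each step of the Euclidean algorithm lowers
  the degree by one and meets a positive leading coefficient (\<open>interlaced_iff_det_even_degree\<close>,
  \<open>interlaced_iff_det_odd_degree\<close>).

  \<^emph>\<open>Generalized Hurwitz polynomials.\<close> All the parity conditions of the definition amount to one
  inequality \<open>p(-\<mu>) p'(\<mu>) < 0\<close> at each positive zero \<open>\<mu>\<close>, because the derivative alternates in
  sign along consecutive simple zeros (\<open>gen_hurwitz_order_iff\<close>).

  \<^emph>\<open>Even degree.\<close> Given interlacing, \<open>p(z) = 0\<close> means \<open>P\<^sub>1(z\<^sup>2) / P\<^sub>0(z\<^sup>2) = -1 / z\<close>. The left side
  reverses the sign of the imaginary part of \<open>z\<^sup>2\<close>, which rules out nonreal zeros with nonnegative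
  real part, and the negative Wronskian gives the inequality at the real ones
  (\<open>interlaced_imp_right_zeros_alternating\<close>). Conversely, the nonnegative zeros of \<open>P\<^sub>0\<close> are found
  between the squares of the zeros \<open>\<mu>\<close>, since \<open>2 P\<^sub>0(\<mu>\<^sup>2) = p(-\<mu>)\<close>, and the negative ones from the
  increase of the argument of \<open>p(iy) = P\<^sub>0(-y\<^sup>2) + i y P\<^sub>1(-y\<^sup>2)\<close> along the imaginary axis
  (\<open>imaginary_axis_crossings\<close>, \<open>right_zeros_alternating_imp_interlaced\<close>). As a by-product the
  order of \<open>p\<close> is the number of nonnegative zeros of \<open>P\<^sub>0\<close>.

  \<^emph>\<open>Odd degree.\<close> Multiplication by \<open>1 + z / M\<close> with large \<open>M\<close> adds a zero far to the left, makes
  the degree even and alters nothing in the right half-plane (\<open>odd_degree_characterization\<close>).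

  \<^emph>\<open>The order.\<close> For polynomials with real simple zeros Descartes' rule of signs is an equality,
  which follows from comparing a polynomial with its derivative, an interlacing pair. Applied to
  \<open>P\<^sub>0\<close> and \<open>P\<^sub>1\<close> it turns the number of nonnegative zeros into the stated numbers of sign
  changes (\<open>card_right_zeros_interlaced\<close>). In odd degree the final entry \<open>1\<close> of the sequence
  stands for the leading coefficient of a small perturbation of \<open>P\<^sub>0\<close> of degree one more than
  that of \<open>P\<^sub>1\<close>.
\<close>

section \<open>Signs of real polynomials between their zeros\<close>

lemma strict_mono_on_lessThan_SucI:
  fixes x :: "nat \<Rightarrow> real"
  assumes "\<And>i. Suc i < d \<Longrightarrow> x i < x (Suc i)"
  shows "strict_mono_on {..<d} x"
proof -
  have "x i < x (i + Suc k)" if "i + Suc k < d" for i k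
    using that
  proof (induction k)
    case 0
    then show ?case using assms[of i] by simp
  next
    case (Suc k)
    then show ?case using assms[of "i + Suc k"] by simp
  qed
  then show ?thesis
    by (intro strict_mono_onI) (metis lessThan_iff less_iff_Suc_add add_Suc_right)
qed

lemma poly_same_sign:
  fixes p :: "real poly"
  assumes "\<And>x. min a b \<le> x \<Longrightarrow> x \<le> max a b \<Longrightarrow> poly p x \<noteq> 0"
  shows "poly p a * poly p b > 0"
proof (rule ccontr)
  assume "\<not> poly p a * poly p b > 0"
  moreover have "poly p a \<noteq> 0" "poly p b \<noteq> 0" using assms by auto
  ultimately have neg: "poly p a * poly p b < 0"
    by (metis linorder_neqE_linordered_idom mult_eq_0_iff)
  then have "a \<noteq> b" using not_square_less_zero by blast
  with neg obtain x where "min a b < x" "x < max a b" "poly p x = 0"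
    using poly_IVT[of a b p] poly_IVT[of b a p] by (cases "a < b") (auto simp: mult.commute)
  then show False using assms by force
qed

lemma poly_pos_above_roots:
  fixes p :: "real poly"
  assumes "lead_coeff p > 0" "\<And>x. x \<ge> a \<Longrightarrow> poly p x \<noteq> 0"
  shows "poly p a > 0"
proof -
  obtain N where N: "\<And>x. x \<ge> N \<Longrightarrow> poly p x \<ge> lead_coeff p"
    using poly_pinfty_gt_lc assms(1) by blast
  have "poly p a * poly p (max a N) > 0"
    using assms(2) by (intro poly_same_sign) auto
  moreover have "poly p (max a N) > 0"
    using N[of "max a N"] assms(1) by simp
  ultimately show ?thesis by (simp add: zero_less_mult_iff)
qed

lemma poly_sign_below_roots:
  fixes p :: "real poly"
  assumes "lead_coeff p > 0" "\<And>x. x \<le> a \<Longrightarrow> poly p x \<noteq> 0"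
  shows "(-1) ^ degree p * poly p a > 0"
proof -
  define q where "q = smult ((-1) ^ degree p) (p \<circ>\<^sub>p [:0, -1:])"
  have "lead_coeff q > 0"
    using assms(1) by (cases "even (degree p)") (simp_all add: q_def lead_coeff_comp)
  then have "poly q (- a) > 0"
    using assms(2) by (intro poly_pos_above_roots) (auto simp: q_def poly_pcompose)
  then show ?thesis by (simp add: q_def poly_pcompose)
qed

lemma poly_root_factor:
  fixes p :: "real poly"
  assumes "poly p a = 0"
  obtains q where "p = [:-a, 1:] * q" "poly q a = poly (pderiv p) a"
proof -
  obtain q where "p = [:-a, 1:] * q" using assms by (auto simp: poly_eq_0_iff_dvd)
  moreover from this have "poly q a = poly (pderiv p) a"
    by (simp only: pderiv_mult) (simp add: pderiv_pCons)
  ultimately show ?thesis using that by blast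
qed

text \<open>
  Dividing out the simple zero \<open>a\<close> leaves a polynomial that takes the value of the derivative
  at \<open>a\<close> and has no zero up to \<open>b\<close>.
\<close>

lemma poly_sign_right_of_simple_root:
  fixes p :: "real poly"
  assumes "poly p a = 0" "poly (pderiv p) a \<noteq> 0" "a < b"
    "\<And>x. a < x \<Longrightarrow> x \<le> b \<Longrightarrow> poly p x \<noteq> 0"
  shows "poly (pderiv p) a * poly p b > 0"
proof -
  obtain q where q: "p = [:-a, 1:] * q" "poly q a = poly (pderiv p) a"
    using poly_root_factor assms(1) by blast
  have "poly q a * poly q b > 0"
  proof (rule poly_same_sign)
    fix x assume "min a b \<le> x" "x \<le> max a b"
    then show "poly q x \<noteq> 0"
      using assms q by (cases "x = a") (auto simp: poly_mult)
  qed
  then have "(b - a) * (poly q a * poly q b) > 0" using assms(3) by simp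
  moreover have "poly p b = (b - a) * poly q b" by (simp add: q(1) algebra_simps)
  ultimately show ?thesis using q(2) by (simp only: mult.left_commute)
qed

lemma poly_sign_left_of_simple_root:
  fixes p :: "real poly"
  assumes "poly p a = 0" "poly (pderiv p) a \<noteq> 0" "b < a"
    "\<And>x. b \<le> x \<Longrightarrow> x < a \<Longrightarrow> poly p x \<noteq> 0"
  shows "poly (pderiv p) a * poly p b < 0"
proof -
  obtain q where q: "p = [:-a, 1:] * q" "poly q a = poly (pderiv p) a"
    using poly_root_factor assms(1) by blast
  have "poly q a * poly q b > 0"
  proof (rule poly_same_sign)
    fix x assume "min a b \<le> x" "x \<le> max a b"
    then show "poly q x \<noteq> 0"
      using assms q by (cases "x = a") (auto simp: poly_mult)
  qed
  then have "(b - a) * (poly q a * poly q b) < 0" using assms(3) by (simp add: mult_neg_pos)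
  moreover have "poly p b = (b - a) * poly q b" by (simp add: q(1) algebra_simps)
  ultimately show ?thesis using q(2) by (simp only: mult.left_commute)
qed

text \<open>
  The midpoint lies to the right of one zero and to the left of the other, so its sign decides
  both derivatives.
\<close>

lemma pderiv_sign_consecutive_roots:
  fixes p :: "real poly"
  assumes "a < b" "poly p a = 0" "poly p b = 0" "poly (pderiv p) a \<noteq> 0" "poly (pderiv p) b \<noteq> 0"
    "\<And>x. a < x \<Longrightarrow> x < b \<Longrightarrow> poly p x \<noteq> 0"
  shows "poly (pderiv p) a * poly (pderiv p) b < 0"
proof -
  define c where "c = (a + b) / 2"
  have c: "a < c" "c < b" using assms(1) by (auto simp: c_def field_simps)
  have "poly (pderiv p) a * poly p c > 0"
    using assms c by (intro poly_sign_right_of_simple_root) auto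
  moreover have "poly (pderiv p) b * poly p c < 0"
    using assms c by (intro poly_sign_left_of_simple_root) auto
  ultimately show ?thesis by (auto simp: zero_less_mult_iff mult_less_0_iff)
qed

lemma pderiv_pos_last_root:
  fixes p :: "real poly"
  assumes "lead_coeff p > 0" "poly p a = 0" "poly (pderiv p) a \<noteq> 0" "\<And>x. a < x \<Longrightarrow> poly p x \<noteq> 0"
  shows "poly (pderiv p) a > 0"
proof -
  have "poly (pderiv p) a * poly p (a + 1) > 0"
    using assms by (intro poly_sign_right_of_simple_root) auto
  moreover have "poly p (a + 1) > 0" using assms by (intro poly_pos_above_roots) auto
  ultimately show ?thesis by (simp add: zero_less_mult_iff)
qed

lemma poly_eq_prod_roots:
  fixes A :: "real poly"
  assumes "strict_mono_on {..<degree A} x" "\<And>i. i < degree A \<Longrightarrow> poly A (x i) = 0"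
  shows "A = smult (lead_coeff A) (\<Prod>i<degree A. [:- x i, 1:])"
proof (rule ccontr)
  define P where "P = (\<Prod>i<degree A. [:- x i, 1:])"
  define D where "D = A - smult (lead_coeff A) P"
  assume "A \<noteq> smult (lead_coeff A) (\<Prod>i<degree A. [:- x i, 1:])"
  then have D0: "D \<noteq> 0" by (simp add: D_def P_def)
  have degP: "degree P = degree A" unfolding P_def by (subst degree_prod_eq_sum_degree) auto
  have lcP: "lead_coeff P = 1" unfolding P_def by (simp add: lead_coeff_prod)
  have cD: "coeff D (degree A) = 0" using degP lcP by (simp add: D_def)
  have "degree D \<le> degree A" using degP unfolding D_def by (intro degree_diff_le) auto
  with cD D0 have degD: "degree D < degree A"
    by (metis le_neq_implies_less leading_coeff_0_iff)
  have "poly D (x i) = 0" if "i < degree A" for i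
    using assms(2)[OF that] that by (auto simp: D_def P_def poly_prod)
  then have "x ` {..<degree A} \<subseteq> {u. poly D u = 0}" by auto
  then have "card (x ` {..<degree A}) \<le> degree D"
    using card_poly_roots_bound[OF D0] poly_roots_finite[OF D0] card_mono le_trans by blast
  moreover have "card (x ` {..<degree A}) = degree A"
    using assms(1) by (simp add: card_image strict_mono_on_imp_inj_on)
  ultimately show False using degD by simp
qed

lemma sign_prod_lessThan:
  fixes c :: "nat \<Rightarrow> real"
  assumes "m \<le> d" "\<And>i. i < m \<Longrightarrow> c i > 0" "\<And>i. m \<le> i \<Longrightarrow> i < d \<Longrightarrow> c i < 0"
  shows "(-1) ^ (d + m) * (\<Prod>i<d. c i) > 0"
  using assms
proof (induction d)
  case (Suc d)
  show ?case
  proof (cases "m = Suc d")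
    case True
    then have "(\<Prod>i<Suc d. c i) > 0" using Suc.prems(2) by (intro prod_pos) auto
    then show ?thesis using True by (simp flip: mult_2)
  next
    case False
    then have "(-1) ^ (d + m) * (\<Prod>i<d. c i) > 0" "c d < 0" using Suc by auto
    then have "(-1) ^ (d + m) * (\<Prod>i<d. c i) * (- c d) > 0"
      by (metis mult_pos_pos neg_0_less_iff_less)
    then show ?thesis by (simp add: mult_ac)
  qed
qed simp

lemma sign_poly_between_roots:
  fixes A :: "real poly"
  assumes "strict_mono_on {..<degree A} x" "\<And>i. i < degree A \<Longrightarrow> poly A (x i) = 0"
    "lead_coeff A > 0" "m \<le> degree A"
    "\<And>i. i < m \<Longrightarrow> x i < t" "\<And>i. m \<le> i \<Longrightarrow> i < degree A \<Longrightarrow> t < x i"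
  shows "(-1) ^ (degree A + m) * poly A t > 0"
proof -
  have "poly A t = lead_coeff A * (\<Prod>i<degree A. t - x i)"
    by (subst poly_eq_prod_roots[OF assms(1,2)]) (auto simp: poly_prod)
  moreover have "(-1) ^ (degree A + m) * (\<Prod>i<degree A. t - x i) > 0"
    using assms by (intro sign_prod_lessThan) auto
  ultimately show ?thesis using mult_pos_pos[OF assms(3)] by (simp only: mult.left_commute)
qed

lemma sign_pderiv_at_root:
  fixes A :: "real poly"
  assumes "strict_mono_on {..<degree A} x" "\<And>i. i < degree A \<Longrightarrow> poly A (x i) = 0"
    "lead_coeff A > 0" "i < degree A"
  shows "(-1) ^ (degree A + Suc i) * poly (pderiv A) (x i) > 0"
proof -
  let ?d = "degree A"
  have "A = smult (lead_coeff A) (\<Prod>i<?d. [:- x i, 1:])" by (rule poly_eq_prod_roots[OF assms(1,2)])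
  also have "(\<Prod>i<?d. [:- x i, 1:]) = [:- x i, 1:] * (\<Prod>j\<in>{..<?d} - {i}. [:- x j, 1:])"
    using assms(4) by (intro prod.remove) auto
  finally have "pderiv A = pderiv (smult (lead_coeff A) ([:- x i, 1:] * (\<Prod>j\<in>{..<?d} - {i}. [:- x j, 1:])))"
    by (rule arg_cong)
  then have "poly (pderiv A) (x i) = lead_coeff A * (\<Prod>j\<in>{..<?d} - {i}. x i - x j)"
    by (simp add: pderiv_smult pderiv_mult pderiv_pCons poly_prod del: mult_pCons_left)
  \<comment> \<open>the positive factor inserted at \<open>i\<close> makes the first \<open>Suc i\<close> factors positive\<close>
  also have "(\<Prod>j\<in>{..<?d} - {i}. x i - x j) = (\<Prod>j<?d. if j = i then 1 else x i - x j)"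
    using assms(4) by (subst prod.remove[of "{..<?d}" i]) auto
  finally have "poly (pderiv A) (x i) = lead_coeff A * \<dots>" .
  moreover have "(-1) ^ (?d + Suc i) * (\<Prod>j<?d. if j = i then 1 else x i - x j) > 0"
    using assms(1,4) by (intro sign_prod_lessThan) (auto simp: strict_mono_on_def less_Suc_eq Suc_le_eq)
  ultimately show ?thesis using mult_pos_pos[OF assms(3)] by (simp only: mult.left_commute)
qed

section \<open>Interlacing polynomials and the Euclidean algorithm\<close>

text \<open>
  Besides having only real simple zeros, \<open>A\<close> must satisfy \<open>B(x) A'(x) > 0\<close> at each zero \<open>x\<close>, if
  its leading coefficient is positive; so \<open>B / A\<close> has positive residues. The parity of
  \<open>degree A + Suc i\<close> is that of the number of zeros above the \<open>i\<close>-th one, counted from \<open>0\<close>. Only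
  the values of \<open>B\<close> at the zeros of \<open>A\<close> matter, so \<open>B\<close> can be changed by multiples of \<open>A\<close>.
\<close>

definition interlaced :: "real poly \<Rightarrow> real poly \<Rightarrow> bool" where
  "interlaced A B \<longleftrightarrow> (\<exists>x. strict_mono_on {..<degree A} x \<and>
     (\<forall>i<degree A. poly A (x i) = 0 \<and> (-1) ^ (degree A + Suc i) * poly B (x i) > 0))"

lemma alternating_roots:
  fixes A :: "real poly" and t :: "nat \<Rightarrow> real"
  assumes "\<And>i. i < d \<Longrightarrow> t i < t (Suc i)" "\<And>i. i < d \<Longrightarrow> poly A (t i) * poly A (t (Suc i)) < 0"
  obtains x where "\<And>i. i < d \<Longrightarrow> t i < x i \<and> x i < t (Suc i) \<and> poly A (x i) = 0"
    "strict_mono_on {..<d} x"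
proof -
  have "\<forall>i. \<exists>u. i < d \<longrightarrow> t i < u \<and> u < t (Suc i) \<and> poly A u = 0"
    using poly_IVT[OF assms(1) assms(2)] by blast
  then obtain x where x: "\<And>i. i < d \<Longrightarrow> t i < x i \<and> x i < t (Suc i) \<and> poly A (x i) = 0"
    by metis
  moreover have "strict_mono_on {..<d} x"
    by (intro strict_mono_on_lessThan_SucI) (metis Suc_lessD x less_trans)
  ultimately show ?thesis using that by blast
qed

lemma neg_mult_of_alternating:
  fixes u v :: real
  assumes "(-1) ^ i * u > 0" "(-1) ^ Suc i * v > 0"
  shows "u * v < 0"
proof -
  have "((-1) ^ i * u) * ((-1) ^ Suc i * v) > 0" using assms by (rule mult_pos_pos)
  moreover have "((-1) ^ i * u) * ((-1) ^ Suc i * v) = - (u * v)"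
    by (cases "even i") auto
  ultimately show ?thesis by linarith
qed

lemma interlacedE:
  assumes "interlaced A B"
  obtains x where "strict_mono_on {..<degree A} x" "\<And>i. i < degree A \<Longrightarrow> poly A (x i) = 0"
    "\<And>i. i < degree A \<Longrightarrow> (-1) ^ (degree A + Suc i) * poly B (x i) > 0"
  using assms unfolding interlaced_def by blast

lemma interlaced_cong:
  assumes "\<And>x. poly A x = 0 \<Longrightarrow> poly B x = poly C x"
  shows "interlaced A B \<longleftrightarrow> interlaced A C"
  unfolding interlaced_def using assms by (metis (no_types, lifting))

text \<open>
  The sign changes of \<open>B\<close> between consecutive zeros of \<open>A\<close> already account for as many zeros as
  the degree of \<open>B\<close> allows. Hence there is none beyond the last zero of \<open>A\<close>, where \<open>B\<close> is
  positive, and this determines the sign of the leading coefficient.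
\<close>

lemma interlaced_step_imp:
  assumes "interlaced A B" "degree B < degree A" "lead_coeff A > 0"
  obtains x y where "degree A = Suc (degree B)" "lead_coeff B > 0"
    "strict_mono_on {..<degree A} x" "\<And>i. i < degree A \<Longrightarrow> poly A (x i) = 0"
    "strict_mono_on {..<degree B} y" "\<And>i. i < degree B \<Longrightarrow> poly B (y i) = 0"
    "\<And>i. i < degree B \<Longrightarrow> x i < y i \<and> y i < x (Suc i)"
proof -
  obtain x where x: "strict_mono_on {..<degree A} x" "\<And>i. i < degree A \<Longrightarrow> poly A (x i) = 0"
    "\<And>i. i < degree A \<Longrightarrow> (-1) ^ (degree A + Suc i) * poly B (x i) > 0"
    using assms(1) by (elim interlacedE) blast
  obtain e where e: "degree A = Suc e" using assms(2) by (cases "degree A") auto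
  have "poly B (x i) * poly B (x (Suc i)) < 0" if "i < e" for i
  proof (rule neg_mult_of_alternating)
    have i: "i < degree A" "Suc i < degree A" using that e by auto
    show "(-1) ^ (degree A + Suc i) * poly B (x i) > 0" by (rule x(3)[OF i(1)])
    show "(-1) ^ Suc (degree A + Suc i) * poly B (x (Suc i)) > 0"
      using x(3)[OF i(2)] by (simp only: add_Suc_right)
  qed
  moreover have "x i < x (Suc i)" if "i < e" for i
    using x(1) that e by (auto simp: strict_mono_on_def)
  ultimately obtain y where y: "\<And>i. i < e \<Longrightarrow> x i < y i \<and> y i < x (Suc i) \<and> poly B (y i) = 0"
    "strict_mono_on {..<e} y"
    using alternating_roots[of e x B] by blast
  have Bpos: "poly B (x e) > 0" using x(3)[of e] e by (simp flip: mult_2)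
  then have B0: "B \<noteq> 0" by auto
  have "y ` {..<e} \<subseteq> {u. poly B u = 0}" using y by auto
  then have "card (y ` {..<e}) \<le> degree B"
    using card_poly_roots_bound[OF B0] poly_roots_finite[OF B0] card_mono le_trans by blast
  moreover have "card (y ` {..<e}) = e"
    using y(2) by (simp add: card_image strict_mono_on_imp_inj_on)
  ultimately have degB: "degree B = e" using assms(2) e by simp
  have "lead_coeff B > 0"
  proof (rule ccontr)
    assume "\<not> lead_coeff B > 0"
    then have "lead_coeff (- B) > 0" using B0 by (simp add: degree_minus)
      (metis leading_coeff_0_iff linorder_neqE_linordered_idom)
    moreover have "y i < x e" if "i < e" for i
    proof -
      have "x (Suc i) \<le> x e"
        using x(1) e that by (cases "Suc i = e") (auto simp: strict_mono_on_def intro!: less_imp_le)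
      then show ?thesis using y(1)[OF that] by auto
    qed
    ultimately have "(-1) ^ (degree (- B) + e) * poly (- B) (x e) > 0"
      using y degB by (intro sign_poly_between_roots[where x = y]) auto
    then show False using Bpos degB by (simp flip: mult_2)
  qed
  then show ?thesis using that[of x y] x y degB e by auto
qed

text \<open>
  One step of the Euclidean algorithm, because at the zeros of \<open>B\<close> the polynomial \<open>- A\<close> agrees with
  the negative remainder of \<open>A\<close> modulo \<open>B\<close>. For the backward direction, the values of \<open>A\<close> far to
  the left, at the zeros of \<open>B\<close>, and far to the right alternate in sign, which yields all the zeros
  of \<open>A\<close> and places them around those of \<open>B\<close>.
\<close>

lemma interlaced_step:
  assumes "degree B < degree A" "lead_coeff A > 0"
  shows "interlaced A B \<longleftrightarrow>
    degree A = Suc (degree B) \<and> lead_coeff B > 0 \<and> interlaced B (- A)"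
proof (intro iffI conjI; (elim conjE)?)
  assume "interlaced A B"
  then obtain x y where *: "degree A = Suc (degree B)" "lead_coeff B > 0"
    "strict_mono_on {..<degree A} x" "\<And>i. i < degree A \<Longrightarrow> poly A (x i) = 0"
    "strict_mono_on {..<degree B} y" "\<And>i. i < degree B \<Longrightarrow> poly B (y i) = 0"
    "\<And>i. i < degree B \<Longrightarrow> x i < y i \<and> y i < x (Suc i)"
    using interlaced_step_imp assms by metis
  show "degree A = Suc (degree B)" "lead_coeff B > 0" using * by auto
  have "(-1) ^ (degree B + Suc i) * poly (- A) (y i) > 0" if i: "i < degree B" for i
  proof -
    have "x j < y i" if "j < Suc i" for j
    proof -
      have "x j \<le> x i" using *(1,3) i that
        by (cases "j = i") (auto simp: strict_mono_on_def intro!: less_imp_le)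
      then show ?thesis using *(7)[OF i] by simp
    qed
    moreover have "y i < x j" if "Suc i \<le> j" "j < degree A" for j
    proof -
      have "x (Suc i) \<le> x j" using *(1,3) i that
        by (cases "j = Suc i") (auto simp: strict_mono_on_def intro!: less_imp_le)
      then show ?thesis using *(7)[OF i] by simp
    qed
    ultimately have "(-1) ^ (degree A + Suc i) * poly A (y i) > 0"
      using * i assms by (intro sign_poly_between_roots[where x = x]) auto
    then show ?thesis using *(1) by simp
  qed
  then show "interlaced B (- A)" unfolding interlaced_def using * by blast
next
  assume deg: "degree A = Suc (degree B)" and lcB: "lead_coeff B > 0" and "interlaced B (- A)"
  then obtain y where y: "strict_mono_on {..<degree B} y" "\<And>i. i < degree B \<Longrightarrow> poly B (y i) = 0"
    "\<And>i. i < degree B \<Longrightarrow> (-1) ^ (degree B + Suc i) * poly (- A) (y i) > 0"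
    by (elim interlacedE) blast
  define e where "e = degree B"
  have A0: "A \<noteq> 0" "B \<noteq> 0" using assms lcB by auto
  define F where "F = insert 0 (y ` {..<e} \<union> {u. poly A u = 0})"
  have finF: "finite F" using A0 poly_roots_finite[of A] by (auto simp: F_def)
  define L where "L = Min F - 1"
  define U where "U = Max F + 1"
  have LU: "L < u" "u < U" if "u \<in> F" for u
    using Min_le[OF finF that] Max_ge[OF finF that] by (auto simp: L_def U_def)
  have LltU: "L < U" using LU[of 0] by (auto simp: F_def)
  \<comment> \<open>the points at which \<open>A\<close> alternates in sign\<close>
  define t where "t i = (if i = 0 then L else if i \<le> e then y (i - 1) else U)" for i
  have tA: "(-1) ^ (degree A + i) * poly A (t i) > 0" if "i \<le> Suc e" for i
  proof -
    consider "i = 0" | "0 < i" "i \<le> e" | "i = Suc e" using \<open>i \<le> Suc e\<close> by linarith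
    then show ?thesis
    proof cases
      case 1
      then show ?thesis
        using poly_sign_below_roots[of A L] assms(2) LU(1) by (force simp: t_def F_def)
    next
      case 2
      then obtain j where "i = Suc j" by (cases i) auto
      then show ?thesis using 2 y(3)[of j] deg by (simp add: t_def e_def)
    next
      case 3
      have "poly A U > 0"
        using LU(2) assms(2) by (intro poly_pos_above_roots) (auto simp: F_def not_le[symmetric])
      then show ?thesis using 3 deg by (simp add: t_def e_def flip: mult_2)
    qed
  qed
  have tmono: "t i < t (Suc i)" if "i < Suc e" for i
    using that LU y(1) LltU by (auto simp: t_def F_def e_def strict_mono_on_def)
  have tneg: "poly A (t i) * poly A (t (Suc i)) < 0" if "i < Suc e" for i
  proof (rule neg_mult_of_alternating)
    have i: "i \<le> Suc e" "Suc i \<le> Suc e" using that by auto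
    show "(-1) ^ (degree A + i) * poly A (t i) > 0" by (rule tA[OF i(1)])
    show "(-1) ^ Suc (degree A + i) * poly A (t (Suc i)) > 0"
      using tA[OF i(2)] by (simp only: add_Suc_right)
  qed
  obtain x where x: "\<And>i. i < Suc e \<Longrightarrow> t i < x i \<and> x i < t (Suc i) \<and> poly A (x i) = 0"
    "strict_mono_on {..<Suc e} x"
    using alternating_roots[of "Suc e" t A] tmono tneg by blast
  have tmono': "t i \<le> t j" if "i \<le> j" "j \<le> Suc e" for i j
    using that
  proof (induction j rule: dec_induct)
    case (step n)
    then show ?case using tmono[of n] by simp
  qed simp
  have "(-1) ^ (degree A + Suc i) * poly B (x i) > 0" if i: "i < degree A" for i
  proof -
    have "y j < x i" if "j < i" for j
    proof -
      have "y j = t (Suc j)" using that i deg by (simp add: t_def e_def)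
      also have "\<dots> \<le> t i" using that i deg by (intro tmono') (auto simp: e_def)
      finally show ?thesis using x(1)[of i] i deg by (auto simp: e_def)
    qed
    moreover have "x i < y j" if "i \<le> j" "j < degree B" for j
    proof -
      have "y j = t (Suc j)" using that i deg by (simp add: t_def e_def)
      moreover have "t (Suc i) \<le> t (Suc j)" using that i deg by (intro tmono') (auto simp: e_def)
      ultimately show ?thesis using x(1)[of i] i deg by (auto simp: e_def)
    qed
    ultimately have "(-1) ^ (degree B + i) * poly B (x i) > 0"
      using y lcB i deg by (intro sign_poly_between_roots[where x = y]) auto
    then show ?thesis using deg by simp
  qed
  then show "interlaced A B" unfolding interlaced_def using x deg e_def by auto
qed

section \<open>Hurwitz determinants and the Euclidean algorithm\<close>

text \<open>
  Rows \<open>2i\<close> and \<open>2i + 1\<close> are the sequences \<open>g\<close> and \<open>f\<close>, both shifted to the right by \<open>i\<close>. In a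
  Hurwitz matrix these are the coefficients of odd and of even index. The sequences are meant to
  vanish at negative indices.
\<close>

definition interleaved_mat :: "(int \<Rightarrow> real) \<Rightarrow> (int \<Rightarrow> real) \<Rightarrow> nat \<Rightarrow> real mat" where
  "interleaved_mat f g N = Matrix.mat N N (\<lambda>(r, s). (if even r then g else f) (int s - int (r div 2)))"

lemma interleaved_mat_carrier [simp]: "interleaved_mat f g N \<in> carrier_mat N N"
  and interleaved_mat_dim [simp]: "dim_row (interleaved_mat f g N) = N" "dim_col (interleaved_mat f g N) = N"
  by (auto simp: interleaved_mat_def)

text \<open>
  Rows \<open>2i\<close> and \<open>2i + 1\<close> carry the same shift, so a multiple of \<open>g\<close> is added to \<open>f\<close> by a lower
  triangular matrix with unit diagonal.
\<close>

lemma det_interleaved_mat_shear_odd: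
  "det (interleaved_mat (\<lambda>i. f i + c * g i) g N) = det (interleaved_mat f g N)"
proof -
  define E where "E = Matrix.mat N N (\<lambda>(r, k). if r = k then 1 else if odd r \<and> Suc k = r then c else 0)"
  have E: "E \<in> carrier_mat N N" by (simp add: E_def)
  have "interleaved_mat (\<lambda>i. f i + c * g i) g N = E * interleaved_mat f g N"
  proof (rule eq_matI)
    fix r s assume "r < dim_row (E * interleaved_mat f g N)" "s < dim_col (E * interleaved_mat f g N)"
    then have rs: "r < N" "s < N" using E by auto
    have "(E * interleaved_mat f g N) $$ (r, s) = (\<Sum>k<N. E $$ (r, k) * interleaved_mat f g N $$ (k, s))"
      using rs E by (auto simp: scalar_prod_def atLeast0LessThan)
    also have "\<dots> = (\<Sum>k\<in>(if odd r then {r, r - 1} else {r}). E $$ (r, k) * interleaved_mat f g N $$ (k, s))"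
      using rs by (intro sum.mono_neutral_right) (auto simp: E_def split: if_splits)
    also have "\<dots> = interleaved_mat (\<lambda>i. f i + c * g i) g N $$ (r, s)"
      using rs by (auto simp: E_def interleaved_mat_def elim!: oddE)
    finally show "interleaved_mat (\<lambda>i. f i + c * g i) g N $$ (r, s) = (E * interleaved_mat f g N) $$ (r, s)" ..
  qed (use E in auto)
  moreover have "det E = 1"
    by (subst det_lower_triangular[OF _ E]) (simp_all add: E_def prod_list_diag_prod)
  ultimately show ?thesis using det_mult[OF E, of "interleaved_mat f g N"] by simp
qed

text \<open>
  The order has to be even: otherwise the last row carries \<open>g\<close> and the row below it, which would
  supply \<open>f\<close>, is cut off.
\<close>

lemma det_interleaved_mat_shear_even:
  assumes "even N"
  shows "det (interleaved_mat f (\<lambda>i. g i + c * f i) N) = det (interleaved_mat f g N)"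
proof -
  define E where "E = Matrix.mat N N (\<lambda>(r, k). if r = k then 1 else if even r \<and> k = Suc r then c else 0)"
  have E: "E \<in> carrier_mat N N" by (simp add: E_def)
  have "interleaved_mat f (\<lambda>i. g i + c * f i) N = E * interleaved_mat f g N"
  proof (rule eq_matI)
    fix r s assume "r < dim_row (E * interleaved_mat f g N)" "s < dim_col (E * interleaved_mat f g N)"
    then have rs: "r < N" "s < N" using E by auto
    have partner: "Suc r < N" if "even r"
      using that rs assms by (metis Suc_lessI even_Suc)
    have "(E * interleaved_mat f g N) $$ (r, s) = (\<Sum>k<N. E $$ (r, k) * interleaved_mat f g N $$ (k, s))"
      using rs E by (auto simp: scalar_prod_def atLeast0LessThan)
    also have "\<dots> = (\<Sum>k\<in>(if even r then {r, Suc r} else {r}). E $$ (r, k) * interleaved_mat f g N $$ (k, s))"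
      using rs partner by (intro sum.mono_neutral_right) (auto simp: E_def split: if_splits)
    also have "\<dots> = interleaved_mat f (\<lambda>i. g i + c * f i) N $$ (r, s)"
      using rs partner by (auto simp: E_def interleaved_mat_def elim!: evenE)
    finally show "interleaved_mat f (\<lambda>i. g i + c * f i) N $$ (r, s) = (E * interleaved_mat f g N) $$ (r, s)" ..
  qed (use E in auto)
  moreover have "det E = 1"
    by (subst det_upper_triangular[OF _ E])
       (simp_all add: E_def prod_list_diag_prod upper_triangular_def)
  ultimately show ?thesis using det_mult[OF E, of "interleaved_mat f g N"] by simp
qed

text \<open>
  On every pair of rows this is a matrix of determinant one that sends \<open>(g, f)\<close> to
  \<open>(f, b f - g)\<close>. Writing it as three shears avoids the sign of a row permutation.
\<close>

lemma det_interleaved_mat_rotate: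
  assumes "even N"
  shows "det (interleaved_mat f g N) = det (interleaved_mat (\<lambda>i. b * f i - g i) f N)"
proof -
  \<comment> \<open>the pair \<open>(g, f)\<close> passes through \<open>(g1, f)\<close> and \<open>(g1, f1)\<close> to \<open>(f, f1)\<close>\<close>
  define g1 where "g1 = (\<lambda>i. g i + (1 - b) * f i)"
  define f1 where "f1 = (\<lambda>i. f i + (-1) * g1 i)"
  have "det (interleaved_mat f g N) = det (interleaved_mat f g1 N)"
    unfolding g1_def by (rule det_interleaved_mat_shear_even[OF assms, symmetric])
  also have "\<dots> = det (interleaved_mat f1 g1 N)"
    unfolding f1_def by (rule det_interleaved_mat_shear_odd[symmetric])
  also have "\<dots> = det (interleaved_mat f1 (\<lambda>i. g1 i + 1 * f1 i) N)"
    by (rule det_interleaved_mat_shear_even[OF assms, symmetric])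
  also have "(\<lambda>i. g1 i + 1 * f1 i) = f" by (auto simp: f1_def)
  also have "f1 = (\<lambda>i. b * f i - g i)" by (auto simp: f1_def g1_def algebra_simps)
  finally show ?thesis .
qed

text \<open>
  The first column has the single nonzero entry \<open>g 0\<close>. Deleting it with the first row shifts the
  rows by one place, so the two sequences exchange their roles.
\<close>

lemma det_interleaved_mat_peel:
  assumes "\<And>i. i \<le> 0 \<Longrightarrow> f i = 0" "\<And>i. i < 0 \<Longrightarrow> g i = 0"
  shows "det (interleaved_mat f g (Suc N)) = g 0 * det (interleaved_mat g (\<lambda>i. f (i + 1)) N)"
proof -
  let ?M = "interleaved_mat f g (Suc N)"
  have "det ?M = (\<Sum>r<Suc N. ?M $$ (r, 0) * cofactor ?M r 0)"
    by (rule laplace_expansion_column) auto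
  also have "\<dots> = (\<Sum>r\<in>{0}. ?M $$ (r, 0) * cofactor ?M r 0)"
  proof (rule sum.mono_neutral_right)
    show "\<forall>r\<in>{..<Suc N} - {0}. ?M $$ (r, 0) * cofactor ?M r 0 = 0"
    proof
      fix r assume "r \<in> {..<Suc N} - {0}"
      moreover have "r div 2 > 0" if "even r" "r > 0" using that by (auto elim!: evenE)
      ultimately have "?M $$ (r, 0) = 0" using assms by (auto simp: interleaved_mat_def)
      then show "?M $$ (r, 0) * cofactor ?M r 0 = 0" by simp
    qed
  qed auto
  also have "\<dots> = g 0 * det (mat_delete ?M 0 0)" by (simp add: cofactor_def interleaved_mat_def)
  also have "mat_delete ?M 0 0 = interleaved_mat g (\<lambda>i. f (i + 1)) N"
    by (rule eq_matI) (auto simp: mat_delete_def interleaved_mat_def elim!: oddE intro: arg_cong[of _ _ f])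
  finally show ?thesis .
qed

text \<open>
  The step of the Routh scheme: the leading entry of \<open>f\<close> is cancelled by \<open>g\<close>.
\<close>

lemma det_interleaved_mat_Routh:
  assumes "\<And>i. i < 0 \<Longrightarrow> f i = 0" "\<And>i. i < 0 \<Longrightarrow> g i = 0" "g 0 \<noteq> 0"
  shows "det (interleaved_mat f g (Suc N)) =
    g 0 * det (interleaved_mat g (\<lambda>i. f (i + 1) - f 0 / g 0 * g (i + 1)) N)"
proof -
  have "det (interleaved_mat f g (Suc N)) =
      det (interleaved_mat (\<lambda>i. f i + (- (f 0 / g 0)) * g i) g (Suc N))"
    by (rule det_interleaved_mat_shear_odd[symmetric])
  also have "\<dots> = g 0 * det (interleaved_mat g (\<lambda>i. f (i + 1) + (- (f 0 / g 0)) * g (i + 1)) N)"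
  proof (rule det_interleaved_mat_peel)
    fix i :: int assume "i \<le> 0"
    then show "f i + (- (f 0 / g 0)) * g i = 0" using assms by (cases "i = 0") auto
  qed (use assms in auto)
  finally show ?thesis by simp
qed

text \<open>
  The step in which \<open>f 0\<close> is the pivot; the entry \<open>g 0\<close> may have any sign or vanish.
\<close>

lemma det_interleaved_mat_even:
  assumes "\<And>i. i < 0 \<Longrightarrow> f i = 0" "\<And>i. i < 0 \<Longrightarrow> g i = 0" "f 0 \<noteq> 0" "odd N"
  shows "det (interleaved_mat f g (Suc N)) =
    f 0 * det (interleaved_mat f (\<lambda>i. g 0 / f 0 * f (i + 1) - g (i + 1)) N)"
proof -
  have "det (interleaved_mat f g (Suc N)) =
      det (interleaved_mat (\<lambda>i. g 0 / f 0 * f i - g i) f (Suc N))"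
    using assms(4) by (intro det_interleaved_mat_rotate) auto
  also have "\<dots> = f 0 * det (interleaved_mat f (\<lambda>i. g 0 / f 0 * f (i + 1) - g (i + 1)) N)"
  proof (rule det_interleaved_mat_peel)
    fix i :: int assume "i \<le> 0"
    then show "g 0 / f 0 * f i - g i = 0" using assms by (cases "i = 0") auto
  qed (use assms in auto)
  finally show ?thesis .
qed

text \<open>
  The coefficients from degree \<open>d\<close> downwards; \<open>d\<close> may exceed the degree of the polynomial.
\<close>

definition topcoeff :: "nat \<Rightarrow> real poly \<Rightarrow> int \<Rightarrow> real" where
  "topcoeff d P i = (if 0 \<le> i \<and> i \<le> int d then coeff P (d - nat i) else 0)"

lemma topcoeff_0 [simp]: "topcoeff d P 0 = coeff P d"
  and topcoeff_neg: "i < 0 \<Longrightarrow> topcoeff d P i = 0"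
  by (auto simp: topcoeff_def)

lemma topcoeff_Suc_shift:
  assumes "0 \<le> i"
  shows "topcoeff (Suc d) P (i + 1) = topcoeff d P i"
proof -
  have "Suc d - nat (i + 1) = d - nat i" using assms by (simp add: nat_add_distrib)
  then show ?thesis using assms by (simp add: topcoeff_def)
qed

lemma topcoeff_diff: "topcoeff d (P - Q) i = topcoeff d P i - topcoeff d Q i"
  and topcoeff_smult: "topcoeff d (smult c P) i = c * topcoeff d P i"
  by (auto simp: topcoeff_def)

lemma topcoeff_pCons_0: "topcoeff (Suc d) (pCons 0 P) i = topcoeff d P i"
proof -
  have "Suc d - nat i = Suc (d - nat i)" if "0 \<le> i" "i \<le> int d" using that by linarith
  moreover have "Suc d - nat i = 0" if "0 \<le> i" "i \<le> int (Suc d)" "\<not> i \<le> int d" using that by linarith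
  ultimately show ?thesis by (auto simp: topcoeff_def)
qed

text \<open>
  Two elimination steps, with pivot \<open>g 0\<close> each time, take the pair \<open>(A, B)\<close> to \<open>(B, C)\<close>, where
  \<open>- C\<close> is the remainder of \<open>A\<close> modulo \<open>B\<close>. The determinant of order \<open>2m + 3\<close> thereby becomes
  the one of order \<open>2m + 1\<close> for the new pair, up to the factor \<open>(g 0)\<^sup>2\<close>, while the determinant of
  order one is \<open>g 0\<close> itself. This is the recursion of \<open>interlaced_step\<close>.
\<close>

lemma interlaced_iff_det_even_degree:
  assumes "degree A = l" "lead_coeff A > 0" "\<And>i. i \<ge> l \<Longrightarrow> coeff B i = 0"
  shows "interlaced A B \<longleftrightarrow>
    (\<forall>m<l. det (interleaved_mat (topcoeff l A) (topcoeff (l - 1) B) (2 * m + 1)) > 0)"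
  using assms
proof (induction l arbitrary: A B)
  case 0
  then show ?case by (auto simp: interlaced_def)
next
  case (Suc l)
  define f where "f = topcoeff (Suc l) A"
  define g where "g = topcoeff l B"
  have fneg: "f i = 0" and gneg: "g i = 0" if "i < 0" for i
    using that by (auto simp: f_def g_def topcoeff_neg)
  have f0: "f 0 = lead_coeff A" and g0: "g 0 = coeff B l" using Suc.prems by (auto simp: f_def g_def)
  have degB: "degree B \<le> l" using Suc.prems(3) by (intro degree_le) auto
  have D1: "det (interleaved_mat f g (2 * 0 + 1)) = g 0"
    by (subst det_single) (auto simp: interleaved_mat_def)
  have step: "interlaced A B \<longleftrightarrow> degree B = l \<and> lead_coeff B > 0 \<and> interlaced B (- A)"
    using interlaced_step[of B A] degB Suc.prems by auto
  show ?case
  proof (cases "g 0 > 0")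
    case False
    then have "\<not> interlaced A B" using step g0 by auto
    moreover have "\<not> (\<forall>m<Suc l. det (interleaved_mat f g (2 * m + 1)) > 0)"
      using False D1 by (metis zero_less_Suc)
    ultimately show ?thesis by (simp add: f_def g_def)
  next
    case True
    then have degB: "degree B = l" using degB g0 by (metis le_degree le_antisym less_irrefl)
    then have lcB: "lead_coeff B > 0" using True g0 by simp
    define \<alpha> where "\<alpha> = f 0 / g 0"
    define h where "h = (\<lambda>i. f (i + 1) - \<alpha> * g (i + 1))"
    define \<beta> where "\<beta> = h 0 / g 0"
    \<comment> \<open>minus the remainder of \<open>A\<close>, with quotient \<open>\<alpha> u + \<beta>\<close>\<close>
    define C where "C = smult \<beta> B - (A - smult \<alpha> (pCons 0 B))"
    have hneg: "h i = 0" if "i < 0" for i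
      using that True fneg gneg by (cases "i = -1") (auto simp: h_def \<alpha>_def)
    have top: "topcoeff l C (i + 1) = \<beta> * g (i + 1) - h (i + 1)" if "i \<ge> -1" for i
    proof -
      have "topcoeff l C (i + 1) = topcoeff (Suc l) C (i + 1 + 1)"
        using that by (intro topcoeff_Suc_shift[symmetric]) auto
      also have "\<dots> = \<beta> * topcoeff (Suc l) B (i + 1 + 1) - (f (i + 1 + 1) - \<alpha> * g (i + 1 + 1))"
        by (simp only: C_def topcoeff_diff topcoeff_smult topcoeff_pCons_0 f_def g_def)
      also have "topcoeff (Suc l) B (i + 1 + 1) = g (i + 1)"
        unfolding g_def using that by (intro topcoeff_Suc_shift) auto
      finally show ?thesis by (simp add: h_def)
    qed
    have C0: "coeff C i = 0" if "i \<ge> l" for i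
    proof -
      consider "i = l" | "i = Suc l" | "i > Suc l" using \<open>i \<ge> l\<close> by linarith
      then show ?thesis
      proof cases
        case 1
        then show ?thesis using top[of "-1"] True by (simp add: \<beta>_def)
      next
        case 2
        then show ?thesis using True g0 f0 Suc.prems by (simp add: C_def \<alpha>_def)
      next
        case 3
        then show ?thesis using Suc.prems by (cases i) (auto simp: C_def coeff_eq_0)
      qed
    qed
    have "interlaced B (- A) \<longleftrightarrow> interlaced B C"
      by (rule interlaced_cong) (simp add: C_def)
    also have "\<dots> \<longleftrightarrow> (\<forall>m<l. det (interleaved_mat (topcoeff l B) (topcoeff (l - 1) C) (2 * m + 1)) > 0)"
      by (rule Suc.IH) (use degB lcB C0 in auto)
    also have "\<dots> \<longleftrightarrow> (\<forall>m<l. det (interleaved_mat f g (2 * Suc m + 1)) > 0)"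
    proof (intro all_cong)
      fix m assume "m < l"
      then obtain l' where l': "l = Suc l'" by (cases l) auto
      have "det (interleaved_mat f g (2 * Suc m + 1)) = g 0 * det (interleaved_mat g h (Suc (2 * m + 1)))"
        unfolding h_def \<alpha>_def using True fneg gneg
        by (subst det_interleaved_mat_Routh[symmetric]) auto
      also have "det (interleaved_mat g h (Suc (2 * m + 1))) =
          g 0 * det (interleaved_mat g (\<lambda>i. \<beta> * g (i + 1) - h (i + 1)) (2 * m + 1))"
        unfolding \<beta>_def using True hneg gneg by (intro det_interleaved_mat_even) auto
      also have "(\<lambda>i. \<beta> * g (i + 1) - h (i + 1)) = topcoeff (l - 1) C"
      proof
        fix i :: int
        show "\<beta> * g (i + 1) - h (i + 1) = topcoeff (l - 1) C i"
        proof (cases "i \<ge> 0")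
          case True
          then show ?thesis using top[of i] topcoeff_Suc_shift[of i l' C] by (simp add: l')
        next
          case False
          then show ?thesis using hneg gneg top[of "-1"] C0[of l]
            by (cases "i = -1") (auto simp: topcoeff_neg)
        qed
      qed
      finally show "(det (interleaved_mat (topcoeff l B) (topcoeff (l - 1) C) (2 * m + 1)) > 0) =
          (det (interleaved_mat f g (2 * Suc m + 1)) > 0)"
        using True by (simp add: g_def zero_less_mult_iff)
    qed
    finally have "interlaced A B \<longleftrightarrow> (\<forall>m<l. det (interleaved_mat f g (2 * Suc m + 1)) > 0)"
      using step degB lcB by simp
    also have "\<dots> \<longleftrightarrow> (\<forall>m<Suc l. det (interleaved_mat f g (2 * m + 1)) > 0)"
      using D1 True by (simp only: All_less_Suc2) simp
    finally show ?thesis by (simp add: f_def g_def)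
  qed
qed

text \<open>
  One elimination step removes the leading coefficient of \<open>B\<close>, if any, and reduces the claim to
  the even case.
\<close>

lemma interlaced_iff_det_odd_degree:
  assumes "degree A = l" "lead_coeff A > 0" "degree B \<le> l"
  shows "interlaced A (- B) \<longleftrightarrow>
    (\<forall>m<l. det (interleaved_mat (topcoeff l A) (topcoeff l B) (2 * m + 2)) > 0)"
proof -
  define \<beta> where "\<beta> = coeff B l / coeff A l"
  define C where "C = smult \<beta> A - B"
  have Al: "coeff A l > 0" using assms by simp
  have C0: "coeff C i = 0" if "i \<ge> l" for i
    using that assms Al by (cases "i = l") (auto simp: C_def \<beta>_def coeff_eq_0)
  have "interlaced A (- B) \<longleftrightarrow> interlaced A C"
    by (rule interlaced_cong) (simp add: C_def)
  also have "\<dots> \<longleftrightarrow> (\<forall>m<l. det (interleaved_mat (topcoeff l A) (topcoeff (l - 1) C) (2 * m + 1)) > 0)"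
    by (rule interlaced_iff_det_even_degree) (use assms C0 in auto)
  also have "\<dots> \<longleftrightarrow> (\<forall>m<l. det (interleaved_mat (topcoeff l A) (topcoeff l B) (2 * m + 2)) > 0)"
  proof (intro all_cong)
    fix m assume "m < l"
    then obtain l' where l': "l = Suc l'" by (cases l) auto
    have "det (interleaved_mat (topcoeff l A) (topcoeff l B) (Suc (2 * m + 1))) =
        coeff A l * det (interleaved_mat (topcoeff l A)
          (\<lambda>i. \<beta> * topcoeff l A (i + 1) - topcoeff l B (i + 1)) (2 * m + 1))"
      using det_interleaved_mat_even[of "topcoeff l A" "topcoeff l B" "2 * m + 1"] Al
      by (simp add: topcoeff_neg \<beta>_def)
    also have "(\<lambda>i. \<beta> * topcoeff l A (i + 1) - topcoeff l B (i + 1)) = topcoeff (l - 1) C"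
    proof
      fix i :: int
      have "\<beta> * topcoeff l A (i + 1) - topcoeff l B (i + 1) = topcoeff l C (i + 1)"
        by (simp add: C_def topcoeff_diff topcoeff_smult)
      also have "\<dots> = topcoeff (l - 1) C i"
      proof (cases "i \<ge> 0")
        case False
        then show ?thesis using C0[of l] by (cases "i = -1") (auto simp: topcoeff_neg)
      qed (simp add: l' topcoeff_Suc_shift)
      finally show "\<beta> * topcoeff l A (i + 1) - topcoeff l B (i + 1) = topcoeff (l - 1) C i" .
    qed
    finally show "(det (interleaved_mat (topcoeff l A) (topcoeff (l - 1) C) (2 * m + 1)) > 0) =
        (det (interleaved_mat (topcoeff l A) (topcoeff l B) (2 * m + 2)) > 0)"
      using Al by (simp add: zero_less_mult_iff)
  qed
  finally show ?thesis .
qed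

lemma hurwitz_matrix_eq_interleaved_mat:
  "hurwitz_matrix p j = interleaved_mat (\<lambda>i. hcoeff p (2 * i)) (\<lambda>i. hcoeff p (2 * i + 1)) j"
proof (rule eq_matI)
  fix r s
  assume "r < dim_row (interleaved_mat (\<lambda>i. hcoeff p (2 * i)) (\<lambda>i. hcoeff p (2 * i + 1)) j)"
    "s < dim_col (interleaved_mat (\<lambda>i. hcoeff p (2 * i)) (\<lambda>i. hcoeff p (2 * i + 1)) j)"
  moreover have "2 * (int s + 1) - (int r + 1) =
      (if even r then 2 * (int s - int (r div 2)) + 1 else 2 * (int s - int (r div 2)))"
    by (auto elim!: evenE oddE)
  ultimately show "hurwitz_matrix p j $$ (r, s) =
      interleaved_mat (\<lambda>i. hcoeff p (2 * i)) (\<lambda>i. hcoeff p (2 * i + 1)) j $$ (r, s)"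
    by (simp add: hurwitz_matrix_def interleaved_mat_def)
qed (auto simp: hurwitz_matrix_def)

section \<open>Generalized Hurwitz polynomials through derivatives\<close>

lemma enumerate_finite_real_set:
  fixes M :: "real set"
  assumes "finite M"
  obtains h where "h ` {..<card M} = M" "strict_mono_on {..<card M} h"
proof
  let ?xs = "sorted_list_of_set M"
  have "(\<lambda>i. ?xs ! i) ` {..<card M} = set ?xs"
    by (simp add: set_conv_nth image_def lessThan_def Bex_def conj_commute)
  then show "(\<lambda>i. ?xs ! i) ` {..<card M} = M" using assms by simp
  show "strict_mono_on {..<card M} (\<lambda>i. ?xs ! i)"
    using assms sorted_list_of_set.strict_sorted_key_list_of_set[of M]
    by (intro strict_mono_onI) (simp add: sorted_wrt_nth_less)
qed

lemma order_eq_1_iff: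
  fixes p :: "real poly"
  assumes "p \<noteq> 0"
  shows "Polynomial.order a p = 1 \<longleftrightarrow> poly p a = 0 \<and> poly (pderiv p) a \<noteq> 0"
proof (cases "poly p a = 0")
  case True
  then have "Polynomial.order a p = Suc (Polynomial.order a (pderiv p))"
    using order_pderiv assms by blast
  moreover have "pderiv p \<noteq> 0"
  proof
    assume "pderiv p = 0"
    then obtain c where "p = [:c:]" using pderiv_iszero by blast
    then show False using True assms by simp
  qed
  ultimately show ?thesis using True order_root[of "pderiv p" a] by auto
qed (simp add: order_0I)

lemma num_real_zeros_factor:
  assumes "poly q x \<noteq> 0"
  shows "num_real_zeros ([:- x, 1:] ^ n * q) S = (if x \<in> S then n else 0) + num_real_zeros q S"
proof (cases "n = 0")
  case False
  have q0: "q \<noteq> 0" using assms by auto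
  have ord: "Polynomial.order y ([:- x, 1:] ^ n * q) = (if y = x then n else 0) + Polynomial.order y q" for y
  proof -
    have "Polynomial.order y ([:- x, 1:] ^ n) = (if y = x then n else 0)"
      by (cases "y = x") (auto simp: order_power_n_n intro: order_0I)
    then show ?thesis using q0 by (subst order_mult) auto
  qed
  have fin: "finite {y \<in> S. poly q y = 0}" using poly_roots_finite[OF q0] by (rule finite_subset[rotated]) auto
  have set: "{y. y \<in> S \<and> poly ([:- x, 1:] ^ n * q) y = 0} = (S \<inter> {x}) \<union> {y \<in> S. poly q y = 0}"
    using False by auto
  have "num_real_zeros ([:- x, 1:] ^ n * q) S =
     (\<Sum>y\<in>S \<inter> {x}. Polynomial.order y ([:- x, 1:] ^ n * q)) + (\<Sum>y\<in>{y \<in> S. poly q y = 0}. Polynomial.order y ([:- x, 1:] ^ n * q))"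
    unfolding num_real_zeros_def set using assms fin by (intro sum.union_disjoint) auto
  also have "(\<Sum>y\<in>{y \<in> S. poly q y = 0}. Polynomial.order y ([:- x, 1:] ^ n * q)) = num_real_zeros q S"
    unfolding num_real_zeros_def using assms by (intro sum.cong) (auto simp: ord)
  also have "(\<Sum>y\<in>S \<inter> {x}. Polynomial.order y ([:- x, 1:] ^ n * q)) = (if x \<in> S then n else 0)"
    using assms by (auto simp: ord Int_insert_right order_0I)
  finally show ?thesis .
qed simp

text \<open>
  Splitting off a factor \<open>(t - x)\<^sup>n\<close> multiplies the product of the values at \<open>a\<close> and \<open>b\<close> by
  \<open>((a - x) (b - x))\<^sup>n\<close>, which is negative exactly when \<open>x\<close> lies between them and \<open>n\<close> is odd.
\<close>

lemma odd_num_real_zeros_iff: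
  assumes "a < b" "poly p a \<noteq> 0" "poly p b \<noteq> 0"
  shows "odd (num_real_zeros p {a<..<b}) \<longleftrightarrow> poly p a * poly p b < 0"
  using assms(2,3)
proof (induction p rule: poly_root_order_induct)
  case (no_roots p)
  then have "poly p a * poly p b > 0" by (intro poly_same_sign) auto
  then show ?case using no_roots by (simp add: num_real_zeros_def)
next
  case (root p x n)
  have ne: "x \<noteq> a" "x \<noteq> b" and IH: "odd (num_real_zeros p {a<..<b}) \<longleftrightarrow> poly p a * poly p b < 0"
    using root by auto
  have eq: "poly ([:- x, 1:] ^ n * p) a * poly ([:- x, 1:] ^ n * p) b =
      ((a - x) * (b - x)) ^ n * (poly p a * poly p b)"
    by (simp add: power_mult_distrib mult_ac)
  have ab: "poly p a * poly p b \<noteq> 0" using root by auto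
  show ?case
  proof (cases "x \<in> {a<..<b}")
    case True
    then have "(a - x) * (b - x) < 0" by (simp add: mult_neg_pos)
    moreover have "c ^ n * w < 0 \<longleftrightarrow> odd n \<noteq> (w < 0)" if "c < 0" "w \<noteq> 0" for c w :: real
      using that by (cases "even n") (auto simp: mult_less_0_iff zero_less_power_eq power_less_zero_eq)
    ultimately show ?thesis using True IH ab root(2) unfolding eq by (auto simp: num_real_zeros_factor)
  next
    case False
    then have "(a - x) * (b - x) > 0" using ne assms(1) by (auto simp: zero_less_mult_iff)
    then have "((a - x) * (b - x)) ^ n * (poly p a * poly p b) < 0 \<longleftrightarrow> poly p a * poly p b < 0"
      by (metis mult_less_cancel_left_pos mult_zero_right zero_less_power)
    then show ?thesis
      using False IH root(2) unfolding eq by (auto simp: num_real_zeros_factor simp del: greaterThanLessThan_iff)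
  qed
qed simp

text \<open>
  The variant for an interval that ends at a simple zero; it is needed when the smallest of the
  nonnegative zeros is \<open>0\<close>, which is its own reflection.
\<close>

lemma odd_num_real_zeros_iff_pderiv:
  assumes "a < b" "poly p a \<noteq> 0" "poly p b = 0" "poly (pderiv p) b \<noteq> 0"
  shows "odd (num_real_zeros p {a<..<b}) \<longleftrightarrow> poly p a * poly (pderiv p) b > 0"
proof -
  obtain q where q: "p = [:- b, 1:] * q" "poly q b = poly (pderiv p) b"
    using poly_root_factor assms(3) by blast
  have qa: "poly q a \<noteq> 0" using assms(2) q(1) by auto
  have "num_real_zeros p {a<..<b} = num_real_zeros q {a<..<b}"
    using num_real_zeros_factor[of q b 1 "{a<..<b}"] q assms(4) by simp
  then have "odd (num_real_zeros p {a<..<b}) \<longleftrightarrow> poly q a * poly q b < 0"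
    using odd_num_real_zeros_iff[OF assms(1) qa] q(2) assms(4) by simp
  moreover have "poly p a * poly (pderiv p) b = (a - b) * (poly q a * poly q b)"
    by (simp add: q(2)[symmetric]) (simp add: q(1) algebra_simps)
  ultimately show ?thesis using assms(1) by (simp add: zero_less_mult_iff)
qed

lemma odd_num_real_zeros_below_iff:
  assumes "lead_coeff p > 0" "poly p b \<noteq> 0"
  shows "odd (num_real_zeros p {..<b}) \<longleftrightarrow> (-1) ^ degree p * poly p b < 0"
proof -
  have p0: "p \<noteq> 0" using assms by auto
  define F where "F = insert b {x. poly p x = 0}"
  have finF: "finite F" using poly_roots_finite[OF p0] by (simp add: F_def)
  define a where "a = Min F - 1"
  have a: "a < x" if "x \<in> F" for x
    using Min_le[OF finF that] by (simp add: a_def)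
  have noroot: "poly p x \<noteq> 0" if "x \<le> a" for x using a[of x] that by (auto simp: F_def)
  have sgn: "(-1) ^ degree p * poly p a > 0" using assms(1) noroot by (intro poly_sign_below_roots) auto
  have "{x \<in> {..<b}. poly p x = 0} = {x \<in> {a<..<b}. poly p x = 0}"
    using a by (auto simp: F_def)
  then have "num_real_zeros p {..<b} = num_real_zeros p {a<..<b}"
    by (simp add: num_real_zeros_def)
  moreover have "odd (num_real_zeros p {a<..<b}) \<longleftrightarrow> poly p a * poly p b < 0"
    using noroot[of a] assms(2) a[of b] by (intro odd_num_real_zeros_iff) (auto simp: F_def)
  ultimately show ?thesis
    using sgn by (cases "even (degree p)") (auto simp: mult_less_0_iff)
qed

lemma num_real_zeros_pos_imp_root:
  assumes "num_real_zeros p S \<noteq> 0"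
  obtains x where "x \<in> S" "poly p x = 0"
  using assms unfolding num_real_zeros_def by (metis (mono_tags, lifting) empty_Collect_eq sum.empty)

lemma complex_poly_of_real: "poly (map_poly complex_of_real p) (complex_of_real x) = complex_of_real (poly p x)"
  by (induction p) (auto simp: map_poly_pCons)

text \<open>
  The sign condition at a positive zero replaces the parity conditions on the numbers of
  negative zeros between the reflected points. Since the derivative alternates in sign along
  consecutive simple zeros, so do the values at the reflected points.
\<close>

definition right_zeros_alternating :: "real poly \<Rightarrow> bool" where
  "right_zeros_alternating p \<longleftrightarrow>
     (\<forall>z\<in>complex_zeros p. Re z \<ge> 0 \<longrightarrow> z \<in> \<real>) \<and>
     (\<forall>x\<ge>0. poly p x = 0 \<longrightarrow>
        poly (pderiv p) x \<noteq> 0 \<and> (x > 0 \<longrightarrow> poly p (- x) * poly (pderiv p) x < 0))"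

definition right_zeros :: "real poly \<Rightarrow> real set" where
  "right_zeros p = {x. x \<ge> 0 \<and> poly p x = 0}"

lemma mult_neg_chain:
  fixes u v u' v' :: real
  assumes "u' * v' < 0" "v * v' < 0" "u' * u < 0"
  shows "u * v < 0"
  using assms by (auto simp: mult_less_0_iff)

text \<open>
  The parity condition on the zeros to the left of \<open>- \<mu>\<^sub>k\<close> settles the inequality at the largest zero
  \<open>\<mu>\<^sub>k\<close>, and the odd numbers of zeros between the reflected points carry it down to the others.
\<close>

lemma gen_hurwitz_order_imp:
  assumes "gen_hurwitz_order p k"
  shows "right_zeros_alternating p" "k = card (right_zeros p)"
proof -
  have lc: "lead_coeff p > 0" using assms by (simp add: gen_hurwitz_order_def)
  from assms obtain \<mu> where mono: "strict_mono_on {1..k} \<mu>"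
    and i: "{z \<in> complex_zeros p. Re z \<ge> 0} = (\<lambda>i. complex_of_real (\<mu> i)) ` {1..k}"
    and ord': "\<forall>i\<in>{1..k}. \<mu> i \<ge> 0 \<and> Polynomial.order (\<mu> i) p = 1"
    and ii': "\<forall>i\<in>{1..k}. \<mu> i > 0 \<longrightarrow> poly p (- \<mu> i) \<noteq> 0"
    and iii': "\<forall>i\<in>{1..<k}. odd (num_real_zeros p {- \<mu> (Suc i)<..<- \<mu> i})"
    and v': "k \<ge> 1 \<longrightarrow>
           (\<forall>x. poly p x = 0 \<longrightarrow>
              x \<in> \<mu> ` {1..k} \<union> (\<Union>i\<in>{1..<k}. {- \<mu> (Suc i)<..<- \<mu> i}) \<union>
                {- \<mu> 1<..<0} \<union> {..<- \<mu> k}) \<and>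
           (odd (num_real_zeros p {..<- \<mu> k}) \<longleftrightarrow> even (degree p))"
    unfolding gen_hurwitz_order_def by (elim conjE exE) (rule that)
  have ord: "\<mu> i \<ge> 0 \<and> Polynomial.order (\<mu> i) p = 1" if "i \<in> {1..k}" for i
    using ord' that by (rule bspec)
  have ii: "poly p (- \<mu> i) \<noteq> 0" if "i \<in> {1..k}" "\<mu> i > 0" for i
    using bspec[OF ii' that(1)] that(2) by (rule mp)
  have iii: "odd (num_real_zeros p {- \<mu> (Suc i)<..<- \<mu> i})" if "i \<in> {1..<k}" for i
    using iii' that by (rule bspec)
  have v: "odd (num_real_zeros p {..<- \<mu> k}) \<longleftrightarrow> even (degree p)" if "k \<ge> 1"
    using v' that by (rule mp[THEN conjunct2])
  have p0: "p \<noteq> 0" using lc by auto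
  have rz: "right_zeros p = \<mu> ` {1..k}"
  proof (intro equalityI subsetI)
    fix x assume "x \<in> right_zeros p"
    then have "complex_of_real x \<in> {z \<in> complex_zeros p. Re z \<ge> 0}"
      by (simp add: right_zeros_def complex_zeros_def complex_poly_of_real)
    then show "x \<in> \<mu> ` {1..k}" unfolding i by auto
  next
    fix x assume "x \<in> \<mu> ` {1..k}"
    then have "x \<ge> 0" "Polynomial.order x p = 1" using ord by auto
    then show "x \<in> right_zeros p" using order_eq_1_iff[OF p0] by (auto simp: right_zeros_def)
  qed
  show "k = card (right_zeros p)"
    unfolding rz using mono by (simp add: card_image strict_mono_on_imp_inj_on)
  have onto: "\<exists>j\<in>{1..k}. x = \<mu> j" if "poly p x = 0" "x \<ge> 0" for x
    using that rz[THEN equalityD1, THEN subsetD, of x] by (auto simp: right_zeros_def)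
  have root: "poly p (\<mu> i) = 0" "poly (pderiv p) (\<mu> i) \<noteq> 0" if "i \<in> {1..k}" for i
    using ord[OF that] order_eq_1_iff[OF p0] by auto
  have mu: "\<mu> i < \<mu> j \<longleftrightarrow> i < j" if "i \<in> {1..k}" "j \<in> {1..k}" for i j
    using mono that by (metis strict_mono_on_less)
  have neg: "poly p (- \<mu> i) * poly (pderiv p) (\<mu> i) < 0" if "i \<le> k" "1 \<le> i" "\<mu> i > 0" for i
    using that
  proof (induction i rule: inc_induct)
    case base
    have "x \<le> \<mu> k" if px: "poly p x = 0" for x
    proof (cases "x \<ge> 0")
      case True
      then obtain j where j: "j \<in> {1..k}" "x = \<mu> j" using px True onto by blast
      then show ?thesis using mu[of k j] base by (auto simp: not_less[symmetric])
    qed (use base in simp)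
    then have "poly (pderiv p) (\<mu> k) > 0"
      using root[of k] lc base by (intro pderiv_pos_last_root) force+
    moreover have "poly p (- \<mu> k) < 0"
      using v base odd_num_real_zeros_below_iff[OF lc ii[of k]]
      by (cases "even (degree p)") (auto simp: ii not_less_iff_gr_or_eq)
    ultimately show ?case by (simp add: mult_neg_pos)
  next
    case (step i)
    then have iin: "i \<in> {1..k}" "Suc i \<in> {1..k}" by auto
    have lt: "\<mu> i < \<mu> (Suc i)" using mu iin by simp
    have "poly p x \<noteq> 0" if xx: "\<mu> i < x" "x < \<mu> (Suc i)" for x
    proof
      assume "poly p x = 0"
      then obtain j where j: "j \<in> {1..k}" "x = \<mu> j" using xx step onto[of x] by force
      then show False using mu[of i j] mu[of j "Suc i"] iin that by auto
    qed
    then have "poly (pderiv p) (\<mu> i) * poly (pderiv p) (\<mu> (Suc i)) < 0"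
      using iin root lt by (intro pderiv_sign_consecutive_roots) auto
    moreover have "poly p (- \<mu> (Suc i)) * poly p (- \<mu> i) < 0"
      using odd_num_real_zeros_iff[of "- \<mu> (Suc i)" "- \<mu> i" p] iii[of i] ii iin step lt by auto
    moreover have "poly p (- \<mu> (Suc i)) * poly (pderiv p) (\<mu> (Suc i)) < 0"
      using step lt by auto
    ultimately show ?case by (rule_tac mult_neg_chain)
  qed
  show "right_zeros_alternating p"
    unfolding right_zeros_alternating_def
  proof (intro conjI ballI allI impI)
    fix z assume "z \<in> complex_zeros p" "Re z \<ge> 0"
    then have "z \<in> {z \<in> complex_zeros p. Re z \<ge> 0}" by simp
    then show "z \<in> \<real>" unfolding i by auto
  next
    fix x assume "x \<ge> 0" "poly p x = 0"
    then obtain j where j: "j \<in> {1..k}" "x = \<mu> j" using onto by blast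
    then show "poly (pderiv p) x \<noteq> 0" using root by simp
    show "poly p (- x) * poly (pderiv p) x < 0" if "x > 0" using neg[of j] j that by auto
  qed
qed

text \<open>
  Each parity condition compares the signs of two values that are known from the inequality and from
  the signs of the derivative. The bound on the order holds because the reflected points enclose
  further zeros: there are \<open>k\<close> nonnegative and at least \<open>k - 1\<close> negative ones.
\<close>

lemma gen_hurwitz_order_intro:
  assumes lc: "lead_coeff p > 0" and ok: "right_zeros_alternating p"
  shows "gen_hurwitz_order p (card (right_zeros p))"
proof -
  have p0: "p \<noteq> 0" using lc by auto
  define k where "k = card (right_zeros p)"
  have finr: "finite {x. poly p x = 0}" using poly_roots_finite[OF p0] .
  have fin: "finite (right_zeros p)" using finr by (rule finite_subset[rotated]) (auto simp: right_zeros_def)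
  obtain h where h: "h ` {..<k} = right_zeros p" "strict_mono_on {..<k} h"
    using enumerate_finite_real_set[OF fin] unfolding k_def by blast
  define \<mu> where "\<mu> i = h (i - 1)" for i
  have img: "\<mu> ` {1..k} = right_zeros p"
  proof -
    have "(\<lambda>i. i - 1) ` {1..k} = {..<k}"
      by (auto simp: image_iff intro!: bexI[of _ "Suc _"])
    then show ?thesis unfolding h(1)[symmetric] \<mu>_def by (metis image_image)
  qed
  have mono: "strict_mono_on {1..k} \<mu>"
  proof (rule strict_mono_onI)
    fix r s assume "r \<in> {1..k}" "s \<in> {1..k}" "r < s"
    then show "\<mu> r < \<mu> s"
      unfolding \<mu>_def by (intro strict_mono_onD[OF h(2)]) auto
  qed
  have mu: "\<mu> i < \<mu> j \<longleftrightarrow> i < j" if "i \<in> {1..k}" "j \<in> {1..k}" for i j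
    using mono that by (metis strict_mono_on_less)
  have mule: "\<mu> i \<le> \<mu> j \<longleftrightarrow> i \<le> j" if "i \<in> {1..k}" "j \<in> {1..k}" for i j
    using mu that by (meson not_less)
  have root: "poly p (\<mu> i) = 0" "\<mu> i \<ge> 0" if "i \<in> {1..k}" for i
    using img that by (auto simp: right_zeros_def)
  have der: "poly (pderiv p) (\<mu> i) \<noteq> 0" if "i \<in> {1..k}" for i
    using ok root[OF that] by (auto simp: right_zeros_alternating_def)
  have neg: "poly p (- \<mu> i) * poly (pderiv p) (\<mu> i) < 0" if "i \<in> {1..k}" "\<mu> i > 0" for i
    using ok root[OF that(1)] that by (auto simp: right_zeros_alternating_def)
  have ii: "poly p (- \<mu> i) \<noteq> 0" if "i \<in> {1..k}" "\<mu> i > 0" for i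
    using neg[OF that] by auto
  have onto: "\<exists>j\<in>{1..k}. x = \<mu> j" if "poly p x = 0" "x \<ge> 0" for x
    using that img by (auto simp: right_zeros_def)
  have iii: "odd (num_real_zeros p {- \<mu> (Suc i)<..<- \<mu> i})" if "i \<in> {1..<k}" for i
  proof -
    have iin: "i \<in> {1..k}" "Suc i \<in> {1..k}" using that by auto
    have lt: "\<mu> i < \<mu> (Suc i)" using mu iin by simp
    then have pos: "\<mu> (Suc i) > 0" using root(2)[OF iin(1)] by simp
    have "poly p x \<noteq> 0" if xx: "\<mu> i < x" "x < \<mu> (Suc i)" for x
    proof
      assume "poly p x = 0"
      then obtain j where j: "j \<in> {1..k}" "x = \<mu> j" using xx onto[of x] root(2)[OF iin(1)] by force
      then show False using mu[of i j] mu[of j "Suc i"] iin that by auto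
    qed
    then have dd: "poly (pderiv p) (\<mu> i) * poly (pderiv p) (\<mu> (Suc i)) < 0"
      using iin root der lt by (intro pderiv_sign_consecutive_roots) auto
    note n1 = neg[OF iin(2) pos]
    show ?thesis
    proof (cases "\<mu> i > 0")
      case True
      have "poly p (- \<mu> (Suc i)) * poly p (- \<mu> i) < 0"
        using neg[OF iin(1) True] n1 dd by (auto simp: mult_less_0_iff)
      then show ?thesis
        using odd_num_real_zeros_iff[of "- \<mu> (Suc i)" "- \<mu> i" p] ii iin pos True lt by auto
    next
      case False
      then have z: "\<mu> i = 0" using root(2)[OF iin(1)] by simp
      have "poly p (- \<mu> (Suc i)) * poly (pderiv p) (\<mu> i) > 0"
        using n1 dd by (auto simp: mult_less_0_iff zero_less_mult_iff)
      then show ?thesis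
        using odd_num_real_zeros_iff_pderiv[of "- \<mu> (Suc i)" "- \<mu> i" p] ii[OF iin(2) pos]
          root(1)[OF iin(1)] der[OF iin(1)] z pos by simp
    qed
  qed
  have iv: "even (num_real_zeros p {- \<mu> 1<..<0})" if "k \<ge> 1"
  proof -
    have one: "1 \<in> {1..k}" using that by simp
    show ?thesis
    proof (cases "\<mu> 1 > 0")
      case True
      have none: "poly p x \<noteq> 0" if xx: "0 \<le> x" "x < \<mu> 1" for x
      proof
        assume "poly p x = 0"
        then obtain j where "j \<in> {1..k}" "x = \<mu> j" using onto[of x] xx by force
        then show False using mule[of 1 j] one that by auto
      qed
      have "poly (pderiv p) (\<mu> 1) * poly p 0 < 0"
        using root der one True none by (intro poly_sign_left_of_simple_root) auto
      then have "\<not> poly p (- \<mu> 1) * poly p 0 < 0"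
        using neg[OF one True] by (auto simp: mult_less_0_iff)
      then show ?thesis
        using odd_num_real_zeros_iff[of "- \<mu> 1" 0 p] True ii[OF one True] none[of 0] by simp
    next
      case False
      then show ?thesis using root(2)[OF one] by (simp add: num_real_zeros_def)
    qed
  qed
  have v: "odd (num_real_zeros p {..<- \<mu> k}) \<longleftrightarrow> even (degree p)" if "k \<ge> 1"
  proof -
    have kin: "k \<in> {1..k}" using that by simp
    have above: "poly p x \<noteq> 0" if xx: "\<mu> k < x" for x
    proof
      assume "poly p x = 0"
      then obtain j where "j \<in> {1..k}" "x = \<mu> j" using onto[of x] xx root(2)[OF kin] by force
      then show False using mule[of j k] kin that by auto
    qed
    have "poly (pderiv p) (\<mu> k) > 0"
      using root[OF kin] der[OF kin] lc above by (intro pderiv_pos_last_root) auto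
    show ?thesis
    proof (cases "\<mu> k > 0")
      case True
      then have "poly p (- \<mu> k) < 0"
        using neg[OF kin True] \<open>poly (pderiv p) (\<mu> k) > 0\<close> by (simp add: mult_less_0_iff)
      then show ?thesis using odd_num_real_zeros_below_iff[OF lc ii[OF kin True]]
        by (cases "even (degree p)") auto
    next
      case False
      then have z: "\<mu> k = 0" using root(2)[OF kin] by simp
      \<comment> \<open>\<open>0\<close> is the only nonnegative zero, and the interval ends there\<close>
      obtain q where q: "p = [:- 0, 1:] * q" "poly q 0 = poly (pderiv p) 0"
        using poly_root_factor[of p 0] root(1)[OF kin] z by auto
      have q0: "poly q 0 > 0" using q(2) \<open>poly (pderiv p) (\<mu> k) > 0\<close> z by simp
      have "q \<noteq> 0" using q0 by auto
      then have lq: "lead_coeff q > 0" "degree p = Suc (degree q)" using lc q(1) by auto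
      have "num_real_zeros p {..<0} = num_real_zeros q {..<0}"
        using num_real_zeros_factor[of q 0 1 "{..<0}"] q q0 by simp
      then show ?thesis
        using odd_num_real_zeros_below_iff[OF lq(1), of 0] q0 lq(2) z
        by (cases "even (degree q)") auto
    qed
  qed
  have cover: "x \<in> \<mu> ` {1..k} \<union> (\<Union>i\<in>{1..<k}. {- \<mu> (Suc i)<..<- \<mu> i}) \<union>
      {- \<mu> 1<..<0} \<union> {..<- \<mu> k}" if "k \<ge> 1" "poly p x = 0" for x
  proof (cases "x \<ge> 0")
    case True
    then show ?thesis using onto that by auto
  next
    case False
    have ne: "x \<noteq> - \<mu> i" if "i \<in> {1..k}" for i
      using ii[OF that] False \<open>poly p x = 0\<close> by auto
    define I where "I = {i \<in> {1..k}. \<mu> i < - x}"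
    show ?thesis
    proof (cases "I = {}")
      case True
      then have "\<not> \<mu> 1 < - x" using that by (auto simp: I_def)
      then show ?thesis using ne[of 1] that False by auto
    next
      case nonempty: False
      have finI: "finite I" by (simp add: I_def)
      define m where "m = Max I"
      have m: "m \<in> {1..k}" "\<mu> m < - x" using Max_in[OF finI nonempty] by (auto simp: m_def I_def)
      show ?thesis
      proof (cases "m = k")
        case True
        then show ?thesis using m by auto
      next
        case False
        then have sm: "Suc m \<in> {1..k}" using m by auto
        have "Suc m \<notin> I" using Max_ge[OF finI, of "Suc m"] by (auto simp: m_def)
        then have "- x < \<mu> (Suc m)" using sm ne[of "Suc m"] by (force simp: I_def)
        then have "x \<in> {- \<mu> (Suc m)<..<- \<mu> m}" using m by auto
        moreover have "m \<in> {1..<k}" using m sm by auto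
        ultimately show ?thesis by blast
      qed
    qed
  qed
  have bound: "k \<le> (degree p + 1) div 2"
  proof -
    have "\<exists>r. r \<in> {- \<mu> (Suc i)<..<- \<mu> i} \<and> poly p r = 0" if "i \<in> {1..<k}" for i
      using num_real_zeros_pos_imp_root iii[OF that] by (metis even_zero)
    then obtain r where r: "\<And>i. i \<in> {1..<k} \<Longrightarrow> r i \<in> {- \<mu> (Suc i)<..<- \<mu> i} \<and> poly p (r i) = 0"
      by metis
    have lt: "r j < r i" if "i \<in> {1..<k}" "j \<in> {1..<k}" "i < j" for i j
    proof -
      have "\<mu> (Suc i) \<le> \<mu> j" using that by (subst mule) auto
      then show ?thesis using r[OF that(1)] r[OF that(2)] by auto
    qed
    have inj: "inj_on r {1..<k}" by (intro linorder_inj_onI) (use lt in force)+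
    have neg: "r i < 0" if "i \<in> {1..<k}" for i
      using r[OF that] root(2)[of i] that by auto
    have "card (right_zeros p \<union> r ` {1..<k}) = k + (k - 1)"
    proof (subst card_Un_disjoint)
      show "right_zeros p \<inter> r ` {1..<k} = {}" using neg by (force simp: right_zeros_def)
      show "card (right_zeros p) + card (r ` {1..<k}) = k + (k - 1)"
        using card_image[OF inj] by (simp add: k_def)
    qed (use fin in auto)
    moreover have "card (right_zeros p \<union> r ` {1..<k}) \<le> card {x. poly p x = 0}"
      using r finr by (intro card_mono) (auto simp: right_zeros_def)
    ultimately show ?thesis using card_poly_roots_bound[OF p0] by linarith
  qed
  have i: "{z \<in> complex_zeros p. Re z \<ge> 0} = (\<lambda>i. complex_of_real (\<mu> i)) ` {1..k}"
  proof (intro equalityI subsetI)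
    fix z assume z: "z \<in> {z \<in> complex_zeros p. Re z \<ge> 0}"
    then have "z \<in> \<real>" using ok by (auto simp: right_zeros_alternating_def)
    then obtain x where x: "z = complex_of_real x" by (auto elim: Reals_cases)
    then have "poly p x = 0" "x \<ge> 0" using z by (auto simp: complex_zeros_def complex_poly_of_real)
    then show "z \<in> (\<lambda>i. complex_of_real (\<mu> i)) ` {1..k}" using onto x by auto
  next
    fix z assume "z \<in> (\<lambda>i. complex_of_real (\<mu> i)) ` {1..k}"
    then show "z \<in> {z \<in> complex_zeros p. Re z \<ge> 0}"
      using root by (auto simp: complex_zeros_def complex_poly_of_real)
  qed
  have vi: "Re z < 0" if "z \<in> complex_zeros p" "z \<notin> \<real>" for z
    using ok that by (auto simp: right_zeros_alternating_def not_le[symmetric])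
  have ord: "Polynomial.order (\<mu> i) p = 1" if "i \<in> {1..k}" for i
    using root(1)[OF that] der[OF that] order_eq_1_iff[OF p0] by blast
  show ?thesis
    unfolding gen_hurwitz_order_def k_def[symmetric]
    by (intro conjI exI[of _ \<mu>] ballI allI impI)
      (rule lc bound mono i root(2) ord ii iii iv v cover vi; assumption)+
qed

lemma gen_hurwitz_order_iff:
  assumes "lead_coeff p > 0"
  shows "gen_hurwitz_order p k \<longleftrightarrow> right_zeros_alternating p \<and> k = card (right_zeros p)"
  using gen_hurwitz_order_imp gen_hurwitz_order_intro[OF assms] by blast

section \<open>Interlacing confines the zeros in the right half-plane\<close>

definition even_part :: "real poly \<Rightarrow> real poly" where
  "even_part p = Poly (map (\<lambda>i. coeff p (2 * i)) [0..<Suc (degree p)])"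

definition odd_part :: "real poly \<Rightarrow> real poly" where
  "odd_part p = Poly (map (\<lambda>i. coeff p (2 * i + 1)) [0..<Suc (degree p)])"

lemma coeff_even_part [simp]: "coeff (even_part p) i = coeff p (2 * i)"
  by (auto simp: even_part_def coeff_Poly_eq nth_default_def coeff_eq_0 simp del: upt_Suc)

lemma coeff_odd_part [simp]: "coeff (odd_part p) i = coeff p (2 * i + 1)"
  by (auto simp: odd_part_def coeff_Poly_eq nth_default_def coeff_eq_0 simp del: upt_Suc)

lemma even_part_pCons: "even_part (pCons a p) = pCons a (odd_part p)"
  and odd_part_pCons: "odd_part (pCons a p) = even_part p"
  by (auto intro!: poly_eqI simp: coeff_pCons split: nat.splits)

lemma even_part_0 [simp]: "even_part 0 = 0" and odd_part_0 [simp]: "odd_part 0 = 0"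
  by (auto intro!: poly_eqI)

lemma poly_even_odd: "poly p z = poly (even_part p) (z\<^sup>2) + z * poly (odd_part p) (z\<^sup>2)"
  by (induction p) (simp_all add: even_part_pCons odd_part_pCons algebra_simps power2_eq_square)

abbreviation cpoly :: "real poly \<Rightarrow> complex \<Rightarrow> complex" where
  "cpoly p \<equiv> poly (map_poly complex_of_real p)"

lemma cpoly_add: "cpoly (p + q) z = cpoly p z + cpoly q z"
proof -
  have "map_poly complex_of_real (p + q) = map_poly complex_of_real p + map_poly complex_of_real q"
    by (intro poly_eqI) (simp add: coeff_map_poly)
  then show ?thesis by simp
qed

lemma cpoly_smult: "cpoly (smult a p) z = complex_of_real a * cpoly p z"
proof -
  have "map_poly complex_of_real (smult a p) = smult (complex_of_real a) (map_poly complex_of_real p)"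
    by (intro poly_eqI) (simp add: coeff_map_poly)
  then show ?thesis by simp
qed

lemma cpoly_mult: "cpoly (p * q) z = cpoly p z * cpoly q z"
  by (induction p) (simp_all add: cpoly_add cpoly_smult map_poly_pCons algebra_simps)

lemma cpoly_even_odd: "cpoly p z = cpoly (even_part p) (z\<^sup>2) + z * cpoly (odd_part p) (z\<^sup>2)"
  by (induction p)
    (simp_all add: even_part_pCons odd_part_pCons map_poly_pCons algebra_simps power2_eq_square)

lemma cpoly_imaginary:
  "cpoly p (\<i> * complex_of_real y) =
     Complex (poly (even_part p) (- (y\<^sup>2))) (y * poly (odd_part p) (- (y\<^sup>2)))"
proof -
  have "(\<i> * complex_of_real y)\<^sup>2 = complex_of_real (- (y\<^sup>2))"
    by (simp add: power_mult_distrib)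
  then show ?thesis
    unfolding cpoly_even_odd[of p "\<i> * complex_of_real y"]
    by (simp only: complex_poly_of_real) (simp add: complex_eq_iff)
qed

lemma degree_even_part:
  assumes "degree p = 2 * l" "lead_coeff p > 0"
  shows "degree (even_part p) = l" "lead_coeff (even_part p) = lead_coeff p"
proof -
  show d: "degree (even_part p) = l"
  proof (rule antisym)
    show "degree (even_part p) \<le> l" using assms(1) by (intro degree_le) (auto simp: coeff_eq_0)
    show "l \<le> degree (even_part p)" using assms by (intro le_degree) auto
  qed
  show "lead_coeff (even_part p) = lead_coeff p" using assms(1) by (simp add: d)
qed

lemma degree_odd_part:
  assumes "degree p = 2 * l + 1" "lead_coeff p > 0"
  shows "degree (odd_part p) = l" "lead_coeff (odd_part p) = lead_coeff p"
proof -
  show d: "degree (odd_part p) = l"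
  proof (rule antisym)
    show "degree (odd_part p) \<le> l" using assms(1) by (intro degree_le) (auto simp: coeff_eq_0)
    show "l \<le> degree (odd_part p)" using assms by (intro le_degree) auto
  qed
  show "lead_coeff (odd_part p) = lead_coeff p" using assms(1) by (simp add: d)
qed

lemma poly_pderiv_even_odd:
  "poly (pderiv p) x = 2 * x * poly (pderiv (even_part p)) (x\<^sup>2) + poly (odd_part p) (x\<^sup>2) +
     2 * x\<^sup>2 * poly (pderiv (odd_part p)) (x\<^sup>2)"
proof (rule DERIV_unique)
  show "(poly p has_real_derivative poly (pderiv p) x) (at x)" by (rule poly_DERIV)
  have "((\<lambda>z. poly (even_part p) (z\<^sup>2) + z * poly (odd_part p) (z\<^sup>2)) has_real_derivative
      2 * x * poly (pderiv (even_part p)) (x\<^sup>2) + poly (odd_part p) (x\<^sup>2) +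
      2 * x\<^sup>2 * poly (pderiv (odd_part p)) (x\<^sup>2)) (at x)"
    by (auto intro!: derivative_eq_intros simp: algebra_simps power2_eq_square)
  moreover have "(\<lambda>z. poly (even_part p) (z\<^sup>2) + z * poly (odd_part p) (z\<^sup>2)) = poly p"
    using poly_even_odd[of p] by (intro ext) simp
  ultimately show "(poly p has_real_derivative
      2 * x * poly (pderiv (even_part p)) (x\<^sup>2) + poly (odd_part p) (x\<^sup>2) +
      2 * x\<^sup>2 * poly (pderiv (odd_part p)) (x\<^sup>2)) (at x)" by simp
qed

text \<open>
  The partial fraction decomposition \<open>B / A = (\<Sum>i. (c i / a) / (u - x i))\<close> with positive residues,
  multiplied by \<open>A\<close>; here \<open>a\<close> is the leading coefficient of \<open>A\<close>. It is Lagrange interpolation of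
  \<open>B\<close> at the zeros of \<open>A\<close>.
\<close>

lemma interlaced_partial_fractions:
  assumes "interlaced A B" "degree B < degree A" "lead_coeff A > 0"
  obtains x c L where
    "\<And>i. i < degree A \<Longrightarrow> c i > 0"
    "\<And>i. i < degree A \<Longrightarrow> A = [:- x i, 1:] * smult (lead_coeff A) (L i)"
    "B = (\<Sum>i<degree A. smult (c i) (L i))"
    "A = smult (lead_coeff A) (\<Prod>i<degree A. [:- x i, 1:])"
    "\<And>i. i < degree A \<Longrightarrow> poly (L i) (x i) \<noteq> 0"
proof -
  obtain x where x: "strict_mono_on {..<degree A} x" "\<And>i. i < degree A \<Longrightarrow> poly A (x i) = 0"
    "\<And>i. i < degree A \<Longrightarrow> (-1) ^ (degree A + Suc i) * poly B (x i) > 0"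
    using assms(1) by (elim interlacedE) blast
  define d where "d = degree A"
  define a where "a = lead_coeff A"
  have a: "a > 0" using assms(3) by (simp add: a_def)
  define L where "L i = (\<Prod>j\<in>{..<d} - {i}. [:- x j, 1:])" for i
  define c where "c i = poly B (x i) / poly (L i) (x i)" for i
  have Aprod: "A = smult a (\<Prod>i<d. [:- x i, 1:])"
    unfolding a_def d_def by (rule poly_eq_prod_roots[OF x(1,2)])
  have AL: "A = [:- x i, 1:] * smult a (L i)" if "i < d" for i
  proof -
    have "(\<Prod>i<d. [:- x i, 1:]) = [:- x i, 1:] * L i"
      unfolding L_def using that by (intro prod.remove) auto
    then show ?thesis using Aprod by (simp only: mult_smult_right)
  qed
  have L': "poly (pderiv A) (x i) = a * poly (L i) (x i)" if "i < d" for i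
    by (subst AL[OF that], subst pderiv_mult) (simp add: pderiv_pCons pderiv_smult)
  have sL: "(-1) ^ (d + Suc i) * poly (L i) (x i) > 0" if "i < d" for i
  proof -
    have "i < degree A" using that by (simp add: d_def)
    then have "(-1) ^ (d + Suc i) * (a * poly (L i) (x i)) > 0"
      using sign_pderiv_at_root[OF x(1,2) assms(3), of i] unfolding L'[OF that] by (simp only: d_def)
    then show ?thesis using a by (metis mult.left_commute zero_less_mult_pos)
  qed
  have Lne: "poly (L i) (x i) \<noteq> 0" if "i < d" for i using sL[OF that] by auto
  have c: "c i > 0" if "i < d" for i
  proof -
    have "((-1) ^ (d + Suc i) * poly B (x i)) / ((-1) ^ (d + Suc i) * poly (L i) (x i)) > 0"
      using sL[OF that] x(3)[of i] that unfolding d_def by (intro divide_pos_pos) auto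
    then show ?thesis by (simp add: c_def)
  qed
  have L0: "poly (L i) (x j) = 0" if "j < d" "j \<noteq> i" for i j
    using that by (auto simp: L_def poly_prod)
  have degL: "degree (L i) < d" if "i < d" for i
    unfolding L_def using that by (subst degree_prod_eq_sum_degree) auto
  define S where "S = (\<Sum>i<d. smult (c i) (L i))"
  have degS: "degree S < d"
    unfolding S_def using assms(2) degL by (intro degree_sum_less le_less_trans[OF degree_smult_le]) (auto simp: d_def)
  have "poly (B - S) (x j) = 0" if "j < d" for j
  proof -
    have "poly S (x j) = (\<Sum>i\<in>{j}. c i * poly (L i) (x j))"
      unfolding S_def poly_sum poly_smult using that L0 by (intro sum.mono_neutral_right) auto
    then show ?thesis using Lne[OF that] by (simp add: c_def)
  qed
  then have sub: "x ` {..<d} \<subseteq> {u. poly (B - S) u = 0}" by auto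
  have "B = S"
  proof (rule ccontr)
    assume "B \<noteq> S"
    then have ne: "B - S \<noteq> 0" by simp
    have "card (x ` {..<d}) \<le> degree (B - S)"
      using card_poly_roots_bound[OF ne] poly_roots_finite[OF ne] sub card_mono le_trans by blast
    moreover have "card (x ` {..<d}) = d"
      using x(1) unfolding d_def by (simp add: card_image strict_mono_on_imp_inj_on)
    moreover have "degree (B - S) < d" using degS assms(2) by (intro degree_diff_less) (auto simp: d_def)
    ultimately show False by simp
  qed
  then have "B = (\<Sum>i<d. smult (c i) (L i))" by (simp only: S_def)
  note facts = c AL this Aprod Lne
  show ?thesis
    by (rule that[of c x L]; (unfold a_def[symmetric])?, (unfold d_def[symmetric])?) (rule facts; assumption?)+
qed

text \<open>
  The Wronskian is linear in \<open>B\<close>, and for the summand \<open>L i\<close> of the partial fraction decomposition it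
  equals \<open>- a (L i)\<^sup>2\<close>.
\<close>

lemma interlaced_Wronskian_neg:
  assumes "interlaced A B" "degree B < degree A" "lead_coeff A > 0"
  shows "poly (pderiv B) u * poly A u - poly B u * poly (pderiv A) u < 0"
proof -
  obtain x c L where c: "\<And>i. i < degree A \<Longrightarrow> c i > 0"
    and AL: "\<And>i. i < degree A \<Longrightarrow> A = [:- x i, 1:] * smult (lead_coeff A) (L i)"
    and B: "B = (\<Sum>i<degree A. smult (c i) (L i))"
    and A: "A = smult (lead_coeff A) (\<Prod>i<degree A. [:- x i, 1:])"
    and L: "\<And>i. i < degree A \<Longrightarrow> poly (L i) (x i) \<noteq> 0"
    by (rule interlaced_partial_fractions[OF assms]) (rule that; assumption)
  define a where "a = lead_coeff A"
  have W: "poly (pderiv (L i)) u * poly A u - poly (L i) u * poly (pderiv A) u = - (a * (poly (L i) u)\<^sup>2)"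
    if "i < degree A" for i
  proof -
    have e1: "poly A u = (u - x i) * (a * poly (L i) u)"
      by (subst AL[OF that]) (simp add: a_def algebra_simps)
    have e2: "poly (pderiv A) u = a * poly (L i) u + (u - x i) * (a * poly (pderiv (L i)) u)"
      by (subst AL[OF that], subst pderiv_mult)
        (simp add: a_def pderiv_pCons pderiv_smult algebra_simps)
    show ?thesis unfolding e1 e2 by (simp add: algebra_simps power2_eq_square)
  qed
  have pB: "poly B u = (\<Sum>i<degree A. c i * poly (L i) u)"
    unfolding arg_cong[OF B, of "\<lambda>P. poly P u"] by (simp add: poly_sum)
  have "pderiv (\<Sum>i<d. F i) = (\<Sum>i<d. pderiv (F i))" for F :: "nat \<Rightarrow> real poly" and d :: nat
    by (induction d) (auto simp: pderiv_add)
  note pderiv_sum = this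
  have pB': "poly (pderiv B) u = (\<Sum>i<degree A. c i * poly (pderiv (L i)) u)"
    unfolding arg_cong[OF B, of "\<lambda>P. poly (pderiv P) u"]
    by (simp add: poly_sum pderiv_sum pderiv_smult)
  have "poly (pderiv B) u * poly A u - poly B u * poly (pderiv A) u =
      (\<Sum>i<degree A. c i * (poly (pderiv (L i)) u * poly A u - poly (L i) u * poly (pderiv A) u))"
    unfolding pB pB' sum_distrib_right sum_subtractf[symmetric]
    by (intro sum.cong refl) (simp add: right_diff_distrib mult.assoc)
  also have "\<dots> = - (\<Sum>i<degree A. c i * (a * (poly (L i) u)\<^sup>2))"
    by (simp add: W sum_negf)
  finally have eq: "poly (pderiv B) u * poly A u - poly B u * poly (pderiv A) u =
      - (\<Sum>i<degree A. c i * (a * (poly (L i) u)\<^sup>2))" .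
  have "(\<Sum>i<degree A. c i * (a * (poly (L i) u)\<^sup>2)) > 0"
  proof -
    obtain k where k: "k < degree A" "poly (L k) u \<noteq> 0"
    proof (cases "poly A u = 0")
      case True
      have "poly A u = lead_coeff A * (\<Prod>i<degree A. u - x i)"
        by (subst A) (simp add: poly_prod)
      then obtain k where "k < degree A" "u = x k" using True assms(3) by auto
      then show ?thesis using L that by blast
    next
      case False
      have "poly (L 0) u \<noteq> 0"
      proof
        assume "poly (L 0) u = 0"
        then have "poly A u = 0" by (subst AL[of 0]) (use assms in auto)
        then show False using False by simp
      qed
      then show ?thesis using that[of 0] assms(2) by auto
    qed
    have "a > 0" using assms(3) by (simp add: a_def)
    then show ?thesis using c k
      by (intro sum_pos2[of _ k]) (auto intro!: mult_nonneg_nonneg simp: less_imp_le)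
  qed
  then show ?thesis using eq by simp
qed

text \<open>
  Each summand \<open>1 / (u - x)\<close> of the partial fraction decomposition maps the upper half-plane to the
  lower one.
\<close>

lemma interlaced_quotient_Im:
  assumes "interlaced A B" "degree B < degree A" "lead_coeff A > 0" "Im u \<noteq> 0"
  shows "cpoly A u \<noteq> 0" "Im (cpoly B u / cpoly A u) * Im u < 0"
proof -
  obtain x c L where c: "\<And>i. i < degree A \<Longrightarrow> c i > 0"
    and AL: "\<And>i. i < degree A \<Longrightarrow> A = [:- x i, 1:] * smult (lead_coeff A) (L i)"
    and B: "B = (\<Sum>i<degree A. smult (c i) (L i))"
    and A: "A = smult (lead_coeff A) (\<Prod>i<degree A. [:- x i, 1:])"
    by (rule interlaced_partial_fractions[OF assms(1-3)]) (rule that; assumption)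
  define a where "a = lead_coeff A"
  have a: "a > 0" using assms(3) by (simp add: a_def)
  have lin: "cpoly [:- t, 1:] u = u - complex_of_real t" for t
    by (simp add: map_poly_pCons)
  have sum: "cpoly (\<Sum>i<d. F i) u = (\<Sum>i<d. cpoly (F i) u)" for F and d :: nat
    by (induction d) (auto simp: cpoly_add)
  have prod: "cpoly (\<Prod>i<d. F i) u = (\<Prod>i<d. cpoly (F i) u)" for F and d :: nat
    by (induction d) (auto simp: cpoly_mult)
  have ne: "u - complex_of_real t \<noteq> 0" for t using assms(4) by (auto simp: complex_eq_iff)
  have "cpoly A u = a * (\<Prod>i<degree A. u - complex_of_real (x i))"
    by (subst A) (simp only: cpoly_smult prod lin a_def)
  then show A0: "cpoly A u \<noteq> 0" using a ne by simp
  have AL': "cpoly A u = (u - complex_of_real (x i)) * (complex_of_real a * cpoly (L i) u)"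
    if "i < degree A" for i
    by (subst AL[OF that]) (simp only: cpoly_mult lin cpoly_smult a_def)
  have "cpoly B u / cpoly A u = (\<Sum>i<degree A. complex_of_real (c i) * cpoly (L i) u / cpoly A u)"
    by (subst B) (simp only: sum cpoly_smult sum_divide_distrib)
  also have "\<dots> = (\<Sum>i<degree A. complex_of_real (c i / a) / (u - complex_of_real (x i)))"
  proof (intro sum.cong refl)
    fix i assume i: "i \<in> {..<degree A}"
    have "cpoly (L i) u \<noteq> 0" using AL'[of i] i A0 by auto
    then show "complex_of_real (c i) * cpoly (L i) u / cpoly A u =
        complex_of_real (c i / a) / (u - complex_of_real (x i))"
      using AL'[of i] i ne[of "x i"] a by (simp add: divide_simps)
  qed
  finally have "Im (cpoly B u / cpoly A u) =
      (\<Sum>i<degree A. Im (complex_of_real (c i / a) / (u - complex_of_real (x i))))" by simp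
  also have "\<dots> = (\<Sum>i<degree A. - (c i / a * Im u / (cmod (u - complex_of_real (x i)))\<^sup>2))"
    by (intro sum.cong refl) (simp add: Im_divide cmod_power2 del: of_real_divide)
  also have "\<dots> * Im u = - (\<Sum>i<degree A. c i / a * (Im u)\<^sup>2 / (cmod (u - complex_of_real (x i)))\<^sup>2)"
    by (simp add: sum_distrib_right sum_negf power2_eq_square mult.assoc)
  also have "\<dots> < 0"
    unfolding neg_less_0_iff_less using c a assms(2,4) ne
    by (intro sum_pos divide_pos_pos mult_pos_pos) auto
  finally show "Im (cpoly B u / cpoly A u) * Im u < 0" .
qed

text \<open>
  The two equations for \<open>p(x)\<close> and \<open>p(-x)\<close> differ only in the sign of the odd part.
\<close>

lemma poly_reflected:
  assumes "poly p x = 0"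
  shows "poly p (- x) = 2 * poly (even_part p) (x\<^sup>2)"
  using assms poly_even_odd[of p x] poly_even_odd[of p "- x"] unfolding power2_minus by linarith

text \<open>
  A zero \<open>z\<close> with positive real part satisfies \<open>B(z\<^sup>2) / A(z\<^sup>2) = -1 / z\<close>. If \<open>z\<close> is not real, the
  imaginary part of the right side has the sign of \<open>Im z\<close>, that of the left side the opposite sign.
  On the imaginary axis \<open>A(z\<^sup>2)\<close> and \<open>z B(z\<^sup>2)\<close> are the real and the imaginary part of \<open>p(z)\<close>, and a
  nonreal zero would be a common zero of \<open>A\<close> and \<open>B\<close>. At a positive zero \<open>x\<close> the product
  \<open>A(x\<^sup>2) p'(x)\<close> is a positive multiple of the Wronskian minus a square.
\<close>

lemma interlaced_imp_right_zeros_alternating: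
  assumes "interlaced (even_part p) (odd_part p)" "degree (odd_part p) < degree (even_part p)"
    "lead_coeff (even_part p) > 0"
  shows "right_zeros_alternating p"
proof -
  define A where "A = even_part p"
  define B where "B = odd_part p"
  note AB = assms[folded A_def B_def]
  have coprime: "poly B x \<noteq> 0" if "poly A x = 0" for x
    using interlaced_Wronskian_neg[OF AB, of x] that by auto
  show ?thesis
    unfolding right_zeros_alternating_def
  proof (intro conjI ballI allI impI)
    fix z assume "z \<in> complex_zeros p" and Re: "Re z \<ge> 0"
    then have z0: "cpoly A (z\<^sup>2) + z * cpoly B (z\<^sup>2) = 0"
      using cpoly_even_odd[of p z] by (simp add: complex_zeros_def A_def B_def)
    show "z \<in> \<real>"
    proof (rule ccontr)
      assume "z \<notin> \<real>"
      then have Im: "Im z \<noteq> 0" by (simp add: complex_is_Real_iff)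
      then have zn: "z \<noteq> 0" by auto
      show False
      proof (cases "Re z = 0")
        case False
        have im2: "Im (z\<^sup>2) = 2 * Re z * Im z" by (simp add: power2_eq_square)
        then have im2': "Im (z\<^sup>2) \<noteq> 0" using False Im by simp
        have "z * cpoly B (z\<^sup>2) = - cpoly A (z\<^sup>2)"
          using z0 by (simp add: eq_neg_iff_add_eq_0 add.commute)
        then have "cpoly B (z\<^sup>2) = - cpoly A (z\<^sup>2) / z" using zn by (metis nonzero_mult_div_cancel_left)
        then have "cpoly B (z\<^sup>2) / cpoly A (z\<^sup>2) = - 1 / z"
          using interlaced_quotient_Im(1)[OF AB im2'] by simp
        then have less: "Im (- 1 / z) * Im (z\<^sup>2) < 0"
          using interlaced_quotient_Im(2)[OF AB im2'] by simp
        have "Im (- 1 / z) = Im z / (cmod z)\<^sup>2" by (simp add: Im_divide cmod_power2)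
        then have "Im (- 1 / z) * Im (z\<^sup>2) = 2 * Re z * (Im z)\<^sup>2 / (cmod z)\<^sup>2"
          unfolding im2 by (simp only:) (simp add: power2_eq_square)
        moreover have "2 * Re z * (Im z)\<^sup>2 / (cmod z)\<^sup>2 \<ge> 0" using Re by simp
        ultimately show False using less by linarith
      next
        case True
        then have "z = \<i> * complex_of_real (Im z)" by (simp add: complex_eq_iff)
        then have "cpoly p (\<i> * complex_of_real (Im z)) = 0"
          using z0 cpoly_even_odd[of p z] by (simp add: A_def B_def)
        then have "poly A (- ((Im z)\<^sup>2)) = 0" "poly B (- ((Im z)\<^sup>2)) = 0"
          using Im unfolding cpoly_imaginary by (auto simp: A_def B_def complex_eq_iff)
        then show False using coprime by blast
      qed
    qed
  next
    fix x :: real assume x: "x \<ge> 0" "poly p x = 0"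
    have p0: "poly A (x\<^sup>2) = - x * poly B (x\<^sup>2)"
      using x(2) poly_even_odd[of p x] unfolding A_def B_def by linarith
    have neg: "poly p (- x) * poly (pderiv p) x < 0" if "x > 0"
    proof -
      have B0: "poly B (x\<^sup>2) \<noteq> 0" using coprime[of "x\<^sup>2"] p0 by auto
      have pm: "poly p (- x) = 2 * poly A (x\<^sup>2)"
        using poly_reflected[OF x(2)] by (simp only: A_def)
      have pd: "poly (pderiv p) x = 2 * x * poly (pderiv A) (x\<^sup>2) + poly B (x\<^sup>2) +
          2 * x\<^sup>2 * poly (pderiv B) (x\<^sup>2)"
        unfolding A_def B_def by (rule poly_pderiv_even_odd)
      have "poly A (x\<^sup>2) * poly (pderiv p) x =
          2 * x\<^sup>2 * (poly (pderiv B) (x\<^sup>2) * poly A (x\<^sup>2) - poly B (x\<^sup>2) * poly (pderiv A) (x\<^sup>2))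
          - x * (poly B (x\<^sup>2))\<^sup>2"
        unfolding pd p0 by (simp only: algebra_simps power2_eq_square)
      moreover have "2 * x\<^sup>2 * (poly (pderiv B) (x\<^sup>2) * poly A (x\<^sup>2) - poly B (x\<^sup>2) * poly (pderiv A) (x\<^sup>2)) < 0"
        using interlaced_Wronskian_neg[OF AB, of "x\<^sup>2"] that by (simp add: mult_pos_neg)
      moreover have "x * (poly B (x\<^sup>2))\<^sup>2 > 0" using that B0 by simp
      ultimately have "poly A (x\<^sup>2) * poly (pderiv p) x < 0" by linarith
      then show ?thesis by (simp add: pm mult.commute)
    qed
    then show "poly (pderiv p) x \<noteq> 0"
    proof (cases "x > 0")
      case False
      then have "x = 0" using x by simp
      moreover have "poly B 0 \<noteq> 0" using coprime[of 0] p0 \<open>x = 0\<close> by simp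
      moreover have "poly (pderiv p) 0 = poly B 0"
        unfolding B_def by (subst poly_pderiv_even_odd) simp
      ultimately show ?thesis by simp
    qed (use neg in auto)
    show "poly p (- x) * poly (pderiv p) x < 0" if "x > 0" by (rule neg[OF that])
  qed
qed

section \<open>The argument along the imaginary axis\<close>

lemma pderiv_map_poly_of_real:
  "pderiv (map_poly complex_of_real p) = map_poly complex_of_real (pderiv p)"
  by (intro poly_eqI) (simp add: coeff_map_poly coeff_pderiv)

lemma degree_map_poly_of_real: "degree (map_poly complex_of_real p) = degree p"
  by (rule degree_map_poly) simp

lemma order_cpoly_simple_root:
  assumes "poly p x = 0" "poly (pderiv p) x \<noteq> 0"
  shows "Polynomial.order (complex_of_real x) (map_poly complex_of_real p) = 1"
proof -
  let ?q = "map_poly complex_of_real p"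
  have q': "poly (pderiv ?q) (complex_of_real x) \<noteq> 0"
    using assms(2) by (simp add: pderiv_map_poly_of_real complex_poly_of_real)
  then have "?q \<noteq> 0" by auto
  moreover have "poly ?q (complex_of_real x) = 0" using assms(1) by (simp add: complex_poly_of_real)
  ultimately have "Polynomial.order (complex_of_real x) ?q =
      Suc (Polynomial.order (complex_of_real x) (pderiv ?q))" by (rule order_pderiv)
  then show ?thesis using q' by (simp add: order_0I)
qed

lemma cpoly_cnj: "cpoly p (cnj z) = cnj (cpoly p z)"
  by (induction p) (simp_all add: map_poly_pCons)

text \<open>
  Conjugation carries a factorization of the polynomial at \<open>w\<close> to one at \<open>cnj w\<close>.
\<close>

lemma order_cpoly_cnj:
  assumes "p \<noteq> 0"
  shows "Polynomial.order (cnj z) (map_poly complex_of_real p) = Polynomial.order z (map_poly complex_of_real p)"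
proof -
  let ?q = "map_poly complex_of_real p"
  have q0: "?q \<noteq> 0" using assms by (simp add: map_poly_eq_0_iff)
  have le: "Polynomial.order w ?q \<le> Polynomial.order (cnj w) ?q" for w
  proof -
    obtain s where s: "?q = [:- w, 1:] ^ Polynomial.order w ?q * s"
      using order_1[of w ?q] by (elim dvdE)
    have "?q = [:- cnj w, 1:] ^ Polynomial.order w ?q * map_poly cnj s"
    proof (rule poly_ext)
      fix v
      have "poly ?q v = cnj (poly ?q (cnj v))" by (simp add: cpoly_cnj)
      also have "poly ?q (cnj v) = (cnj v - w) ^ Polynomial.order w ?q * poly s (cnj v)"
        by (subst s) simp
      finally show "poly ?q v = poly ([:- cnj w, 1:] ^ Polynomial.order w ?q * map_poly cnj s) v"
        by simp
    qed
    then have "[:- cnj w, 1:] ^ Polynomial.order w ?q dvd ?q" by (rule dvdI)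
    then show ?thesis using q0 by (simp add: order_divides)
  qed
  show ?thesis using le[of z] le[of "cnj z"] by simp
qed

lemma cos_sin_half_odd_pi:
  "cos ((real m + 1 / 2) * pi) = 0" "sin ((real m + 1 / 2) * pi) = (-1) ^ m"
proof -
  have "(real m + 1 / 2) * pi = pi / 2 + real m * pi" by (simp add: algebra_simps)
  then show "cos ((real m + 1 / 2) * pi) = 0" "sin ((real m + 1 / 2) * pi) = (-1) ^ m"
    by (simp_all add: cos_add sin_add cos_npi mult.commute[of "real m"])
qed

lemma increasing_crossings:
  fixes \<theta> :: "real \<Rightarrow> real" and c :: "nat \<Rightarrow> real"
  assumes "continuous_on {0<..} \<theta>" "(\<theta> \<longlongrightarrow> L) at_top" "y0 > 0"
    "\<And>i. i < m \<Longrightarrow> \<theta> y0 < c i" "\<And>i. i < m \<Longrightarrow> c i < L" "\<And>i j. i < j \<Longrightarrow> j < m \<Longrightarrow> c i < c j"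
  obtains Y where "\<And>i. i < m \<Longrightarrow> Y i > 0 \<and> \<theta> (Y i) = c i" "strict_mono_on {..<m} Y"
proof -
  have step: "\<exists>t > s. \<theta> t = v" if sv: "s > 0" "\<theta> s < v" "v < L" for s v
  proof -
    have "eventually (\<lambda>t. \<theta> t > v) at_top" using assms(2) sv(3) by (rule order_tendstoD(1))
    then have "eventually (\<lambda>t. \<theta> t > v \<and> t > s) at_top"
      using eventually_gt_at_top[of s] by (rule eventually_conj)
    then obtain T where T: "\<theta> T > v" "T > s" by (auto dest: eventually_happens)
    have "continuous_on {s..T} \<theta>"
      using assms(1) by (rule continuous_on_subset) (use sv in auto)
    then obtain t where "s \<le> t" "t \<le> T" "\<theta> t = v"
      using IVT'[of \<theta> s v T] T sv by auto
    moreover have "t \<noteq> s" using sv \<open>\<theta> t = v\<close> by auto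
    ultimately show ?thesis by (intro exI[of _ t]) auto
  qed
  have "\<exists>Y. (\<forall>i<k. Y i > 0 \<and> \<theta> (Y i) = c i) \<and> strict_mono_on {..<k} Y" if "k \<le> m" for k
    using that
  proof (induction k)
    case (Suc k)
    then obtain Y where Y: "\<And>i. i < k \<Longrightarrow> Y i > 0 \<and> \<theta> (Y i) = c i" "strict_mono_on {..<k} Y" by auto
    define s where "s = (if k = 0 then y0 else Y (k - 1))"
    have s: "s > 0" "\<theta> s < c k" using Y(1)[of "k - 1"] assms(3,4,6) Suc.prems by (auto simp: s_def)
    then obtain t where t: "t > s" "\<theta> t = c k" using step[of s "c k"] assms(5) Suc.prems by auto
    have "(Y(k := t)) i < (Y(k := t)) (Suc i)" if "Suc i < Suc k" for i
      using that t(1) Y(2) by (auto simp: s_def strict_mono_on_def)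
    then have "strict_mono_on {..<Suc k} (Y(k := t))" by (rule strict_mono_on_lessThan_SucI)
    moreover have "\<forall>i<Suc k. (Y(k := t)) i > 0 \<and> \<theta> ((Y(k := t)) i) = c i"
      using Y(1) t s by (auto simp: less_Suc_eq)
    ultimately show ?case by blast
  qed (auto intro!: exI[of _ "\<lambda>_. 0"] simp: strict_mono_on_def)
  then show ?thesis using that by blast
qed

lemma tendsto_Arg_imaginary_at_top:
  "((\<lambda>y. Arg (\<i> * complex_of_real y - w)) \<longlongrightarrow> pi / 2) at_top"
proof -
  have "((\<lambda>y. complex_of_real (inverse y)) \<longlongrightarrow> complex_of_real 0) at_top"
    by (intro tendsto_of_real tendsto_inverse_0_at_top filterlim_ident)
  then have "((\<lambda>y. \<i> - w * complex_of_real (inverse y)) \<longlongrightarrow> \<i> - w * complex_of_real 0) at_top"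
    by (intro tendsto_diff tendsto_mult tendsto_const)
  then have lim: "((\<lambda>y. Arg (\<i> - w * complex_of_real (inverse y))) \<longlongrightarrow> Arg \<i>) at_top"
    by (intro tendsto_Arg) (auto simp: complex_nonpos_Reals_iff)
  have "Arg \<i> = pi / 2" using Arg_cis[of "pi / 2"] by simp
  moreover have "eventually (\<lambda>y. Arg (\<i> - w * complex_of_real (inverse y)) =
      Arg (\<i> * complex_of_real y - w)) at_top"
    using eventually_gt_at_top[of 0]
  proof eventually_elim
    case (elim y)
    have "\<i> * complex_of_real y - w = complex_of_real y * (\<i> - w * complex_of_real (inverse y))"
      using elim by (simp add: field_simps)
    then show ?case using elim by simp
  qed
  ultimately show ?thesis using lim by (auto elim: Lim_transform_eventually)
qed

text \<open>
  For \<open>y > 0\<close> let \<open>\<theta> y\<close> be the sum of the arguments of \<open>i y - z\<close> over all zeros \<open>z\<close>, so that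
  \<open>p(iy)\<close> is a positive multiple of \<open>cis (\<theta> y)\<close>. No \<open>i y - z\<close> meets the branch cut, since \<open>z\<close> is real
  or lies in the left half-plane; hence \<open>\<theta>\<close> is continuous. It tends to \<open>degree p \<sqdot> \<pi> / 2 = l \<pi>\<close>
  at infinity. Near \<open>0\<close> it is at most about \<open>k \<pi>\<close>: the \<open>k\<close> nonnegative zeros contribute at most
  \<open>\<pi>\<close> each, the others cancel in conjugate pairs or contribute nothing. So \<open>\<theta>\<close> passes through
  \<open>(k + i + 1 / 2) \<pi>\<close> for all \<open>i < l - k\<close>; there \<open>p(iy)\<close> is imaginary with known sign.
\<close>

lemma imaginary_axis_crossings:
  assumes lc: "lead_coeff p > 0" and deg: "degree p = 2 * l" and ok: "right_zeros_alternating p"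
    and k: "k = card (right_zeros p)" "k \<le> l"
  obtains Y where "strict_mono_on {..<l - k} Y"
    "\<And>i. i < l - k \<Longrightarrow> Y i > 0 \<and> poly (even_part p) (- ((Y i)\<^sup>2)) = 0 \<and>
       (-1) ^ (k + i) * poly (odd_part p) (- ((Y i)\<^sup>2)) > 0"
proof -
  define q where "q = map_poly complex_of_real p"
  define Z where "Z = complex_zeros p"
  have p0: "p \<noteq> 0" using lc by auto
  have q0: "q \<noteq> 0" using p0 by (simp add: q_def map_poly_eq_0_iff)
  have Zq: "Z = {z. poly q z = 0}" by (simp add: Z_def complex_zeros_def q_def)
  have finZ: "finite Z" unfolding Zq by (rule poly_roots_finite[OF q0])
  have degq: "degree q = 2 * l" using deg by (simp add: q_def degree_map_poly_of_real)
  have lcq: "lead_coeff q = complex_of_real (lead_coeff p)"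
    using degq deg by (simp add: q_def coeff_map_poly)
  define m where "m z = Polynomial.order z q" for z
  have dec: "q = smult (lead_coeff q) (\<Prod>z\<in>Z. [:- z, 1:] ^ m z)"
    unfolding Zq m_def by (rule complex_poly_decompose[symmetric])
  have msum: "(\<Sum>z\<in>Z. m z) = 2 * l"
  proof -
    have "degree q = degree (\<Prod>z\<in>Z. [:- z, 1:] ^ m z)"
      by (subst dec) (use q0 in simp)
    also have "\<dots> = (\<Sum>z\<in>Z. m z)"
      by (subst degree_prod_eq_sum_degree) (auto simp: degree_power_eq)
    finally show ?thesis using degq by simp
  qed
  define R where "R = complex_of_real ` right_zeros p"
  have RZ: "R = {z \<in> Z. Re z \<ge> 0}"
  proof (intro equalityI subsetI)
    fix z assume "z \<in> R"
    then show "z \<in> {z \<in> Z. Re z \<ge> 0}"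
      by (auto simp: R_def right_zeros_def Z_def complex_zeros_def complex_poly_of_real)
  next
    fix z assume z: "z \<in> {z \<in> Z. Re z \<ge> 0}"
    then have "z \<in> \<real>" using ok by (auto simp: right_zeros_alternating_def Z_def)
    then obtain x where x: "z = complex_of_real x" by (auto elim: Reals_cases)
    then have "x \<in> right_zeros p"
      using z by (auto simp: right_zeros_def Z_def complex_zeros_def complex_poly_of_real)
    then show "z \<in> R" using x by (auto simp: R_def)
  qed
  have mR: "m z = 1" if "z \<in> R" for z
    using that ok order_cpoly_simple_root
    by (auto simp: R_def right_zeros_def right_zeros_alternating_def m_def q_def)
  have cardR: "card R = k" unfolding R_def k by (intro card_image inj_onI) simp
  define f where "f y z = Arg (\<i> * complex_of_real y - z)" for y z
  define \<theta> where "\<theta> y = (\<Sum>z\<in>Z. m z * f y z)" for y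
  have avoid: "\<i> * complex_of_real y - z \<notin> \<real>\<^sub>\<le>\<^sub>0" if "y > 0" "z \<in> Z" for y z
  proof (cases "Re z \<ge> 0")
    case True
    then have "z \<in> \<real>" using that ok by (auto simp: right_zeros_alternating_def Z_def)
    then show ?thesis using that by (auto simp: complex_nonpos_Reals_iff complex_is_Real_iff)
  qed (auto simp: complex_nonpos_Reals_iff)
  have cont: "continuous_on {0<..} \<theta>"
    unfolding \<theta>_def f_def by (intro continuous_intros) (use avoid in auto)
  have "(\<theta> \<longlongrightarrow> (\<Sum>z\<in>Z. m z * (pi / 2))) at_top"
    unfolding \<theta>_def f_def by (intro tendsto_intros tendsto_Arg_imaginary_at_top)
  also have "(\<Sum>z\<in>Z. m z * (pi / 2)) = real l * pi"
    by (simp only: sum_distrib_right[symmetric] of_nat_sum[symmetric] msum)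
  finally have lim: "(\<theta> \<longlongrightarrow> real l * pi) at_top" .
  have polar: "\<exists>M > 0. poly q (\<i> * complex_of_real y) = rcis M (\<theta> y)" if "y > 0" for y
  proof -
    have ne: "\<i> * complex_of_real y - z \<noteq> 0" if "z \<in> Z" for z
      using avoid[OF \<open>y > 0\<close> that] by auto
    have "poly q (\<i> * complex_of_real y) =
        complex_of_real (lead_coeff p) * (\<Prod>z\<in>Z. (\<i> * complex_of_real y - z) ^ m z)"
      by (subst dec, subst lcq) (simp add: poly_prod)
    also have "(\<Prod>z\<in>Z. (\<i> * complex_of_real y - z) ^ m z) =
        (\<Prod>z\<in>Z. complex_of_real (cmod (\<i> * complex_of_real y - z) ^ m z) * cis (m z * f y z))"
    proof (intro prod.cong refl)
      fix z assume "z \<in> Z"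
      have "\<i> * complex_of_real y - z = rcis (cmod (\<i> * complex_of_real y - z)) (f y z)"
        unfolding f_def by (rule rcis_cmod_Arg[symmetric])
      then have "(\<i> * complex_of_real y - z) ^ m z =
          rcis (cmod (\<i> * complex_of_real y - z)) (f y z) ^ m z" by simp
      then show "(\<i> * complex_of_real y - z) ^ m z =
          complex_of_real (cmod (\<i> * complex_of_real y - z) ^ m z) * cis (m z * f y z)"
        by (simp add: rcis_def power_mult_distrib Complex.DeMoivre)
    qed
    also have "\<dots> = complex_of_real (\<Prod>z\<in>Z. cmod (\<i> * complex_of_real y - z) ^ m z) * cis (\<theta> y)"
    proof -
      have "(\<Prod>z\<in>F. cis (h z)) = cis (\<Sum>z\<in>F. h z)" if "finite F" for F and h :: "complex \<Rightarrow> real"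
        using that by (induction F rule: finite_induct) (simp_all add: cis_mult)
      then show ?thesis unfolding \<theta>_def by (simp add: prod.distrib finZ)
    qed
    finally have "poly q (\<i> * complex_of_real y) =
        rcis (lead_coeff p * (\<Prod>z\<in>Z. cmod (\<i> * complex_of_real y - z) ^ m z)) (\<theta> y)"
      by (simp add: rcis_def)
    moreover have "lead_coeff p * (\<Prod>z\<in>Z. cmod (\<i> * complex_of_real y - z) ^ m z) > 0"
      using ne lc by (intro mult_pos_pos prod_pos) auto
    ultimately show ?thesis by blast
  qed
  obtain y0 where y0: "y0 > 0" "\<theta> y0 < (real k + 1 / 2) * pi"
  proof -
    \<comment> \<open>the zeros in the open left half-plane\<close>
    define N where "N = Z - R"
    have N: "Re z < 0" if "z \<in> N" for z using that by (auto simp: N_def RZ)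
    define g where "g y = (\<Sum>z\<in>N. m z * f y z)" for y
    have "((\<lambda>y. \<i> * complex_of_real y - z) \<longlongrightarrow> \<i> * complex_of_real 0 - z) (at_right 0)" for z
      by (intro tendsto_intros)
    then have "(g \<longlongrightarrow> (\<Sum>z\<in>N. m z * Arg (- z))) (at_right 0)"
      unfolding g_def f_def
      by (intro tendsto_sum tendsto_mult tendsto_const tendsto_Arg)
        (auto simp: complex_nonpos_Reals_iff dest: N)
    moreover have "(\<Sum>z\<in>N. m z * Arg (- z)) = 0"
    proof -
      have cN: "cnj z \<in> N" if "z \<in> N" for z
        using that N[OF that] by (auto simp: N_def RZ Z_def complex_zeros_def cpoly_cnj)
      have "bij_betw cnj N N"
        by (rule bij_betw_byWitness[where f' = cnj]) (use cN in auto)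
      then have "(\<Sum>z\<in>N. m z * Arg (- z)) = (\<Sum>z\<in>N. m (cnj z) * Arg (- cnj z))"
        by (rule sum.reindex_bij_betw[symmetric])
      also have "\<dots> = (\<Sum>z\<in>N. - (m z * Arg (- z)))"
      proof (intro sum.cong refl)
        fix z assume z: "z \<in> N"
        have "m (cnj z) = m z" unfolding m_def q_def by (rule order_cpoly_cnj[OF p0])
        moreover have "Arg (- cnj z) = - Arg (- z)"
        proof (cases "- z \<in> \<real>")
          case True
          then have "Arg (- z) = 0" using N[OF z] by (simp add: Arg_eq_0)
          moreover have "- cnj z = - z" using True by (simp add: complex_is_Real_iff complex_eq_iff)
          ultimately show ?thesis by simp
        next
          case False
          then show ?thesis using Arg_cnj[of "- z"] by simp
        qed
        ultimately show "m (cnj z) * Arg (- cnj z) = - (m z * Arg (- z))" by simp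
      qed
      finally show ?thesis by (simp add: sum_negf)
    qed
    ultimately have "eventually (\<lambda>y. g y < pi / 2) (at_right 0)"
      by (intro order_tendstoD(2)) auto
    moreover have "eventually (\<lambda>y. y > 0) (at_right (0::real))"
      by (rule eventually_at_right_less)
    ultimately have "eventually (\<lambda>y. g y < pi / 2 \<and> y > 0) (at_right 0)"
      by (rule eventually_conj)
    then obtain y where y: "g y < pi / 2" "y > 0"
      by (auto dest!: eventually_happens simp: trivial_limit_at_right_real)
    have "\<theta> y = (\<Sum>z\<in>R. m z * f y z) + g y"
    proof -
      have "R \<subseteq> Z" by (auto simp: RZ)
      then show ?thesis unfolding \<theta>_def g_def N_def using finZ by (subst sum.subset_diff[of R Z]) auto
    qed
    moreover have "(\<Sum>z\<in>R. m z * f y z) \<le> (\<Sum>z\<in>R. pi)"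
      by (intro sum_mono) (simp add: mR f_def Arg_le_pi)
    ultimately have "\<theta> y < (real k + 1 / 2) * pi" using y cardR by (simp add: algebra_simps)
    then show ?thesis using that y by blast
  qed
  define c where "c i = (real (k + i) + 1 / 2) * pi" for i :: nat
  have "\<theta> y0 < c i" if "i < l - k" for i
  proof -
    have "(real k + 1 / 2) * pi \<le> c i" unfolding c_def by (intro mult_right_mono) auto
    then show ?thesis using y0 by simp
  qed
  moreover have "c i < real l * pi" if "i < l - k" for i
  proof -
    have "real (k + i) + 1 \<le> real l" using that by linarith
    then show ?thesis unfolding c_def by (intro mult_strict_right_mono) auto
  qed
  moreover have "c i < c j" if "i < j" for i j
    unfolding c_def using that by (intro mult_strict_right_mono) auto
  ultimately obtain Y where Y: "\<And>i. i < l - k \<Longrightarrow> Y i > 0 \<and> \<theta> (Y i) = c i" "strict_mono_on {..<l - k} Y"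
    using increasing_crossings[OF cont lim y0(1), of "l - k" c] by blast
  have "Y i > 0 \<and> poly (even_part p) (- ((Y i)\<^sup>2)) = 0 \<and>
       (-1) ^ (k + i) * poly (odd_part p) (- ((Y i)\<^sup>2)) > 0" if i: "i < l - k" for i
  proof -
    have Yi: "Y i > 0" "\<theta> (Y i) = c i" using Y(1)[OF i] by auto
    obtain M where M: "M > 0" "poly q (\<i> * complex_of_real (Y i)) = rcis M (c i)"
      using polar[OF Yi(1)] Yi(2) by auto
    have eq: "Complex (poly (even_part p) (- ((Y i)\<^sup>2))) (Y i * poly (odd_part p) (- ((Y i)\<^sup>2))) = rcis M (c i)"
      using M(2) cpoly_imaginary[of p "Y i"] by (simp add: q_def)
    have "poly (even_part p) (- ((Y i)\<^sup>2)) = M * cos (c i)"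
      "Y i * poly (odd_part p) (- ((Y i)\<^sup>2)) = M * sin (c i)"
      using arg_cong[OF eq, of Re] arg_cong[OF eq, of Im] by auto
    then have "poly (even_part p) (- ((Y i)\<^sup>2)) = 0"
      and odd: "Y i * poly (odd_part p) (- ((Y i)\<^sup>2)) = M * (-1) ^ (k + i)"
      unfolding c_def cos_sin_half_odd_pi by auto
    moreover have "Y i * ((-1) ^ (k + i) * poly (odd_part p) (- ((Y i)\<^sup>2))) = M"
    proof -
      have "(-1) ^ (k + i) * (-1) ^ (k + i) = (1 :: real)" by (simp flip: power_mult_distrib)
      then have "M * (-1) ^ (k + i) * (-1) ^ (k + i) = M" by (simp only: mult.assoc mult_1_right)
      then show ?thesis unfolding odd[symmetric] by (simp only: mult_ac)
    qed
    ultimately show ?thesis using M(1) Yi(1) by (metis zero_less_mult_pos)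
  qed
  then show ?thesis using that Y(2) by blast
qed

section \<open>The zeros in the right half-plane determine the interlacing\<close>

lemma alternating_sign_step:
  fixes u v :: real
  assumes "(-1) ^ Suc m * v > 0" "u * v < 0"
  shows "(-1) ^ m * u > 0"
  using assms by (cases "even m") (auto simp: mult_less_0_iff)

text \<open>
  Let \<open>h 0 < \<dots> < h (k - 1)\<close> be the nonnegative zeros of \<open>p\<close>. As \<open>2 A((h j)\<^sup>2) = p(- h j)\<close> alternates
  in sign and is negative for the last one, \<open>A\<close> has a zero \<open>\<xi> j\<close> between \<open>(h j)\<^sup>2\<close> and the next
  square, and one beyond the last square. There \<open>p(\<surd>(\<xi> j)) = \<surd>(\<xi> j) B(\<xi> j)\<close>, so the sign of \<open>B\<close>
  is the sign of \<open>p\<close> between its zeros. If \<open>h 0 = 0\<close>, then \<open>\<xi> 0 = 0\<close>. The remaining \<open>l - k\<close> zeros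
  of \<open>A\<close> are negative and come from the imaginary axis.
\<close>

lemma right_zeros_alternating_imp_interlaced:
  assumes lc: "lead_coeff p > 0" and deg: "degree p = 2 * l" and ok: "right_zeros_alternating p"
  shows "interlaced (even_part p) (odd_part p)"
    and "card (right_zeros (even_part p)) = card (right_zeros p)"
proof -
  define A where "A = even_part p"
  define B where "B = odd_part p"
  have A: "degree A = l" "lead_coeff A > 0"
    using degree_even_part[OF deg lc] lc by (auto simp: A_def)
  have A0: "A \<noteq> 0" "p \<noteq> 0" using A lc by auto
  have finA: "finite {x. poly A x = 0}" by (rule poly_roots_finite[OF A0(1)])
  define k where "k = card (right_zeros p)"
  have fin: "finite (right_zeros p)"
    using poly_roots_finite[OF A0(2)] by (rule finite_subset[rotated]) (auto simp: right_zeros_def)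
  obtain h where h: "h ` {..<k} = right_zeros p" "strict_mono_on {..<k} h"
    using enumerate_finite_real_set[OF fin] unfolding k_def by blast
  have root: "poly p (h j) = 0" "h j \<ge> 0" if "j < k" for j
    using h(1) that by (auto simp: right_zeros_def)
  have der: "poly (pderiv p) (h j) \<noteq> 0" if "j < k" for j
    using ok root[OF that] by (auto simp: right_zeros_alternating_def)
  have neg: "poly p (- h j) * poly (pderiv p) (h j) < 0" if "j < k" "h j > 0" for j
    using ok root[OF that(1)] that by (auto simp: right_zeros_alternating_def)
  have onto: "\<exists>j<k. x = h j" if "poly p x = 0" "x \<ge> 0" for x
  proof -
    have "x \<in> h ` {..<k}" using that unfolding h(1) by (simp add: right_zeros_def)
    then show ?thesis by auto
  qed
  have hless: "h i < h j \<longleftrightarrow> i < j" if "i < k" "j < k" for i j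
    using h(2) that by (metis lessThan_iff strict_mono_on_less)
  have gap: "poly p x \<noteq> 0" if j: "j < k" and x: "h j < x" "Suc j < k \<Longrightarrow> x < h (Suc j)" for j x
  proof
    assume "poly p x = 0"
    then obtain i where i: "i < k" "x = h i" using onto[of x] root(2)[OF j] x(1) by auto
    then have "j < i" using hless[OF j i(1)] x(1) by simp
    then have "Suc j < k" "\<not> i < Suc j" using i(1) by auto
    then show False using x(2) hless[of i "Suc j"] i by auto
  qed
  \<comment> \<open>the signs of the derivative, from the largest zero downwards\<close>
  have S1: "(-1) ^ (k + Suc j) * poly (pderiv p) (h j) > 0" if "j < k" for j
  proof -
    have "j \<le> k - 1" using that by simp
    then show ?thesis
    proof (induction j rule: inc_induct)
      case base
      have "poly (pderiv p) (h (k - 1)) > 0"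
        using that root der lc gap[of "k - 1"] by (intro pderiv_pos_last_root) auto
      then show ?case using that by (simp flip: mult_2)
    next
      case (step n)
      have "poly (pderiv p) (h n) * poly (pderiv p) (h (Suc n)) < 0"
        using step(1,2) root der gap[of n] hless[of n "Suc n"]
        by (intro pderiv_sign_consecutive_roots) auto
      moreover have "(-1) ^ Suc (k + Suc n) * poly (pderiv p) (h (Suc n)) > 0"
        using step(3) by (simp only: add_Suc_right)
      ultimately show ?case by (rule_tac alternating_sign_step)
    qed
  qed
  have A_sq: "poly A ((h j)\<^sup>2) = poly p (- h j) / 2" if "j < k" for j
    using poly_reflected[OF root(1)[OF that]] by (simp add: A_def)
  have SA: "(-1) ^ (k + j) * poly A ((h j)\<^sup>2) > 0" if "j < k" "h j > 0" for j
  proof (rule alternating_sign_step)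
    show "(-1) ^ Suc (k + j) * poly (pderiv p) (h j) > 0"
      using S1[OF that(1)] by (simp only: add_Suc_right)
    show "poly A ((h j)\<^sup>2) * poly (pderiv p) (h j) < 0"
      using neg[OF that] by (simp add: A_sq[OF that(1)])
  qed
  have "\<exists>\<xi>. poly A \<xi> = 0 \<and> (h j)\<^sup>2 \<le> \<xi> \<and> (Suc j < k \<longrightarrow> \<xi> < (h (Suc j))\<^sup>2) \<and>
      (-1) ^ (k + Suc j) * poly B \<xi> > 0" if j: "j < k" for j
  proof (cases "h j > 0")
    case False
    then have z: "h j = 0" using root(2)[OF j] by simp
    have "poly A 0 = 0" using poly_even_odd[of p 0] root(1)[OF j] z by (simp add: A_def)
    moreover have "poly (pderiv p) 0 = poly B 0"
      unfolding B_def by (subst poly_pderiv_even_odd) simp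
    moreover have "Suc j < k \<longrightarrow> h j < h (Suc j)" using hless[of j "Suc j"] by auto
    ultimately show ?thesis using S1[OF j] z by (intro exI[of _ 0]) auto
  next
    case pos: True
    obtain t where t: "(h j)\<^sup>2 < t" "poly A ((h j)\<^sup>2) * poly A t < 0" "Suc j < k \<longrightarrow> t = (h (Suc j))\<^sup>2"
    proof (cases "Suc j < k")
      case True
      then have lt: "h j < h (Suc j)" using hless[of j "Suc j"] by auto
      have "poly A ((h j)\<^sup>2) * poly A ((h (Suc j))\<^sup>2) < 0"
        using SA[OF j pos] SA[OF True] lt pos by (intro neg_mult_of_alternating[of "k + j"]) auto
      moreover have "(h j)\<^sup>2 < (h (Suc j))\<^sup>2" using lt pos by (intro power_strict_mono) auto
      ultimately show ?thesis using that True by blast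
    next
      case False
      then have kj: "k = Suc j" using j by simp
      have "poly A ((h j)\<^sup>2) < 0" using SA[OF j pos] by (simp add: kj flip: mult_2)
      obtain N where N: "\<And>x. x \<ge> N \<Longrightarrow> poly A x \<ge> lead_coeff A"
        using poly_pinfty_gt_lc A(2) by blast
      define t where "t = max N ((h j)\<^sup>2 + 1)"
      have "poly A t > 0" using N[of t] A(2) by (simp add: t_def)
      moreover have "(h j)\<^sup>2 < t" by (simp add: t_def)
      ultimately show ?thesis using that \<open>poly A ((h j)\<^sup>2) < 0\<close> False by (simp add: mult_neg_pos)
    qed
    obtain \<xi> where \<xi>: "(h j)\<^sup>2 < \<xi>" "\<xi> < t" "poly A \<xi> = 0"
      using poly_IVT[OF t(1,2)] by blast
    define z where "z = sqrt \<xi>"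
    have \<xi>0: "\<xi> > 0" using \<xi>(1) zero_le_power2[of "h j"] by linarith
    then have z: "z\<^sup>2 = \<xi>" "z > 0" by (auto simp: z_def)
    have z1: "h j < z" unfolding z_def using \<xi>(1) by (intro real_less_rsqrt)
    have z2: "z < h (Suc j)" if "Suc j < k"
      unfolding z_def using \<xi> t(3) that root(2)[OF that] \<xi>0 by (intro real_less_lsqrt) auto
    have "poly (pderiv p) (h j) * poly p z > 0"
    proof (rule poly_sign_right_of_simple_root[OF root(1)[OF j] der[OF j] z1])
      fix x assume "h j < x" "x \<le> z"
      then show "poly p x \<noteq> 0" using gap[OF j, of x] z2 by force
    qed
    moreover have "poly p z = z * poly B \<xi>"
      using poly_even_odd[of p z] z \<xi>(3) by (simp add: A_def B_def)
    ultimately have "z * (poly (pderiv p) (h j) * poly B \<xi>) > 0" by (simp add: mult.left_commute)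
    then have "poly (pderiv p) (h j) * poly B \<xi> > 0" using z(2) by (rule zero_less_mult_pos)
    then have "(-1) ^ (k + Suc j) * poly B \<xi> > 0"
      using S1[OF j] by (cases "even (k + Suc j)") (auto simp: zero_less_mult_iff)
    then show ?thesis using \<xi> t(3) by (intro exI[of _ \<xi>]) auto
  qed
  then obtain \<xi> where \<xi>: "\<And>j. j < k \<Longrightarrow> poly A (\<xi> j) = 0 \<and> (h j)\<^sup>2 \<le> \<xi> j \<and>
      (Suc j < k \<longrightarrow> \<xi> j < (h (Suc j))\<^sup>2) \<and> (-1) ^ (k + Suc j) * poly B (\<xi> j) > 0"
    by metis
  have \<xi>mono: "strict_mono_on {..<k} \<xi>"
  proof (rule strict_mono_on_lessThan_SucI)
    fix j assume "Suc j < k"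
    then show "\<xi> j < \<xi> (Suc j)" using \<xi>[of j] \<xi>[of "Suc j"] by auto
  qed
  have \<xi>0: "\<xi> j \<ge> 0" if "j < k" for j using \<xi>[OF that] zero_le_power2[of "h j"] by linarith
  have "card (\<xi> ` {..<k}) \<le> card {x. poly A x = 0}"
    using \<xi> finA by (intro card_mono) auto
  moreover have card\<xi>: "card (\<xi> ` {..<k}) = k"
    using \<xi>mono by (simp add: card_image strict_mono_on_imp_inj_on)
  ultimately have kl: "k \<le> l" using card_poly_roots_bound[OF A0(1)] A(1) by simp
  obtain Y where Y: "strict_mono_on {..<l - k} Y"
    "\<And>i. i < l - k \<Longrightarrow> Y i > 0 \<and> poly A (- ((Y i)\<^sup>2)) = 0 \<and> (-1) ^ (k + i) * poly B (- ((Y i)\<^sup>2)) > 0"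
    using imaginary_axis_crossings[OF lc deg ok k_def kl] unfolding A_def B_def by blast
  \<comment> \<open>the points on the imaginary axis in reverse order, then the \<open>\<xi> j\<close>\<close>
  define x where "x m = (if m < l - k then - ((Y (l - k - 1 - m))\<^sup>2) else \<xi> (m - (l - k)))" for m
  have xneg: "x m < 0" if "m < l - k" for m
  proof -
    have "l - k - 1 - m < l - k" using that by simp
    then have "Y (l - k - 1 - m) > 0" using Y(2) by blast
    then show ?thesis using that by (simp add: x_def)
  qed
  have xpos: "x m \<ge> 0" if "l - k \<le> m" "m < l" for m
    using \<xi>0[of "m - (l - k)"] that kl by (simp add: x_def)
  have mono: "strict_mono_on {..<l} x"
  proof (rule strict_mono_on_lessThan_SucI)
    fix m assume m: "Suc m < l"
    consider "Suc m < l - k" | "Suc m = l - k" | "l - k \<le> m" by linarith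
    then show "x m < x (Suc m)"
    proof cases
      case 1
      then have "Y (l - k - 1 - Suc m) < Y (l - k - 1 - m)" "Y (l - k - 1 - Suc m) > 0"
        using Y(2)[of "l - k - 1 - Suc m"] by (auto intro!: strict_mono_onD[OF Y(1)])
      then have "(Y (l - k - 1 - Suc m))\<^sup>2 < (Y (l - k - 1 - m))\<^sup>2" by (intro power_strict_mono) auto
      then show ?thesis using 1 by (simp add: x_def)
    next
      case 2
      then show ?thesis using xneg[of m] xpos[of "Suc m"] m by simp
    next
      case 3
      then have "\<xi> (m - (l - k)) < \<xi> (Suc m - (l - k))"
        using m kl by (intro strict_mono_onD[OF \<xi>mono]) auto
      then show ?thesis using 3 by (simp add: x_def)
    qed
  qed
  have xroot: "poly A (x m) = 0" if "m < l" for m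
    using that kl Y(2)[of "l - k - 1 - m"] \<xi>[of "m - (l - k)"] by (auto simp: x_def)
  have sign: "(-1) ^ (l + Suc m) * poly B (x m) > 0" if m: "m < l" for m
  proof (cases "m < l - k")
    case True
    define i where "i = l - k - 1 - m"
    have "l + Suc m = k + i + 2 * Suc m" using True by (simp add: i_def)
    then have "(-1 :: real) ^ (l + Suc m) = (-1) ^ (k + i)" by (simp add: power_add power_mult)
    moreover have "i < l - k" using True by (simp add: i_def)
    moreover have "x m = - ((Y i)\<^sup>2)" using True by (simp add: x_def i_def)
    ultimately show ?thesis using Y(2)[of i] by (simp only:)
  next
    case False
    define j where "j = m - (l - k)"
    have "l + Suc m = k + Suc j + 2 * (l - k)" using False kl by (simp add: j_def)
    then have "(-1 :: real) ^ (l + Suc m) = (-1) ^ (k + Suc j)" by (simp add: power_add power_mult)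
    moreover have "j < k" using False kl m by (simp add: j_def)
    moreover have "x m = \<xi> j" using False by (simp add: x_def j_def)
    ultimately show ?thesis using \<xi>[of j] by (simp only:)
  qed
  show "interlaced A B" unfolding interlaced_def A(1) using mono xroot sign by blast
  have "x ` {..<l} = {u. poly A u = 0}"
  proof (rule card_subset_eq[OF finA])
    show "x ` {..<l} \<subseteq> {u. poly A u = 0}" using xroot by auto
    then have "card (x ` {..<l}) \<le> card {u. poly A u = 0}" using finA by (rule card_mono[rotated])
    moreover have "card (x ` {..<l}) = l" using mono by (simp add: card_image strict_mono_on_imp_inj_on)
    ultimately show "card (x ` {..<l}) = card {u. poly A u = 0}"
      using card_poly_roots_bound[OF A0(1)] A(1) by simp
  qed
  have "right_zeros A \<subseteq> \<xi> ` {..<k}"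
  proof
    fix u assume "u \<in> right_zeros A"
    then have "u \<ge> 0" "u \<in> x ` {..<l}" using \<open>x ` {..<l} = _\<close> by (auto simp: right_zeros_def)
    then obtain m where m: "m < l" "u = x m" by auto
    then have "\<not> m < l - k" using xneg[of m] \<open>u \<ge> 0\<close> by force
    then show "u \<in> \<xi> ` {..<k}" using m kl by (auto simp: x_def)
  qed
  moreover have "\<xi> ` {..<k} \<subseteq> right_zeros A" using \<xi> \<xi>0 by (auto simp: right_zeros_def)
  ultimately have "right_zeros A = \<xi> ` {..<k}" by (rule equalityI)
  then show "card (right_zeros A) = card (right_zeros p)" using card\<xi> k_def by metis
qed

lemma right_zeros_alternating_iff_interlaced:
  assumes lc: "lead_coeff p > 0" and deg: "degree p = 2 * l" and l: "l > 0"
  shows "right_zeros_alternating p \<longleftrightarrow> interlaced (even_part p) (odd_part p)"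
proof
  assume "interlaced (even_part p) (odd_part p)"
  moreover have "degree (odd_part p) < l"
    using deg l by (intro degree_lessI) (auto simp: coeff_eq_0)
  ultimately show "right_zeros_alternating p"
    using degree_even_part[OF deg lc] lc by (intro interlaced_imp_right_zeros_alternating) auto
qed (rule right_zeros_alternating_imp_interlaced(1)[OF lc deg])

section \<open>From odd to even degree\<close>

lemma real_zeros_bounded:
  fixes p :: "real poly"
  assumes "p \<noteq> 0"
  obtains M where "M > 0" "\<And>x. poly p x = 0 \<Longrightarrow> \<bar>x\<bar> < M"
proof -
  have fin: "finite (insert 0 (abs ` {x. poly p x = 0}))" using poly_roots_finite[OF assms] by simp
  define M where "M = Max (insert 0 (abs ` {x. poly p x = 0})) + 1"
  have "\<bar>x\<bar> < M" if "poly p x = 0" for x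
    using Max_ge[OF fin, of "\<bar>x\<bar>"] that by (force simp: M_def)
  moreover have "M > 0" using Max_ge[OF fin, of 0] by (simp add: M_def)
  ultimately show ?thesis using that by blast
qed

text \<open>
  At a zero \<open>x\<close> of \<open>p\<close> the product \<open>p(-x) p'(x)\<close> is multiplied by \<open>1 - (x / M)\<^sup>2\<close>, which is positive
  because \<open>M\<close> exceeds the modulus of every real zero.
\<close>

lemma right_zeros_alternating_mult_left_root:
  assumes M: "M > 0" "\<And>x. poly p x = 0 \<Longrightarrow> \<bar>x\<bar> < M"
  shows "right_zeros_alternating ([:1, 1 / M:] * p) \<longleftrightarrow> right_zeros_alternating p"
    and "right_zeros ([:1, 1 / M:] * p) = right_zeros p"
proof -
  let ?q = "[:1, 1 / M:] * p"
  have lin: "1 + x / M > 0" if "x \<ge> 0" for x using M(1) that by (simp add: add_pos_nonneg)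
  have pq: "poly ?q x = (1 + x / M) * poly p x" for x by (simp add: distrib_right)
  have root: "poly ?q x = 0 \<longleftrightarrow> poly p x = 0" if "x \<ge> 0" for x
    using lin[OF that] unfolding pq by simp
  then show "right_zeros ?q = right_zeros p" by (auto simp: right_zeros_def)
  have cq: "cpoly ?q z = (1 + z / complex_of_real M) * cpoly p z" for z
    by (simp add: cpoly_mult map_poly_pCons del: mult_pCons_left)
  have cz: "z \<in> complex_zeros ?q \<longleftrightarrow> z \<in> complex_zeros p" if "Re z \<ge> 0" for z
  proof -
    have "Re (1 + z / complex_of_real M) > 0" using lin[OF that] by simp
    then have "1 + z / complex_of_real M \<noteq> 0" by (metis less_irrefl zero_complex.sel(1))
    then show ?thesis unfolding complex_zeros_def mem_Collect_eq cq by simp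
  qed
  have der: "poly (pderiv ?q) x = (1 + x / M) * poly (pderiv p) x" if "poly p x = 0" for x
    using that by (simp add: pderiv_mult pderiv_pCons del: mult_pCons_left)
  have prod: "poly ?q (- x) * poly (pderiv ?q) x < 0 \<longleftrightarrow> poly p (- x) * poly (pderiv p) x < 0"
    if "x > 0" "poly p x = 0" for x
  proof -
    have "poly ?q (- x) * poly (pderiv ?q) x =
        ((1 - x / M) * (1 + x / M)) * (poly p (- x) * poly (pderiv p) x)"
      unfolding der[OF that(2)] pq by (simp add: mult_ac)
    moreover have "(1 - x / M) * (1 + x / M) > 0"
      using M(1) M(2)[OF that(2)] that(1) by (intro mult_pos_pos) (auto simp: field_simps add_pos_pos)
    ultimately show ?thesis by (metis mult_less_cancel_left_pos mult_zero_right)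
  qed
  have "(poly ?q x = 0 \<longrightarrow> poly (pderiv ?q) x \<noteq> 0 \<and> (x > 0 \<longrightarrow> poly ?q (- x) * poly (pderiv ?q) x < 0)) \<longleftrightarrow>
      (poly p x = 0 \<longrightarrow> poly (pderiv p) x \<noteq> 0 \<and> (x > 0 \<longrightarrow> poly p (- x) * poly (pderiv p) x < 0))"
    if "x \<ge> 0" for x
  proof (cases "poly p x = 0")
    case True
    have "poly (pderiv ?q) x \<noteq> 0 \<longleftrightarrow> poly (pderiv p) x \<noteq> 0"
      unfolding der[OF True] using lin[OF that] by simp
    then show ?thesis using root[OF that] prod[OF _ True] True by blast
  next
    case False
    then show ?thesis using root[OF that] by blast
  qed
  moreover have "(\<forall>z\<in>complex_zeros ?q. Re z \<ge> 0 \<longrightarrow> z \<in> \<real>) \<longleftrightarrow>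
      (\<forall>z\<in>complex_zeros p. Re z \<ge> 0 \<longrightarrow> z \<in> \<real>)" using cz by blast
  ultimately show "right_zeros_alternating ?q \<longleftrightarrow> right_zeros_alternating p"
    unfolding right_zeros_alternating_def by (simp only: cong: imp_cong)
qed

text \<open>
  Let \<open>q = (1 + z / M) p\<close>, with even part \<open>A\<close>. At a zero \<open>u\<close> of \<open>A\<close> the odd part of \<open>q\<close> equals
  \<open>(1 - u / M\<^sup>2) B\<close>, with \<open>B\<close> the odd part of \<open>p\<close>, and this factor is positive: for \<open>z \<ge> M\<close> the
  number \<open>p(z)\<close> is positive and \<open>p(-z)\<close> is negative, which makes \<open>2 A(z\<^sup>2) = q(z) + q(-z)\<close> positive.
  So the odd part of \<open>q\<close> can be replaced by \<open>B\<close>, and one division step leads to \<open>B\<close> and the even part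
  of \<open>p\<close>. The polynomial \<open>A\<close> is kept in the second claim because its nonnegative zeros give the
  order of \<open>p\<close>.
\<close>

lemma odd_degree_characterization:
  assumes lc: "lead_coeff p > 0" and deg: "degree p = 2 * l + 1"
  shows "right_zeros_alternating p \<longleftrightarrow> interlaced (odd_part p) (- even_part p)"
    and "right_zeros_alternating p \<Longrightarrow> \<exists>A. degree A = Suc l \<and> lead_coeff A > 0 \<and>
      (\<exists>\<epsilon>>0. A = even_part p + smult \<epsilon> (pCons 0 (odd_part p))) \<and>
      card (right_zeros A) = card (right_zeros p)"
proof -
  have p0: "p \<noteq> 0" using lc by auto
  obtain M where M: "M > 0" "\<And>x. poly p x = 0 \<Longrightarrow> \<bar>x\<bar> < M" using real_zeros_bounded[OF p0] by blast
  define q where "q = [:1, 1 / M:] * p"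
  define A where "A = even_part p + smult (1 / M) (pCons 0 (odd_part p))"
  define B where "B = odd_part p"
  have degB: "degree B = l" "lead_coeff B = lead_coeff p" using degree_odd_part[OF deg lc] by (auto simp: B_def)
  have degq: "degree q = 2 * Suc l" unfolding q_def using M(1) p0 deg by (subst degree_mult_eq) auto
  have lcq: "lead_coeff q > 0" unfolding q_def lead_coeff_mult using M(1) lc by simp
  have eq: "even_part q = A"
    by (rule poly_eqI) (auto simp: q_def A_def coeff_pCons split: nat.splits)
  have oq: "odd_part q = B + smult (1 / M) (even_part p)"
    by (rule poly_eqI) (auto simp: q_def B_def)
  have A: "degree A = Suc l" "lead_coeff A > 0"
    using degree_even_part[OF degq lcq] lcq by (auto simp: eq)
  have Apos: "poly A u > 0" if "u \<ge> M\<^sup>2" for u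
  proof -
    define z where "z = sqrt u"
    have z: "z \<ge> M" "z\<^sup>2 = u"
      using that M(1) by (auto simp: z_def real_le_rsqrt order_trans[OF zero_le_power2[of M]])
    have pz: "poly p z > 0" using M z by (intro poly_pos_above_roots lc) force
    have "(-1) ^ degree p * poly p (- z) > 0"
      using M z by (intro poly_sign_below_roots lc) force
    then have pmz: "poly p (- z) < 0" using deg by simp
    have "2 * poly A u = poly q z + poly q (- z)"
      unfolding poly_even_odd[of q z] poly_even_odd[of q "- z"] eq using z(2) by simp
    also have "\<dots> = (1 + z / M) * poly p z + (z / M - 1) * (- poly p (- z))"
      by (simp add: q_def algebra_simps)
    also have "\<dots> > 0" using z M pz pmz
      by (intro add_pos_nonneg mult_pos_pos mult_nonneg_nonneg) (auto simp: add_pos_nonneg)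
    finally show ?thesis by simp
  qed
  have on_roots: "0 < c * poly (odd_part q) u \<longleftrightarrow> 0 < c * poly B u" if "poly A u = 0" for u c
  proof -
    have "u < M\<^sup>2" using Apos[of u] that by force
    then have "1 - u / M\<^sup>2 > 0" using M(1) by simp
    moreover have "poly (even_part p) u = - (u / M * poly B u)"
      using that by (simp add: A_def B_def eq_neg_iff_add_eq_0)
    then have "c * poly (odd_part q) u = (1 - u / M\<^sup>2) * (c * poly B u)"
      by (simp add: oq algebra_simps power2_eq_square)
    ultimately show ?thesis by (metis mult_pos_pos zero_less_mult_pos)
  qed
  have "right_zeros_alternating p \<longleftrightarrow> right_zeros_alternating q"
    using right_zeros_alternating_mult_left_root(1)[OF M] by (simp add: q_def)
  also have "\<dots> \<longleftrightarrow> interlaced A (odd_part q)"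
    using right_zeros_alternating_iff_interlaced[OF lcq degq] by (simp add: eq)
  also have "\<dots> \<longleftrightarrow> interlaced A B"
    unfolding interlaced_def using on_roots by (metis (no_types, lifting))
  also have "\<dots> \<longleftrightarrow> interlaced B (- A)"
    using interlaced_step[of B A] A degB lc by auto
  also have "\<dots> \<longleftrightarrow> interlaced B (- even_part p)"
    by (rule interlaced_cong) (simp add: A_def B_def)
  finally show "right_zeros_alternating p \<longleftrightarrow> interlaced (odd_part p) (- even_part p)" by (simp add: B_def)
  assume "right_zeros_alternating p"
  then have "right_zeros_alternating q" using right_zeros_alternating_mult_left_root(1)[OF M] by (simp add: q_def)
  then have "card (right_zeros A) = card (right_zeros q)"
    using right_zeros_alternating_imp_interlaced(2)[OF lcq degq] by (simp add: eq)
  also have "\<dots> = card (right_zeros p)"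
    using right_zeros_alternating_mult_left_root(2)[OF M] by (simp add: q_def)
  finally show "\<exists>A. degree A = Suc l \<and> lead_coeff A > 0 \<and>
      (\<exists>\<epsilon>>0. A = even_part p + smult \<epsilon> (pCons 0 (odd_part p))) \<and>
      card (right_zeros A) = card (right_zeros p)"
    using A M(1) by (intro exI[of _ A] conjI exI[of _ "1 / M"]) (auto simp: A_def)
qed

section \<open>Sign changes and zeros\<close>

lemma coeffs_pCons_nonzero: "p \<noteq> 0 \<Longrightarrow> coeffs (pCons a p) = a # coeffs p"
  by (simp add: cCons_def)

text \<open>
  For the list of coefficients this is the sign of the polynomial just to the right of \<open>0\<close>. The default
  value \<open>0\<close> lets the recursion for sign changes hold without exceptions.
\<close>

definition first_nonzero :: "real list \<Rightarrow> real" where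
  "first_nonzero xs = (case filter (\<lambda>x. x \<noteq> 0) xs of [] \<Rightarrow> 0 | y # ys \<Rightarrow> y)"

lemma first_nonzero_Nil [simp]: "first_nonzero [] = 0"
  and first_nonzero_Cons [simp]: "first_nonzero (c # xs) = (if c = 0 then first_nonzero xs else c)"
  by (auto simp: first_nonzero_def)

lemma strong_sign_changes_Nil [simp]: "strong_sign_changes [] = 0"
  by (simp add: strong_sign_changes_def)

lemma strong_sign_changes_Cons [simp]:
  "strong_sign_changes (c # xs) =
     (if c * first_nonzero xs < 0 then 1 else 0) + strong_sign_changes xs"
proof (cases "c = 0")
  case True
  then show ?thesis by (simp add: strong_sign_changes_def)
next
  case False
  show ?thesis
  proof (cases "filter (\<lambda>x. x \<noteq> 0) xs")
    case Nil
    then show ?thesis using False by (simp add: strong_sign_changes_def first_nonzero_def)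
  next
    case (Cons y ys)
    let ?I = "\<lambda>zs. {i. Suc i < length zs \<and> zs ! i * zs ! Suc i < (0 :: real)}"
    have "?I (c # y # ys) = (if c * y < 0 then {0} else {}) \<union> Suc ` ?I (y # ys)"
    proof (intro equalityI subsetI)
      fix i assume "i \<in> ?I (c # y # ys)"
      then show "i \<in> (if c * y < 0 then {0} else {}) \<union> Suc ` ?I (y # ys)" by (cases i) auto
    qed (auto split: if_splits)
    moreover have "card ((if c * y < 0 then {0} else {}) \<union> Suc ` ?I (y # ys)) =
        card (if c * y < 0 then {0 :: nat} else {}) + card (Suc ` ?I (y # ys))"
      by (intro card_Un_disjoint) auto
    ultimately show ?thesis
      using False Cons by (simp add: strong_sign_changes_def first_nonzero_def card_image)
  qed
qed

lemma mult_neg_cong_sgn: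
  fixes a b c d :: real
  assumes "sgn a = sgn b" "sgn c = sgn d"
  shows "a * c < 0 \<longleftrightarrow> b * d < 0"
  using assms by (metis sgn_1_neg sgn_mult)

lemma sign_changes_cong:
  assumes "list_all2 (\<lambda>x y. sgn x = sgn y) xs ys"
  shows "strong_sign_changes xs = strong_sign_changes ys \<and> sgn (first_nonzero xs) = sgn (first_nonzero ys)"
  using assms
proof (induction rule: list_all2_induct)
  case (Cons x xs y ys)
  then have "x * first_nonzero xs < 0 \<longleftrightarrow> y * first_nonzero ys < 0"
    by (intro mult_neg_cong_sgn) auto
  moreover have "x = 0 \<longleftrightarrow> y = 0" using Cons by (metis sgn_0_0)
  ultimately show ?case using Cons by simp
qed simp

lemma sign_changes_append_pos:
  assumes "xs \<noteq> []" "last xs > 0" "c > 0"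
  shows "strong_sign_changes (xs @ [c]) = strong_sign_changes xs \<and> first_nonzero (xs @ [c]) = first_nonzero xs"
  using assms
proof (induction xs)
  case (Cons x xs)
  then show ?case by (cases "xs = []") (auto simp: mult_less_0_iff)
qed simp

lemma eventually_sgn_poly_at_right_0:
  fixes p :: "real poly"
  assumes "p \<noteq> 0"
  shows "eventually (\<lambda>t. poly p t * first_nonzero (coeffs p) > 0) (at_right 0)"
  using assms
proof (induction p)
  case (pCons a p)
  show ?case
  proof (cases "a = 0")
    case True
    then have p: "p \<noteq> 0" using pCons by auto
    have "eventually (\<lambda>t::real. t > 0) (at_right 0)" by (rule eventually_at_right_less)
    with pCons.IH[OF p] show ?thesis
      by eventually_elim (use True p in \<open>simp add: coeffs_pCons_nonzero mult.assoc\<close>)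
  next
    case False
    have "((\<lambda>t. poly (pCons a p) t * a) \<longlongrightarrow> poly (pCons a p) 0 * a) (at_right 0)"
      by (intro tendsto_intros)
    moreover have "a * a > 0" using False by (cases "a > 0") (auto intro: mult_neg_neg)
    then have "poly (pCons a p) 0 * a > 0" by simp
    ultimately have "eventually (\<lambda>t. poly (pCons a p) t * a > 0) (at_right 0)"
      by (rule order_tendstoD(1))
    moreover have "first_nonzero (coeffs (pCons a p)) = a" using False by (simp add: cCons_def)
    ultimately show ?thesis by simp
  qed
qed simp

definition pos_zeros :: "real poly \<Rightarrow> real set" where
  "pos_zeros p = {x. x > 0 \<and> poly p x = 0}"

text \<open>
  The index \<open>m\<close> separates the positive zeros from the others. The sign condition is the sign of \<open>A\<close>
  at a small positive point.
\<close>

lemma pos_zeros_threshold: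
  fixes A :: "real poly"
  assumes x: "strict_mono_on {..<degree A} x" "\<And>i. i < degree A \<Longrightarrow> poly A (x i) = 0"
    and lc: "lead_coeff A > 0"
  obtains m where "m \<le> degree A" "\<And>i. i < m \<Longrightarrow> x i \<le> 0" "\<And>i. m \<le> i \<Longrightarrow> i < degree A \<Longrightarrow> x i > 0"
    "card (pos_zeros A) = degree A - m"
    "(-1) ^ (degree A + m) * first_nonzero (coeffs A) > 0"
proof -
  let ?d = "degree A"
  have A0: "A \<noteq> 0" using lc by auto
  define m where "m = (LEAST m. m = ?d \<or> x m > 0)"
  have mP: "m = ?d \<or> x m > 0" unfolding m_def by (rule LeastI[of _ ?d]) simp
  have mle: "m \<le> ?d" unfolding m_def by (rule Least_le) simp
  have below: "x i \<le> 0" if "i < m" for i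
    using not_less_Least[of i "\<lambda>m. m = ?d \<or> x m > 0"] that by (auto simp: m_def)
  have above: "x i > 0" if "m \<le> i" "i < ?d" for i
  proof -
    have "x m \<le> x i" using x(1) that
      by (cases "m = i") (auto simp: strict_mono_on_def intro!: less_imp_le)
    then show ?thesis using mP that by auto
  qed
  have "pos_zeros A = x ` {m..<?d}"
  proof (intro equalityI subsetI)
    fix u assume u: "u \<in> pos_zeros A"
    then have "poly A u = 0" by (simp add: pos_zeros_def)
    then have "(\<Prod>i<?d. u - x i) = 0"
      using lc by (subst (asm) poly_eq_prod_roots[OF x]) (auto simp: poly_prod)
    then obtain i where i: "i < ?d" "u = x i" by auto
    then have "m \<le> i" using below[of i] u by (force simp: pos_zeros_def)
    then show "u \<in> x ` {m..<?d}" using i by auto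
  qed (use above x(2) in \<open>auto simp: pos_zeros_def\<close>)
  moreover have "inj_on x {m..<?d}"
    using strict_mono_on_imp_inj_on[OF x(1)] by (rule inj_on_subset) auto
  ultimately have card: "card (pos_zeros A) = ?d - m" by (simp add: card_image)
  have "eventually (\<lambda>t. \<forall>i\<in>{m..<?d}. t < x i) (at_right 0)"
    using above by (intro eventually_ball_finite) (auto intro!: order_tendstoD(2)[OF tendsto_ident_at])
  moreover have "eventually (\<lambda>t::real. t > 0) (at_right 0)" by (rule eventually_at_right_less)
  ultimately have "eventually (\<lambda>t. (\<forall>i\<in>{m..<?d}. t < x i) \<and> t > 0 \<and>
      poly A t * first_nonzero (coeffs A) > 0) (at_right 0)"
    using eventually_sgn_poly_at_right_0[OF A0] by eventually_elim auto
  then obtain t where t: "\<forall>i\<in>{m..<?d}. t < x i" "t > 0" "poly A t * first_nonzero (coeffs A) > 0"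
    by (auto dest!: eventually_happens simp: trivial_limit_at_right_real)
  have "(-1) ^ (?d + m) * poly A t > 0"
    using t below by (intro sign_poly_between_roots[OF x lc mle]) (auto dest: le_less_trans)
  then have "(-1) ^ (?d + m) * first_nonzero (coeffs A) > 0"
    using t(3) by (cases "even (?d + m)") (auto simp: zero_less_mult_iff)
  then show ?thesis using that[of m] mle below above card by blast
qed

text \<open>
  By interlacing the two numbers of positive zeros are equal or differ by one. Their parities are
  visible in the signs just to the right of \<open>0\<close>, and this decides between the two cases.
\<close>

lemma card_pos_zeros_interlaced:
  assumes "interlaced A B" "degree B < degree A" "lead_coeff A > 0"
  shows "card (pos_zeros A) = card (pos_zeros B) +
    (if first_nonzero (coeffs A) * first_nonzero (coeffs B) < 0 then 1 else 0)"
proof -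
  obtain x y where deg: "degree A = Suc (degree B)" and lcB: "lead_coeff B > 0"
    and x: "strict_mono_on {..<degree A} x" "\<And>i. i < degree A \<Longrightarrow> poly A (x i) = 0"
    and y: "strict_mono_on {..<degree B} y" "\<And>i. i < degree B \<Longrightarrow> poly B (y i) = 0"
    and xy: "\<And>i. i < degree B \<Longrightarrow> x i < y i \<and> y i < x (Suc i)"
    by (rule interlaced_step_imp[OF assms]) (rule that; assumption)
  let ?e = "degree B"
  obtain a where a: "a \<le> degree A" "\<And>i. i < a \<Longrightarrow> x i \<le> 0" "\<And>i. a \<le> i \<Longrightarrow> i < degree A \<Longrightarrow> x i > 0"
    "card (pos_zeros A) = degree A - a" "(-1) ^ (degree A + a) * first_nonzero (coeffs A) > 0"
    by (rule pos_zeros_threshold[OF x assms(3)], assumption) (rule that; assumption)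
  obtain b where b: "b \<le> ?e" "\<And>i. i < b \<Longrightarrow> y i \<le> 0" "\<And>i. b \<le> i \<Longrightarrow> i < ?e \<Longrightarrow> y i > 0"
    "card (pos_zeros B) = ?e - b" "(-1) ^ (?e + b) * first_nonzero (coeffs B) > 0"
    by (rule pos_zeros_threshold[OF y lcB], assumption) (rule that; assumption)
  have "b \<le> a"
  proof (rule ccontr)
    assume "\<not> b \<le> a"
    then have "a < b" "a < ?e" using b(1) by auto
    then show False using b(2)[of a] a(3)[of a] xy[of a] deg by auto
  qed
  moreover have "a \<le> Suc b"
  proof (rule ccontr)
    assume "\<not> a \<le> Suc b"
    then have "Suc b < a" "b < ?e" using a(1) deg by auto
    then show False using a(2)[of "Suc b"] b(3)[of b] xy[of b] by auto
  qed
  ultimately consider "a = b" | "a = Suc b" by linarith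
  then show ?thesis
  proof cases
    case 1
    have "first_nonzero (coeffs B) * first_nonzero (coeffs A) < 0"
      using b(5) a(5) by (intro neg_mult_of_alternating[of "?e + b"]) (simp_all only: deg 1 add_Suc)
    then show ?thesis using a b 1 deg by (simp add: mult.commute Suc_diff_le)
  next
    case 2
    have "\<not> first_nonzero (coeffs A) * first_nonzero (coeffs B) < 0"
      using b(5) a(5) deg 2 by (cases "even (?e + b)") (auto simp: mult_less_0_iff)
    then show ?thesis using a b 2 deg by simp
  qed
qed

lemma sgn_coeffs_pderiv:
  fixes g :: "real poly"
  assumes "g \<noteq> 0"
  shows "list_all2 (\<lambda>u v. sgn u = sgn v) (coeffs g) (coeffs (pderiv (pCons a g)))"
proof -
  have deg: "degree (pderiv (pCons a g)) = degree g"
    using assms degree_pderiv[of "pCons a g"] by simp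
  have "pderiv (pCons a g) \<noteq> 0" using assms by (auto simp: pderiv_eq_0_iff)
  then have l: "length (coeffs (pderiv (pCons a g))) = length (coeffs g)"
    using assms deg by (simp add: length_coeffs_degree)
  have "sgn (coeffs g ! i) = sgn (coeffs (pderiv (pCons a g)) ! i)" if "i < length (coeffs g)" for i
  proof -
    have i: "i \<le> degree g" using that assms by (simp add: length_coeffs_degree)
    have "coeffs g ! i = coeff g i" using assms i by (intro coeffs_nth) auto
    moreover have "coeffs (pderiv (pCons a g)) ! i = coeff (pderiv (pCons a g)) i"
      using \<open>pderiv (pCons a g) \<noteq> 0\<close> i deg by (intro coeffs_nth) auto
    ultimately show ?thesis by (simp add: coeff_pderiv sgn_mult)
  qed
  then show ?thesis using l by (simp add: list_all2_conv_all_nth)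
qed

text \<open>
  A polynomial interlaces with its derivative. Passing to the derivative removes the constant
  coefficient and keeps the signs of all others, so the sign changes obey the same recursion as the
  positive zeros in \<open>card_pos_zeros_interlaced\<close>.
\<close>

lemma Descartes_simple_real_roots:
  fixes A :: "real poly"
  assumes "strict_mono_on {..<degree A} x" "\<And>i. i < degree A \<Longrightarrow> poly A (x i) = 0" "lead_coeff A > 0"
  shows "strong_sign_changes (coeffs A) = card (pos_zeros A)"
  using assms
proof (induction "degree A" arbitrary: A x)
  case 0
  then obtain a where a: "A = [:a:]" by (metis degree_eq_zeroE)
  then show ?case using 0 by (auto simp: pos_zeros_def)
next
  case (Suc e)
  obtain a g where A: "A = pCons a g" by (cases A)
  have g: "g \<noteq> 0" using Suc.hyps(2) A by auto
  have degA: "degree A = Suc (degree g)" using A g by simp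
  have "interlaced A (pderiv A)"
    unfolding interlaced_def
  proof (intro exI[of _ x] conjI allI impI)
    fix i assume "i < degree A"
    then show "poly A (x i) = 0" "(-1) ^ (degree A + Suc i) * poly (pderiv A) (x i) > 0"
      using Suc.prems sign_pderiv_at_root by blast+
  qed (rule Suc.prems(1))
  moreover have degA': "degree (pderiv A) < degree A" using degA by (simp add: degree_pderiv)
  ultimately obtain x' y where "lead_coeff (pderiv A) > 0" "strict_mono_on {..<degree (pderiv A)} y"
    "\<And>i. i < degree (pderiv A) \<Longrightarrow> poly (pderiv A) (y i) = 0"
    using Suc.prems(3) by (elim interlaced_step_imp) blast+
  moreover have "e = degree (pderiv A)" using Suc.hyps(2) by (simp add: degree_pderiv)
  ultimately have IH: "strong_sign_changes (coeffs (pderiv A)) = card (pos_zeros (pderiv A))"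
    using Suc.hyps(1)[of "pderiv A" y] by blast
  note cong = sign_changes_cong[OF sgn_coeffs_pderiv[OF g, of a], folded A]
  have cA: "coeffs A = a # coeffs g" using A g by (simp add: coeffs_pCons_nonzero)
  have sg: "sgn (first_nonzero (coeffs g)) = sgn (first_nonzero (coeffs (pderiv A)))"
    using cong by blast
  have "a * first_nonzero (coeffs g) < 0 \<longleftrightarrow>
      first_nonzero (coeffs A) * first_nonzero (coeffs (pderiv A)) < 0"
  proof (cases "a = 0")
    case True
    then have "first_nonzero (coeffs A) = first_nonzero (coeffs g)" by (simp add: cA)
    then show ?thesis
      using True mult_neg_cong_sgn[OF refl sg, of "first_nonzero (coeffs g)"]
        not_square_less_zero[of "first_nonzero (coeffs g)"] by simp
  next
    case False
    then have "first_nonzero (coeffs A) = a" by (simp add: cA)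
    then show ?thesis using mult_neg_cong_sgn[OF refl sg, of a] by simp
  qed
  moreover have "strong_sign_changes (coeffs A) =
      (if a * first_nonzero (coeffs g) < 0 then 1 else 0) + strong_sign_changes (coeffs (pderiv A))"
    using cong by (simp add: cA)
  ultimately show ?case
    using card_pos_zeros_interlaced[OF \<open>interlaced A (pderiv A)\<close> degA' Suc.prems(3)] IH by simp
qed

text \<open>
  If \<open>A\<close> vanishes at \<open>0\<close>, then \<open>B(0) A'(0) > 0\<close> by the Wronskian inequality, so \<open>A\<close> and \<open>B\<close> have
  equally many positive zeros.
\<close>

lemma card_right_zeros_interlaced:
  assumes AB: "interlaced A B" "degree B < degree A" "lead_coeff A > 0"
  shows "coeff A 0 \<noteq> 0 \<Longrightarrow> strong_sign_changes (coeffs A) = card (right_zeros A)"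
    and "coeff A 0 \<noteq> 0 \<Longrightarrow> strong_sign_changes (coeff A 0 # coeffs B) = card (right_zeros A)"
    and "coeff A 0 = 0 \<Longrightarrow> strong_sign_changes (tl (coeffs A)) + 1 = card (right_zeros A)"
    and "coeff A 0 = 0 \<Longrightarrow> strong_sign_changes (coeffs B) + 1 = card (right_zeros A)"
proof -
  obtain x y where deg: "degree A = Suc (degree B)" and lcB: "lead_coeff B > 0"
    and x: "strict_mono_on {..<degree A} x" "\<And>i. i < degree A \<Longrightarrow> poly A (x i) = 0"
    and y: "strict_mono_on {..<degree B} y" "\<And>i. i < degree B \<Longrightarrow> poly B (y i) = 0"
    by (rule interlaced_step_imp[OF assms]) (rule that; assumption)
  have A0: "A \<noteq> 0" using AB by auto
  have finite: "finite (pos_zeros A)"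
    using poly_roots_finite[OF A0] by (rule finite_subset[rotated]) (auto simp: pos_zeros_def)
  note DA = Descartes_simple_real_roots[OF x AB(3)]
  note DB = Descartes_simple_real_roots[OF y lcB]
  note cnt = card_pos_zeros_interlaced[OF AB]
  have root0: "poly A 0 = coeff A 0" by (rule poly_0_coeff_0)
  obtain a g where A: "A = pCons a g" by (cases A)
  have g: "g \<noteq> 0" using deg A by auto
  have cA: "coeffs A = a # coeffs g" using A g by (simp add: coeffs_pCons_nonzero)
  {
    assume nz: "coeff A 0 \<noteq> 0"
    then have "right_zeros A = pos_zeros A"
      using root0 by (auto simp: right_zeros_def pos_zeros_def order_le_less)
    then show "strong_sign_changes (coeffs A) = card (right_zeros A)"
      "strong_sign_changes (coeff A 0 # coeffs B) = card (right_zeros A)"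
      using DA DB cnt nz cA A by auto
  }
  {
    assume z: "coeff A 0 = 0"
    then have "right_zeros A = insert 0 (pos_zeros A)"
      using root0 by (auto simp: right_zeros_def pos_zeros_def)
    then have card: "card (right_zeros A) = card (pos_zeros A) + 1"
      using finite by (simp add: pos_zeros_def)
    then show "strong_sign_changes (tl (coeffs A)) + 1 = card (right_zeros A)"
      using DA z cA A by simp
    have "poly B 0 * poly (pderiv A) 0 > 0"
      using interlaced_Wronskian_neg[OF AB, of 0] root0 z by simp
    then have pos: "coeff B 0 * coeff g 0 > 0" using A by (simp add: poly_0_coeff_0 pderiv_pCons)
    have first: "first_nonzero (coeffs q) = coeff q 0" if "coeff q 0 \<noteq> 0" for q
      using that by (cases q) (auto simp: cCons_def)
    have "first_nonzero (coeffs A) = coeff g 0" "first_nonzero (coeffs B) = coeff B 0"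
    proof -
      have "coeff g 0 \<noteq> 0" "coeff B 0 \<noteq> 0" using pos by auto
      then show "first_nonzero (coeffs A) = coeff g 0" "first_nonzero (coeffs B) = coeff B 0"
        using first[of g] first[of B] cA z A by auto
    qed
    then have "\<not> first_nonzero (coeffs A) * first_nonzero (coeffs B) < 0"
      using pos by (simp add: mult.commute)
    then show "strong_sign_changes (coeffs B) + 1 = card (right_zeros A)"
      using DB cnt card by simp
  }
qed

section \<open>The coefficient sequences and the theorem\<close>

lemma hcoeff_int: "hcoeff p (int m) = (if m \<le> degree p then coeff p (degree p - m) else 0)"
  by (simp add: hcoeff_def)

lemma step2_seq_unfold:
  assumes "m \<ge> 0"
  shows "step2_seq p m = hcoeff p m # step2_seq p (m - 2)"
proof (cases "m = 0")
  case True
  then show ?thesis by (simp add: step2_seq_def)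
next
  case False
  then have "[0..m] = [0..m - 2] @ [m - 1, m]"
    using assms upto_rec2[of 0 m] upto_rec2[of 0 "m - 1"] by (simp add: diff_diff_eq)
  moreover have "even (m - 2 - i) \<longleftrightarrow> even (m - i)" for i by presburger
  ultimately show ?thesis by (simp add: step2_seq_def)
qed

lemma step2_seq_map:
  assumes "m = 2 * int q - 1 \<or> m = 2 * int q - 2"
  shows "step2_seq p m = map (\<lambda>i. hcoeff p (m - 2 * int i)) [0..<q] @ [1]"
  using assms
proof (induction q arbitrary: m)
  case 0
  then show ?case by (auto simp: step2_seq_def)
next
  case (Suc q)
  have "step2_seq p m = hcoeff p m # step2_seq p (m - 2)"
    using Suc.prems by (intro step2_seq_unfold) auto
  also have "step2_seq p (m - 2) = map (\<lambda>i. hcoeff p (m - 2 - 2 * int i)) [0..<q] @ [1]"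
    using Suc.prems by (intro Suc.IH) auto
  also have "map (\<lambda>i. hcoeff p (m - 2 - 2 * int i)) [0..<q] =
      map (\<lambda>i. hcoeff p (m - 2 * int i)) (map Suc [0..<q])"
    by (simp add: algebra_simps)
  also have "map Suc [0..<q] = [1..<Suc q]" by (simp add: map_Suc_upt)
  finally show ?case by (simp add: upt_conv_Cons del: upt_Suc)
qed

text \<open>
  With \<open>q\<close> entries before the final \<open>1\<close>, the last of them has index \<open>1\<close> or \<open>0\<close>.
\<close>

lemma step2_seq_coeffs:
  assumes "int (degree p) - int j = 2 * int q - 1 \<or> int (degree p) - int j = 2 * int q - 2"
  shows "step2_seq p (int (degree p) - int j) = map (\<lambda>i. coeff p (2 * i + j)) [0..<q] @ [1]"
proof -
  have "hcoeff p (int (degree p) - int j - 2 * int i) = coeff p (2 * i + j)" if "i < q" for i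
  proof -
    have le: "2 * i + j \<le> degree p" using assms that by linarith
    then have eq: "int (degree p) - int j - 2 * int i = int (degree p - (2 * i + j))" by simp
    show ?thesis unfolding eq hcoeff_int using le by simp
  qed
  then show ?thesis unfolding step2_seq_map[OF assms] by simp
qed

lemma coeffs_map_upt: "p \<noteq> 0 \<Longrightarrow> degree p = d \<Longrightarrow> coeffs p = map (coeff p) [0..<Suc d]"
  by (simp add: coeffs_def)

text \<open>
  Interlacing consists of finitely many strict inequalities.
\<close>

lemma interlaced_small_perturbation:
  assumes "interlaced B (- P)"
  obtains \<eta> where "\<eta> > 0" "interlaced B (- (P + monom \<eta> d))"
proof -
  obtain x where x: "strict_mono_on {..<degree B} x" "\<And>i. i < degree B \<Longrightarrow> poly B (x i) = 0"
    "\<And>i. i < degree B \<Longrightarrow> (-1) ^ (degree B + Suc i) * poly (- P) (x i) > 0"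
    using assms by (elim interlacedE) blast
  have "eventually (\<lambda>\<eta>. (-1) ^ (degree B + Suc i) * poly (- (P + monom \<eta> d)) (x i) > 0) (at_right 0)"
    if "i < degree B" for i
  proof (rule order_tendstoD(1))
    show "((\<lambda>\<eta>. (-1) ^ (degree B + Suc i) * poly (- (P + monom \<eta> d)) (x i)) \<longlongrightarrow>
        (-1) ^ (degree B + Suc i) * (- (poly P (x i) + 0 * x i ^ d))) (at_right 0)"
      unfolding poly_minus poly_add poly_monom by (intro tendsto_intros)
    show "0 < (-1) ^ (degree B + Suc i) * (- (poly P (x i) + 0 * x i ^ d))"
      using x(3)[OF that] by (simp only: poly_minus mult_zero_left add_0_right)
  qed
  then have "eventually (\<lambda>\<eta>. \<forall>i\<in>{..<degree B}. (-1) ^ (degree B + Suc i) *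
      poly (- (P + monom \<eta> d)) (x i) > 0) (at_right 0)"
    by (intro eventually_ball_finite) auto
  moreover have "eventually (\<lambda>\<eta>::real. \<eta> > 0) (at_right 0)" by (rule eventually_at_right_less)
  ultimately have "eventually (\<lambda>\<eta>. (\<forall>i\<in>{..<degree B}. (-1) ^ (degree B + Suc i) *
      poly (- (P + monom \<eta> d)) (x i) > 0) \<and> \<eta> > 0) (at_right 0)"
    by (rule eventually_conj)
  then obtain \<eta> where "\<eta> > 0" "\<And>i. i < degree B \<Longrightarrow>
      (-1) ^ (degree B + Suc i) * poly (- (P + monom \<eta> d)) (x i) > 0"
    by (auto dest!: eventually_happens simp: trivial_limit_at_right_real simp del: poly_minus poly_add)
  then show ?thesis using that x unfolding interlaced_def by blast
qed

lemma all_dets_even_degree: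
  assumes "degree p = 2 * l"
  shows "(\<forall>j. 1 \<le> j \<and> j < degree p \<and> odd (degree p - j) \<longrightarrow> hurwitz_det p j > 0) \<longleftrightarrow>
    (\<forall>m<l. det (interleaved_mat (topcoeff l (even_part p)) (topcoeff (l - 1) (odd_part p)) (2 * m + 1)) > 0)"
proof -
  have "hcoeff p (2 * i) = topcoeff l (even_part p) i" for i
  proof (cases "0 \<le> i \<and> i \<le> int l")
    case True
    then obtain m where m: "i = int m" "m \<le> l" by (metis nonneg_int_cases of_nat_le_iff)
    have "hcoeff p (int (2 * m)) = coeff p (2 * l - 2 * m)"
      unfolding hcoeff_int using m assms by simp
    moreover have "2 * l - 2 * m = 2 * (l - m)" by (simp add: diff_mult_distrib2)
    ultimately show ?thesis using m by (simp add: topcoeff_def)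
  next
    case False
    then show ?thesis using assms by (auto simp: topcoeff_def hcoeff_def)
  qed
  moreover have "hcoeff p (2 * i + 1) = topcoeff (l - 1) (odd_part p) i" if l: "l > 0" for i
  proof (cases "0 \<le> i \<and> i \<le> int (l - 1)")
    case True
    then obtain m where m: "i = int m" "m \<le> l - 1" by (metis nonneg_int_cases of_nat_le_iff)
    have "hcoeff p (int (2 * m + 1)) = coeff p (2 * l - (2 * m + 1))"
      unfolding hcoeff_int using m l assms by simp
    moreover have "2 * l - (2 * m + 1) = 2 * (l - 1 - m) + 1" using m l by linarith
    moreover have "m < l" using m l by simp
    ultimately show ?thesis using m by (simp add: topcoeff_def add.commute)
  next
    case False
    then show ?thesis using assms l by (auto simp: topcoeff_def hcoeff_def)
  qed
  ultimately have "hurwitz_det p (2 * m + 1) =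
      det (interleaved_mat (topcoeff l (even_part p)) (topcoeff (l - 1) (odd_part p)) (2 * m + 1))"
    if "m < l" for m
    using that unfolding hurwitz_det_def hurwitz_matrix_eq_interleaved_mat by simp
  moreover have "(\<forall>j. 1 \<le> j \<and> j < degree p \<and> odd (degree p - j) \<longrightarrow> hurwitz_det p j > 0) \<longleftrightarrow>
      (\<forall>m<l. hurwitz_det p (2 * m + 1) > 0)"
  proof (intro iffI allI impI)
    fix j assume "\<forall>m<l. hurwitz_det p (2 * m + 1) > 0" "1 \<le> j \<and> j < degree p \<and> odd (degree p - j)"
    moreover from this have "odd j" using assms by auto
    ultimately show "hurwitz_det p j > 0" using assms by (elim oddE) auto
  next
    fix m assume "\<forall>j. 1 \<le> j \<and> j < degree p \<and> odd (degree p - j) \<longrightarrow> hurwitz_det p j > 0" "m < l"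
    then show "hurwitz_det p (2 * m + 1) > 0" using assms by auto
  qed
  ultimately show ?thesis by simp
qed

lemma all_dets_odd_degree:
  assumes "degree p = 2 * l + 1"
  shows "(\<forall>j. 1 \<le> j \<and> j < degree p \<and> odd (degree p - j) \<longrightarrow> hurwitz_det p j > 0) \<longleftrightarrow>
    (\<forall>m<l. det (interleaved_mat (topcoeff l (odd_part p)) (topcoeff l (even_part p)) (2 * m + 2)) > 0)"
proof -
  have "hcoeff p (2 * i) = topcoeff l (odd_part p) i \<and> hcoeff p (2 * i + 1) = topcoeff l (even_part p) i" for i
  proof (cases "0 \<le> i \<and> i \<le> int l")
    case True
    then obtain m where m: "i = int m" "m \<le> l" by (metis nonneg_int_cases of_nat_le_iff)
    have "hcoeff p (int (2 * m)) = coeff p (2 * l + 1 - 2 * m)"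
      "hcoeff p (int (2 * m + 1)) = coeff p (2 * l + 1 - (2 * m + 1))"
      unfolding hcoeff_int using m assms by simp_all
    moreover have "2 * l + 1 - 2 * m = 2 * (l - m) + 1" "2 * l + 1 - (2 * m + 1) = 2 * (l - m)"
      using m by linarith+
    ultimately show ?thesis using m by (simp add: topcoeff_def add.commute)
  next
    case False
    then show ?thesis using assms by (auto simp: topcoeff_def hcoeff_def)
  qed
  then have "hurwitz_det p (2 * m + 2) =
      det (interleaved_mat (topcoeff l (odd_part p)) (topcoeff l (even_part p)) (2 * m + 2))" for m
    unfolding hurwitz_det_def hurwitz_matrix_eq_interleaved_mat by simp
  moreover have "(\<forall>j. 1 \<le> j \<and> j < degree p \<and> odd (degree p - j) \<longrightarrow> hurwitz_det p j > 0) \<longleftrightarrow>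
      (\<forall>m<l. hurwitz_det p (2 * m + 2) > 0)"
  proof (intro iffI allI impI)
    fix j assume all: "\<forall>m<l. hurwitz_det p (2 * m + 2) > 0"
      and j: "1 \<le> j \<and> j < degree p \<and> odd (degree p - j)"
    then have "even j" using assms by auto
    then obtain i where "j = 2 * i" by (elim evenE)
    then obtain m where "j = 2 * m + 2" using j by (cases i) auto
    then show "hurwitz_det p j > 0" using all j assms by auto
  next
    fix m assume "\<forall>j. 1 \<le> j \<and> j < degree p \<and> odd (degree p - j) \<longrightarrow> hurwitz_det p j > 0" "m < l"
    then show "hurwitz_det p (2 * m + 2) > 0" using assms by auto
  qed
  ultimately show ?thesis by simp
qed

lemma right_zeros_alternating_iff_dets:
  assumes lc: "lead_coeff p > 0" and n: "degree p \<ge> 1"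
  shows "right_zeros_alternating p \<longleftrightarrow>
    (\<forall>j. 1 \<le> j \<and> j < degree p \<and> odd (degree p - j) \<longrightarrow> hurwitz_det p j > 0)"
proof (cases "even (degree p)")
  case True
  then obtain l where l: "degree p = 2 * l" by (elim evenE)
  have "right_zeros_alternating p \<longleftrightarrow> interlaced (even_part p) (odd_part p)"
    using n l by (intro right_zeros_alternating_iff_interlaced[OF lc l]) auto
  also have "\<dots> \<longleftrightarrow> (\<forall>m<l. det (interleaved_mat (topcoeff l (even_part p)) (topcoeff (l - 1) (odd_part p)) (2 * m + 1)) > 0)"
    using degree_even_part[OF l lc] lc l
    by (intro interlaced_iff_det_even_degree) (auto simp: coeff_eq_0)
  finally show ?thesis using all_dets_even_degree[OF l] by blast
next
  case False
  then obtain l where l: "degree p = 2 * l + 1" by (elim oddE)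
  have "right_zeros_alternating p \<longleftrightarrow> interlaced (odd_part p) (- even_part p)"
    by (rule odd_degree_characterization(1)[OF lc l])
  also have "\<dots> \<longleftrightarrow> (\<forall>m<l. det (interleaved_mat (topcoeff l (odd_part p)) (topcoeff l (even_part p)) (2 * m + 2)) > 0)"
    using degree_odd_part[OF l lc] lc l
    by (intro interlaced_iff_det_odd_degree) (auto intro!: degree_le simp: coeff_eq_0)
  finally show ?thesis using all_dets_odd_degree[OF l] by blast
qed

lemma sign_changes_append_1:
  assumes "lead_coeff p > 0"
  shows "strong_sign_changes (c # coeffs p @ [1]) = strong_sign_changes (c # coeffs p)"
    and "strong_sign_changes (coeffs p @ [1]) = strong_sign_changes (coeffs p)"
proof -
  have "p \<noteq> 0" using assms by auto
  then have "last (coeffs p) > 0" "coeffs p \<noteq> []" using assms by (simp_all add: last_coeffs_eq_coeff_degree)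
  then have "strong_sign_changes (coeffs p @ [1]) = strong_sign_changes (coeffs p) \<and>
      first_nonzero (coeffs p @ [1]) = first_nonzero (coeffs p)"
    by (intro sign_changes_append_pos) auto
  then show "strong_sign_changes (c # coeffs p @ [1]) = strong_sign_changes (c # coeffs p)"
    "strong_sign_changes (coeffs p @ [1]) = strong_sign_changes (coeffs p)" by simp_all
qed

text \<open>
  The order is the number of nonnegative zeros of the even part. Both lists end in the positive
  leading coefficient of the even or odd part, so the final \<open>1\<close> adds no sign change.
\<close>

lemma order_even_degree:
  assumes lc: "lead_coeff p > 0" and deg: "degree p = 2 * l" and l: "l > 0" and ok: "right_zeros_alternating p"
  defines "k \<equiv> card (right_zeros p)" and "n \<equiv> int (degree p)"
  shows "coeff p 0 \<noteq> 0 \<Longrightarrow> k = strong_sign_changes (step2_seq p n)"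
    and "coeff p 0 \<noteq> 0 \<Longrightarrow> k = strong_sign_changes (coeff p 0 # step2_seq p (n - 1))"
    and "coeff p 0 = 0 \<Longrightarrow> k = strong_sign_changes (step2_seq p (n - 2)) + 1"
    and "coeff p 0 = 0 \<Longrightarrow> k = strong_sign_changes (step2_seq p (n - 1)) + 1"
proof -
  define A where "A = even_part p"
  define B where "B = odd_part p"
  have A: "degree A = l" "lead_coeff A > 0"
    using degree_even_part[OF deg lc] lc by (auto simp: A_def)
  have degB: "degree B < degree A"
    unfolding A(1) B_def using deg l by (intro degree_lessI) (auto simp: coeff_eq_0)
  have AB: "interlaced A B" and k: "card (right_zeros A) = k"
    using right_zeros_alternating_imp_interlaced[OF lc deg ok] by (auto simp: A_def B_def k_def)
  have B: "degree A = Suc (degree B)" "lead_coeff B > 0"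
    using AB interlaced_step[OF degB A(2)] by auto
  have A0: "A \<noteq> 0" "B \<noteq> 0" using A B by auto
  note cnt = card_right_zeros_interlaced[OF AB degB A(2), unfolded k]
  have c0: "coeff A 0 = coeff p 0" by (simp add: A_def)
  obtain l' where l': "l = Suc l'" using l by (cases l) auto
  have s0: "step2_seq p n = coeffs A @ [1]"
    using step2_seq_coeffs[of p 0 "Suc l"] deg coeffs_map_upt[OF A0(1) A(1)] by (simp add: A_def n_def del: upt_Suc)
  have s1: "step2_seq p (n - 1) = coeffs B @ [1]"
    using step2_seq_coeffs[of p 1 l] deg coeffs_map_upt[OF A0(2), of l'] A(1) B(1) l'
    by (simp add: B_def n_def del: upt_Suc)
  have s2: "step2_seq p (n - 2) = tl (coeffs A) @ [1]"
  proof -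
    have "step2_seq p (n - 2) = map (\<lambda>i. coeff p (2 * i + 2)) [0..<l] @ [1]"
      using step2_seq_coeffs[of p 2 l] deg by (simp add: n_def)
    also have "map (\<lambda>i. coeff p (2 * i + 2)) [0..<l] = map (coeff A) (map Suc [0..<l])"
      by (simp add: A_def)
    also have "\<dots> = tl (coeffs A)"
      unfolding coeffs_map_upt[OF A0(1) A(1)] map_Suc_upt by (simp add: upt_conv_Cons map_tl[symmetric] del: upt_Suc)
    finally show ?thesis .
  qed
  note app = sign_changes_append_1[OF A(2)] sign_changes_append_1[OF B(2)]
  {
    assume nz: "coeff p 0 \<noteq> 0"
    show "k = strong_sign_changes (step2_seq p n)"
      using cnt(1) nz app(2) by (simp add: s0 c0)
    show "k = strong_sign_changes (coeff p 0 # step2_seq p (n - 1))"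
      unfolding s1 app(3) using cnt(2) nz unfolding c0 by simp
  }
  {
    assume z: "coeff p 0 = 0"
    have "coeffs A = 0 # tl (coeffs A)"
      unfolding coeffs_map_upt[OF A0(1) A(1)] using z c0 by (simp add: upt_conv_Cons del: upt_Suc)
    then have "strong_sign_changes (coeffs A @ [1]) = strong_sign_changes ((0 # tl (coeffs A)) @ [1])"
      "strong_sign_changes (coeffs A) = strong_sign_changes (0 # tl (coeffs A))" by (rule arg_cong)+
    then have "strong_sign_changes (tl (coeffs A) @ [1]) = strong_sign_changes (tl (coeffs A))"
      using app(2) by simp
    then show "k = strong_sign_changes (step2_seq p (n - 2)) + 1"
      using cnt(3) z by (simp add: s2 c0)
    show "k = strong_sign_changes (step2_seq p (n - 1)) + 1"
      unfolding s1 app(4) using cnt(4) z c0 by simp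
  }
qed

text \<open>
  The order is the number of nonnegative zeros of \<open>A = P + \<epsilon> u B\<close>, where \<open>P\<close> and \<open>B\<close> are the even and
  the odd part. The list that begins with the coefficients of \<open>P\<close> and ends in \<open>1\<close> has the signs of
  the coefficients of \<open>T = P + \<eta> u\<^sup>l\<^sup>+\<^sup>1\<close> instead. For small \<open>\<eta>\<close> also \<open>T\<close> interlaces with \<open>B\<close>,
  and as \<open>A\<close> and \<open>T\<close> agree at \<open>0\<close>, comparison with \<open>B\<close> shows that they have equally many nonnegative
  zeros.
\<close>

lemma order_odd_degree:
  assumes lc: "lead_coeff p > 0" and deg: "degree p = 2 * l + 1" and ok: "right_zeros_alternating p"
  defines "k \<equiv> card (right_zeros p)" and "n \<equiv> int (degree p)"
  shows "coeff p 0 \<noteq> 0 \<Longrightarrow> k = strong_sign_changes (step2_seq p n)"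
    and "coeff p 0 \<noteq> 0 \<Longrightarrow> k = strong_sign_changes (coeff p 0 # step2_seq p (n - 1))"
    and "coeff p 0 = 0 \<Longrightarrow> k = strong_sign_changes (step2_seq p (n - 2)) + 1"
    and "coeff p 0 = 0 \<Longrightarrow> k = strong_sign_changes (step2_seq p (n - 1)) + 1"
proof -
  define P where "P = even_part p"
  define B where "B = odd_part p"
  have B: "degree B = l" "lead_coeff B > 0"
    using degree_odd_part[OF deg lc] lc by (auto simp: B_def)
  have B0: "B \<noteq> 0" using B by auto
  have coeffP: "coeff P i = 0" if "i > l" for i
    using that deg by (simp add: P_def coeff_eq_0)
  have BP: "interlaced B (- P)"
    using odd_degree_characterization(1)[OF lc deg] ok by (simp add: B_def P_def)
  obtain A \<epsilon> where A: "degree A = Suc l" "lead_coeff A > 0" "\<epsilon> > 0"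
    "A = P + smult \<epsilon> (pCons 0 B)" "card (right_zeros A) = k"
    using odd_degree_characterization(2)[OF lc deg ok] unfolding P_def B_def k_def by blast
  have "interlaced B (- A)"
    using BP by (subst interlaced_cong[where C = "- P"]) (auto simp: A(4))
  then have AB: "interlaced A B" using interlaced_step[of B A] A B by auto
  have degBA: "degree B < degree A" using A B by simp
  obtain \<eta> where \<eta>: "\<eta> > 0" "interlaced B (- (P + monom \<eta> (Suc l)))"
    using interlaced_small_perturbation[OF BP] by blast
  define T where "T = P + monom \<eta> (Suc l)"
  have cT: "coeff T i = (if i = Suc l then \<eta> else coeff P i)" for i
    using coeffP[of "Suc l"] by (simp add: T_def)
  have degT: "degree T = Suc l"
  proof (rule antisym)
    show "degree T \<le> Suc l" using coeffP by (intro degree_le) (auto simp: cT)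
    show "Suc l \<le> degree T" using \<eta>(1) by (intro le_degree) (simp add: cT)
  qed
  have lcT: "lead_coeff T > 0" using degT \<eta>(1) by (simp add: cT)
  have TB: "interlaced T B"
    using interlaced_step[of B T] \<eta>(2) degT lcT B unfolding T_def[symmetric] by auto
  have degBT: "degree B < degree T" using degT B by simp
  note cntA = card_right_zeros_interlaced[OF AB degBA A(2), unfolded A(5)]
  note cntT = card_right_zeros_interlaced[OF TB degBT lcT]
  have T0: "T \<noteq> 0" using lcT by auto
  have c0: "coeff A 0 = coeff p 0" "coeff T 0 = coeff p 0" by (simp_all add: A(4) cT P_def)
  have kT: "k = card (right_zeros T)"
    using cntA(2,4) cntT(2,4) unfolding c0 by (cases "coeff p 0 = 0") simp_all
  have s1: "step2_seq p (n - 1) = coeffs B @ [1]"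
    using step2_seq_coeffs[of p 1 "Suc l"] deg coeffs_map_upt[OF B0 B(1)] by (simp add: B_def n_def del: upt_Suc)
  have s0: "step2_seq p n = map (coeff P) [0..<Suc l] @ [1]"
    using step2_seq_coeffs[of p 0 "Suc l"] deg by (simp add: P_def n_def del: upt_Suc)
  have s2: "step2_seq p (n - 2) = map (coeff P) [1..<Suc l] @ [1]"
  proof -
    have "step2_seq p (n - 2) = map (\<lambda>i. coeff p (2 * i + 2)) [0..<l] @ [1]"
      using step2_seq_coeffs[of p 2 l] deg by (simp add: n_def)
    also have "map (\<lambda>i. coeff p (2 * i + 2)) [0..<l] = map (coeff P) (map Suc [0..<l])"
      by (simp add: P_def)
    finally show ?thesis by (simp add: map_Suc_upt del: upt_Suc)
  qed
  have cTs: "coeffs T = map (coeff P) [0..<Suc l] @ [\<eta>]"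
    unfolding coeffs_map_upt[OF T0 degT] by (simp add: cT)
  have last: "strong_sign_changes (xs @ [1]) = strong_sign_changes (xs @ [\<eta>])" for xs
    using \<eta>(1) by (intro sign_changes_cong[THEN conjunct1] list_all2_appendI list_all2_refl) auto
  note app = sign_changes_append_1[OF B(2)]
  {
    assume nz: "coeff p 0 \<noteq> 0"
    show "k = strong_sign_changes (step2_seq p n)"
      unfolding s0 last kT cTs[symmetric] using cntT(1) nz unfolding c0 by simp
    show "k = strong_sign_changes (coeff p 0 # step2_seq p (n - 1))"
      unfolding s1 app(1) using cntA(2) nz unfolding c0 by simp
  }
  {
    assume z: "coeff p 0 = 0"
    have "tl (coeffs T) = map (coeff P) [1..<Suc l] @ [\<eta>]"
      unfolding cTs by (simp add: upt_conv_Cons del: upt_Suc)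
    then show "k = strong_sign_changes (step2_seq p (n - 2)) + 1"
      unfolding s2 last kT using cntT(3) z c0 by simp
    show "k = strong_sign_changes (step2_seq p (n - 1)) + 1"
      unfolding s1 app(2) using cntA(4) z c0 by simp
  }
qed

theorem theorem5p8:
  fixes p :: "real poly" and n :: nat
  assumes "degree p = n" and "n \<ge> 1" and "lead_coeff p > 0"
  defines "a \<equiv> hcoeff p"
  shows "(gen_hurwitz p \<longleftrightarrow> (\<forall>j. 1 \<le> j \<and> j < n \<and> odd (n - j) \<longrightarrow> hurwitz_det p j > 0)) \<and>
         (\<forall>k. gen_hurwitz_order p k \<longrightarrow>
            (a (int n) \<noteq> 0 \<longrightarrow>
               k = strong_sign_changes (step2_seq p (int n)) \<and>
               k = strong_sign_changes (a (int n) # step2_seq p (int n - 1))) \<and>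
            (a (int n) = 0 \<longrightarrow>
               k = strong_sign_changes (step2_seq p (int n - 2)) + 1 \<and>
               k = strong_sign_changes (step2_seq p (int n - 1)) + 1))"
proof (intro conjI allI impI)
  have an: "a (int n) = coeff p 0" using assms(1) by (simp add: a_def hcoeff_def)
  note order_iff = gen_hurwitz_order_iff[OF assms(3)]
  show "gen_hurwitz p \<longleftrightarrow> (\<forall>j. 1 \<le> j \<and> j < n \<and> odd (n - j) \<longrightarrow> hurwitz_det p j > 0)"
    using right_zeros_alternating_iff_dets[OF assms(3)] assms(1,2)
    unfolding gen_hurwitz_def order_iff by simp
  fix k assume "gen_hurwitz_order p k"
  then have ok: "right_zeros_alternating p" and k: "k = card (right_zeros p)"
    unfolding order_iff by auto
  have main: "(coeff p 0 \<noteq> 0 \<longrightarrow> k = strong_sign_changes (step2_seq p (int n)) \<and>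
      k = strong_sign_changes (coeff p 0 # step2_seq p (int n - 1))) \<and>
    (coeff p 0 = 0 \<longrightarrow> k = strong_sign_changes (step2_seq p (int n - 2)) + 1 \<and>
      k = strong_sign_changes (step2_seq p (int n - 1)) + 1)"
  proof (cases "even n")
    case True
    then obtain l where l: "degree p = 2 * l" using assms(1) by (elim evenE) auto
    then have "l > 0" using assms(1,2) by simp
    from order_even_degree[OF assms(3) l this ok] show ?thesis unfolding k assms(1)[symmetric] by blast
  next
    case False
    then obtain l where l: "degree p = 2 * l + 1" using assms(1) by (elim oddE) auto
    from order_odd_degree[OF assms(3) l ok] show ?thesis unfolding k assms(1)[symmetric] by blast
  qed
  {
    assume "a (int n) \<noteq> 0"
    then show "k = strong_sign_changes (step2_seq p (int n))"
      "k = strong_sign_changes (a (int n) # step2_seq p (int n - 1))"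
      using main unfolding an by blast+
  }
  {
    assume "a (int n) = 0"
    then show "k = strong_sign_changes (step2_seq p (int n - 2)) + 1"
      "k = strong_sign_changes (step2_seq p (int n - 1)) + 1"
      using main unfolding an by blast+
  }
qed

end
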